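(* Let $d\in\mathbb{N}$ and let $\mathcal{H}$ be a Hilbert space. Let $X$ be the space of all commuting $d$-tuples $\{T_i\}_{i=1}^d$ of contractive $C_0$-semigroups on $\mathcal{H}$ endowed with the topology $k_{\mathrm{WOT}}$ of uniform weak convergence on compact subsets of $\mathbb{R}_{\ge 0}^d$, and let $X^*\subseteq X$ be the set of those $d$-tuples which have strictly non-commuting free dilations. If $d\le 2$, then $X^*=\emptyset$. If $d\ge 3$ and $\mathcal{H}$ is infinite-dimensional, then $X^*\neq\emptyset$. If furthermore $\mathcal{H}$ is separable, then $X^*$ is residual in $(X,k_{\mathrm{WOT}})$, i.e. almost all (in the Baire-category sense) commuting $d$-tuples of contractive $C_0$-semigroups have strictly non-commuting free dilations.
   Context: Commuting means $T_i(s)T_j(t)=T_j(t)T_i(s)$ for all $i,j$ and $s,t\ge 0$. A commuting $d$-tuple corresponds to the semigroup $T(\mathbf{t})=\prod_{i=1}^dT_i(t_i)$, $\mathbf{t}\in\mathbb{R}_{\ge 0}^d$. The topology $k_{\mathrm{WOT}}$ on $X$ is given by: $\{T_i^{(\alpha)}\}_{i=1}^d\to\{T_i\}_{i=1}^d$ iff $\sup_{\mathbf{t}\in K}\big|\big\langle\big(\prod_{i=1}^dT_i^{(\alpha)}(t_i)-\prod_{i=1}^dT_i(t_i)\big)\xi,\eta\big\rangle\big|\to 0$ for every compact $K\subseteq\mathbb{R}_{\ge 0}^d$ and all $\xi,\eta\in\mathcal{H}$. A (continuous-time) free unitary dilation of $(\mathcal{H},\{T_i\}_{i=1}^d)$ is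 a triple $(\mathcal{H}',r,\{U_i\}_{i=1}^d)$ of a Hilbert space $\mathcal{H}'$, an isometry $r:\mathcal{H}\to\mathcal{H}'$ and strongly continuous unitary representations $U_i$ of $\mathbb{R}$ on $\mathcal{H}'$ such that $\prod_{k=1}^NT_{i_k}(t_k)=r^*\big(\prod_{k=1}^NU_{i_k}(t_k)\big)r$ for all $N\in\mathbb{N}$, all $(i_k)_{k=1}^N\subseteq\{1,\ldots,d\}$ and all $(t_k)_{k=1}^N\subseteq\mathbb{R}_{\ge 0}$ (products ordered left to right). $\{T_i\}_{i=1}^d\in X$ has strictly non-commuting free dilations if none of its free unitary dilations consists of commuting unitary representations. A subset is residual if its complement is meagre. *)

theory Defs
  imports "HOL-Analysis.Analysis" "HOL-Algebra.Module"
begin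

section \<open>Complex Hilbert spaces\<close>

text \<open>
  The given space \<open>\<H>\<close> is a type of class \<open>complex_hilbert\<close>. Its norm, topology and completeness
  are those of the library classes \<^class>\<open>real_inner\<close> and \<^class>\<open>complete_space\<close>; the real inner
  product is the real part of the complex one, which is linear in the first argument.
\<close>

class complex_hilbert = real_inner + complete_space +
  fixes scaleC :: "complex \<Rightarrow> 'a \<Rightarrow> 'a" (infixr "*\<^sub>C" 75)
    and cinner :: "'a \<Rightarrow> 'a \<Rightarrow> complex"
  assumes scaleC_add_right: "c *\<^sub>C (x + y) = c *\<^sub>C x + c *\<^sub>C y"
    and scaleC_add_left: "(c + c') *\<^sub>C x = c *\<^sub>C x + c' *\<^sub>C x"
    and scaleC_scaleC: "c *\<^sub>C c' *\<^sub>C x = (c * c') *\<^sub>C x"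
    and scaleC_of_real: "complex_of_real a *\<^sub>C x = a *\<^sub>R x"
    and cinner_commute: "cinner x y = cnj (cinner y x)"
    and cinner_add_left: "cinner (x + y) z = cinner x z + cinner y z"
    and cinner_scaleC_left: "cinner (c *\<^sub>C x) y = c * cinner x y"
    and Re_cinner: "Re (cinner x y) = inner x y"

definition infinite_dimensional :: "'h::complex_hilbert itself \<Rightarrow> bool" where
  "infinite_dimensional _ \<longleftrightarrow>
    \<not> (\<exists>B :: 'h set. finite_dimensional_vector_space ((*\<^sub>C) :: complex \<Rightarrow> 'h \<Rightarrow> 'h) B)"

text \<open>
  The Hilbert space of a dilation is existentially quantified, which a type cannot be. It is therefore
  a complex vector space on a carrier set (a HOL-Algebra module over the field of complex numbers)
  with an inner product. As for all HOL-Algebra modules, the multiplicative fields inherited from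
  the ring record are unused.
\<close>

definition complex_ring :: "complex ring" where
  "complex_ring = \<lparr>carrier = UNIV, mult = (*), one = 1, zero = 0, add = (+)\<rparr>"

record 'k cspace = "(complex, 'k) module" +
  cip :: "'k \<Rightarrow> 'k \<Rightarrow> complex"

definition cspace_norm :: "'k cspace \<Rightarrow> 'k \<Rightarrow> real" where
  "cspace_norm H x = sqrt (Re (cip H x x))"

text \<open>\<^locale>\<open>Metric_space\<close> requires a distance that is symmetric and nonnegative off the carrier as well.\<close>

definition cspace_dist :: "'k cspace \<Rightarrow> 'k \<Rightarrow> 'k \<Rightarrow> real" where
  "cspace_dist H x y =
     (if x \<in> carrier H \<and> y \<in> carrier H then cspace_norm H (x \<ominus>\<^bsub>H\<^esub> y) else 0)"

locale hilbert_space_on = module complex_ring H for H :: "'k cspace" (structure) +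
  assumes cip_commute:
      "\<lbrakk>x \<in> carrier H; y \<in> carrier H\<rbrakk> \<Longrightarrow> cip H x y = cnj (cip H y x)"
    and cip_add_left:
      "\<lbrakk>x \<in> carrier H; y \<in> carrier H; z \<in> carrier H\<rbrakk> \<Longrightarrow>
        cip H (x \<oplus> y) z = cip H x z + cip H y z"
    and cip_smult_left:
      "\<lbrakk>x \<in> carrier H; y \<in> carrier H\<rbrakk> \<Longrightarrow> cip H (c \<odot> x) y = c * cip H x y"
    and cip_ge_zero: "x \<in> carrier H \<Longrightarrow> 0 \<le> Re (cip H x x)"
    and cip_eq_zero: "\<lbrakk>x \<in> carrier H; cip H x x = 0\<rbrakk> \<Longrightarrow> x = \<zero>"
    and complete: "Metric_space.mcomplete (carrier H) (cspace_dist H)"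


section \<open>Commuting tuples of contractive semigroups\<close>

text \<open>
  Operators of a \<open>d\<close>-tuple are indexed by \<open>{1..d}\<close> and by times in \<open>{0..}\<close>. The extensionality
  requirements fix the values at all other arguments, so that a tuple of semigroups is represented
  by exactly one function.
\<close>

definition contractive_C0_semigroup :: "(real \<Rightarrow> 'h \<Rightarrow> 'h::complex_hilbert) \<Rightarrow> bool" where
  "contractive_C0_semigroup T \<longleftrightarrow>
     T \<in> extensional {0..} \<and>
     (\<forall>t\<ge>0. bounded_linear (T t) \<and> (\<forall>c x. T t (c *\<^sub>C x) = c *\<^sub>C T t x) \<and> onorm (T t) \<le> 1) \<and>
     T 0 = id \<and>
     (\<forall>s\<ge>0. \<forall>t\<ge>0. T (s + t) = T s \<circ> T t) \<and>
     (\<forall>x. continuous_on {0..} (\<lambda>t. T t x))"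

type_synonym 'h tuple = "nat \<Rightarrow> real \<Rightarrow> 'h \<Rightarrow> 'h"

definition commuting_tuples :: "nat \<Rightarrow> 'h::complex_hilbert tuple set" where
  "commuting_tuples d =
     {T \<in> extensional {1..d}.
        (\<forall>i\<in>{1..d}. contractive_C0_semigroup (T i)) \<and>
        (\<forall>i\<in>{1..d}. \<forall>j\<in>{1..d}. \<forall>s\<ge>0. \<forall>t\<ge>0. T i s \<circ> T j t = T j t \<circ> T i s)}"

text \<open>\<open>word_op T [(i\<^sub>1, t\<^sub>1), \<dots>, (i\<^sub>N, t\<^sub>N)] = T i\<^sub>1 t\<^sub>1 \<circ> \<dots> \<circ> T i\<^sub>N t\<^sub>N\<close>\<close>

definition word_op :: "(nat \<Rightarrow> real \<Rightarrow> 'b \<Rightarrow> 'b) \<Rightarrow> (nat \<times> real) list \<Rightarrow> 'b \<Rightarrow> 'b" where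
  "word_op T w = foldr (\<lambda>(i, t) f. T i t \<circ> f) w id"

definition tuple_op :: "nat \<Rightarrow> 'h tuple \<Rightarrow> (nat \<Rightarrow> real) \<Rightarrow> 'h \<Rightarrow> 'h" where
  "tuple_op d T t = word_op T (map (\<lambda>i. (i, t i)) [1..<Suc d])"


section \<open>The topology of uniform weak convergence on compact sets\<close>

definition times_space :: "nat \<Rightarrow> (nat \<Rightarrow> real) topology" where
  "times_space d = product_topology (\<lambda>_. top_of_set {0..}) {1..d}"

definition kwot_nbhd ::
  "nat \<Rightarrow> 'h::complex_hilbert tuple \<Rightarrow> (nat \<Rightarrow> real) set \<Rightarrow> ('h \<times> 'h) set \<Rightarrow> real \<Rightarrow> 'h tuple set" where
  "kwot_nbhd d T K F \<epsilon> =
     {S \<in> commuting_tuples d. \<forall>t\<in>K. \<forall>(\<xi>, \<eta>)\<in>F.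
        cmod (cinner (tuple_op d S t \<xi> - tuple_op d T t \<xi>) \<eta>) < \<epsilon>}"

definition kwot :: "nat \<Rightarrow> 'h::complex_hilbert tuple topology" where
  "kwot d = topology (\<lambda>U. U \<subseteq> commuting_tuples d \<and>
     (\<forall>T\<in>U. \<exists>K F \<epsilon>. compactin (times_space d) K \<and> finite F \<and> \<epsilon> > 0 \<and> kwot_nbhd d T K F \<epsilon> \<subseteq> U))"

lemma openin_kwot:
  "openin (kwot d) U \<longleftrightarrow> U \<subseteq> commuting_tuples d \<and>
     (\<forall>T\<in>U. \<exists>K F \<epsilon>. compactin (times_space d) K \<and> finite F \<and> \<epsilon> > 0 \<and> kwot_nbhd d T K F \<epsilon> \<subseteq> U)"
proof -
  define Q :: "'a tuple \<Rightarrow> 'a tuple set \<Rightarrow> bool" where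
    "Q = (\<lambda>T U. \<exists>K F \<epsilon>. compactin (times_space d) K \<and> finite F \<and> \<epsilon> > 0 \<and> kwot_nbhd d T K F \<epsilon> \<subseteq> U)"
  have Int: "Q T (U \<inter> V)" if U: "Q T U" and V: "Q T V" for T U V
  proof -
    obtain K F e where 1: "compactin (times_space d) K" "finite F" "e > 0" "kwot_nbhd d T K F e \<subseteq> U"
      using U unfolding Q_def by blast
    obtain K' F' e' where 2: "compactin (times_space d) K'" "finite F'" "e' > 0"
        "kwot_nbhd d T K' F' e' \<subseteq> V"
      using V unfolding Q_def by blast
    have "kwot_nbhd d T (K \<union> K') (F \<union> F') (min e e') \<subseteq> kwot_nbhd d T K F e \<inter> kwot_nbhd d T K' F' e'"
      unfolding kwot_nbhd_def by fastforce
    then have "kwot_nbhd d T (K \<union> K') (F \<union> F') (min e e') \<subseteq> U \<inter> V"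
      using 1(4) 2(4) by blast
    moreover have "compactin (times_space d) (K \<union> K')" "finite (F \<union> F')" "min e e' > 0"
      using 1 2 by (auto intro: compactin_Un)
    ultimately show ?thesis unfolding Q_def by blast
  qed
  have mono: "Q T V" if "Q T U" "U \<subseteq> V" for T U V
    using that unfolding Q_def by (meson order_trans)
  have "istopology (\<lambda>U. U \<subseteq> commuting_tuples d \<and> (\<forall>T\<in>U. Q T U))"
    unfolding istopology_def
  proof (intro conjI allI impI ballI)
    fix \<U> T assume \<U>: "\<forall>U\<in>\<U>. U \<subseteq> commuting_tuples d \<and> (\<forall>T\<in>U. Q T U)" and "T \<in> \<Union>\<U>"
    then obtain U where "U \<in> \<U>" "T \<in> U" by blast
    with \<U> show "Q T (\<Union>\<U>)" by (meson Union_upper mono)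
  qed (use Int in blast)+
  then show ?thesis
    by (simp add: kwot_def Q_def)
qed

lemma topspace_kwot [simp]: "topspace (kwot d) = commuting_tuples d"
proof (rule subset_antisym)
  show "topspace (kwot d) \<subseteq> commuting_tuples d"
    using openin_topspace[of "kwot d"] unfolding openin_kwot by blast
  have "compactin (times_space d) {}" "finite {}" "(0::real) < 1" by auto
  moreover have "kwot_nbhd d T K F e \<subseteq> commuting_tuples d" for T :: "'a tuple" and K F e
    by (auto simp: kwot_nbhd_def)
  ultimately have "openin (kwot d) (commuting_tuples d :: 'a tuple set)"
    unfolding openin_kwot by (metis subset_refl finite.emptyI)
  then show "commuting_tuples d \<subseteq> topspace (kwot d :: 'a tuple topology)"
    by (rule openin_subset)
qed

text \<open>
  Convergence in \<open>kwot d\<close> along any filter (in particular, of any net) is uniform weak convergence on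
  the compact subsets of the time domain, which determines the topology.
\<close>

lemma cinner_diff_left: "cinner (x - y) z = cinner x z - cinner y (z::'h::complex_hilbert)"
  by (metis add_diff_cancel cinner_add_left diff_add_cancel)

lemma limitin_kwot:
  fixes f :: "'a \<Rightarrow> 'h::complex_hilbert tuple"
  shows "limitin (kwot d) f T F \<longleftrightarrow>
    T \<in> commuting_tuples d \<and> (\<forall>\<^sub>F \<alpha> in F. f \<alpha> \<in> commuting_tuples d) \<and>
    (\<forall>K \<xi> \<eta>. compactin (times_space d) K \<longrightarrow>
       uniform_limit K (\<lambda>\<alpha> t. cinner (tuple_op d (f \<alpha>) t \<xi>) \<eta>) (\<lambda>t. cinner (tuple_op d T t \<xi>) \<eta>) F)"
    (is "?L \<longleftrightarrow> ?R")
proof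
  assume L: ?L
  then have T: "T \<in> commuting_tuples d"
    using limitin_topspace by fastforce
  have "openin (kwot d) (commuting_tuples d :: 'h tuple set)"
    by (metis openin_topspace topspace_kwot)
  then have ev: "\<forall>\<^sub>F \<alpha> in F. f \<alpha> \<in> commuting_tuples d"
    using L T by (auto simp: limitin_def)
  have "uniform_limit K (\<lambda>\<alpha> t. cinner (tuple_op d (f \<alpha>) t \<xi>) \<eta>) (\<lambda>t. cinner (tuple_op d T t \<xi>) \<eta>) F"
    if K: "compactin (times_space d) K" for K \<xi> \<eta>
    unfolding uniform_limit_iff
  proof (intro allI impI)
    fix e :: real assume e: "e > 0"
    define dv where "dv = (\<lambda>S R t. cmod (cinner (tuple_op d S t \<xi> - tuple_op d R t \<xi>) \<eta>))"
    have tri: "dv R T t \<le> dv R S t + dv S T t" for R S t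
    proof -
      have "cinner (tuple_op d R t \<xi> - tuple_op d T t \<xi>) \<eta> =
          cinner (tuple_op d R t \<xi> - tuple_op d S t \<xi>) \<eta> + cinner (tuple_op d S t \<xi> - tuple_op d T t \<xi>) \<eta>"
        by (simp add: cinner_diff_left)
      then show ?thesis unfolding dv_def by (metis norm_triangle_ineq)
    qed
    define V where "V = {S \<in> commuting_tuples d. \<exists>c<e. \<forall>t\<in>K. dv S T t \<le> c}"
    have "openin (kwot d) V"
      unfolding openin_kwot
    proof (intro conjI ballI)
      show "V \<subseteq> commuting_tuples d" by (auto simp: V_def)
    next
      fix S assume "S \<in> V"
      then obtain c where c: "c < e" "\<forall>t\<in>K. dv S T t \<le> c" by (auto simp: V_def)
      have "kwot_nbhd d S K {(\<xi>, \<eta>)} ((e - c) / 2) \<subseteq> V"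
      proof
        fix R assume R: "R \<in> kwot_nbhd d S K {(\<xi>, \<eta>)} ((e - c) / 2)"
        have bound: "dv R T t \<le> (e + c) / 2" if t: "t \<in> K" for t
        proof -
          have "dv R S t < (e - c) / 2"
            using R t by (auto simp: kwot_nbhd_def dv_def)
          moreover have "dv S T t \<le> c" using c t by blast
          ultimately show ?thesis using tri[of R t S] by (simp add: field_simps)
        qed
        have "R \<in> commuting_tuples d" using R by (simp add: kwot_nbhd_def)
        moreover have "(e + c) / 2 < e" using c(1) by simp
        ultimately show "R \<in> V"
          using bound unfolding V_def by blast
      qed
      moreover have "finite {(\<xi>, \<eta>)}" "(e - c) / 2 > 0" using c by auto
      ultimately show "\<exists>K F \<epsilon>. compactin (times_space d) K \<and> finite F \<and> \<epsilon> > 0 \<and> kwot_nbhd d S K F \<epsilon> \<subseteq> V"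
        using K by blast
    qed
    moreover have "T \<in> V"
    proof -
      have "\<forall>t\<in>K. dv T T t \<le> 0" by (simp add: dv_def cinner_diff_left)
      with T e show ?thesis unfolding V_def by blast
    qed
    ultimately have "\<forall>\<^sub>F \<alpha> in F. f \<alpha> \<in> V"
      using L by (auto simp: limitin_def)
    then show "\<forall>\<^sub>F \<alpha> in F. \<forall>t\<in>K.
        dist (cinner (tuple_op d (f \<alpha>) t \<xi>) \<eta>) (cinner (tuple_op d T t \<xi>) \<eta>) < e"
      by eventually_elim (force simp: V_def dv_def dist_norm cinner_diff_left)
  qed
  with T ev show ?R by blast
next
  assume R: ?R
  show ?L
    unfolding limitin_def
  proof (intro conjI allI impI)
    show "T \<in> topspace (kwot d)" using R by simp
  next
    fix U assume "openin (kwot d) U \<and> T \<in> U"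
    then obtain K F' e where *: "compactin (times_space d) K" "finite F'" "e > 0" "kwot_nbhd d T K F' e \<subseteq> U"
      unfolding openin_kwot by blast
    have "\<forall>\<^sub>F \<alpha> in F. \<forall>p\<in>F'. \<forall>t\<in>K. cmod (cinner (tuple_op d (f \<alpha>) t (fst p) - tuple_op d T t (fst p)) (snd p)) < e"
    proof (rule eventually_ball_finite[OF *(2)], rule ballI)
      fix p assume "p \<in> F'"
      have "uniform_limit K (\<lambda>\<alpha> t. cinner (tuple_op d (f \<alpha>) t (fst p)) (snd p))
          (\<lambda>t. cinner (tuple_op d T t (fst p)) (snd p)) F"
        using R * by blast
      then show "\<forall>\<^sub>F \<alpha> in F. \<forall>t\<in>K. cmod (cinner (tuple_op d (f \<alpha>) t (fst p) - tuple_op d T t (fst p)) (snd p)) < e"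
        using \<open>e > 0\<close> by (simp add: uniform_limit_iff dist_norm cinner_diff_left)
    qed
    moreover have "\<forall>\<^sub>F \<alpha> in F. f \<alpha> \<in> commuting_tuples d" using R by blast
    ultimately have "\<forall>\<^sub>F \<alpha> in F. f \<alpha> \<in> kwot_nbhd d T K F' e"
      by eventually_elim (auto simp: kwot_nbhd_def)
    then show "\<forall>\<^sub>F \<alpha> in F. f \<alpha> \<in> U"
      by eventually_elim (use * in blast)
  qed
qed


section \<open>Residual sets\<close>

definition nowhere_dense_in :: "'a topology \<Rightarrow> 'a set \<Rightarrow> bool" where
  "nowhere_dense_in X A \<longleftrightarrow> A \<subseteq> topspace X \<and> X interior_of (X closure_of A) = {}"

definition meagre_in :: "'a topology \<Rightarrow> 'a set \<Rightarrow> bool" where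
  "meagre_in X A \<longleftrightarrow> (\<exists>\<A>. countable \<A> \<and> (\<forall>B\<in>\<A>. nowhere_dense_in X B) \<and> A = \<Union>\<A>)"

definition residual_in :: "'a topology \<Rightarrow> 'a set \<Rightarrow> bool" where
  "residual_in X A \<longleftrightarrow> A \<subseteq> topspace X \<and> meagre_in X (topspace X - A)"


section \<open>Free unitary dilations\<close>

definition unitary_representation :: "'k cspace \<Rightarrow> (real \<Rightarrow> 'k \<Rightarrow> 'k) \<Rightarrow> bool" where
  "unitary_representation H U \<longleftrightarrow>
     (\<forall>t. bij_betw (U t) (carrier H) (carrier H) \<and>
        (\<forall>x\<in>carrier H. \<forall>y\<in>carrier H. U t (x \<oplus>\<^bsub>H\<^esub> y) = U t x \<oplus>\<^bsub>H\<^esub> U t y) \<and>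
        (\<forall>c. \<forall>x\<in>carrier H. U t (c \<odot>\<^bsub>H\<^esub> x) = c \<odot>\<^bsub>H\<^esub> U t x) \<and>
        (\<forall>x\<in>carrier H. \<forall>y\<in>carrier H. cip H (U t x) (U t y) = cip H x y)) \<and>
     (\<forall>x\<in>carrier H. U 0 x = x) \<and>
     (\<forall>s t. \<forall>x\<in>carrier H. U (s + t) x = U s (U t x)) \<and>
     (\<forall>x\<in>carrier H. \<forall>t. ((\<lambda>s. cspace_dist H (U s x) (U t x)) \<longlongrightarrow> 0) (at t))"

definition isometry_into :: "'k cspace \<Rightarrow> ('h::complex_hilbert \<Rightarrow> 'k) \<Rightarrow> bool" where
  "isometry_into H r \<longleftrightarrow>
     (\<forall>x. r x \<in> carrier H) \<and>
     (\<forall>x y. r (x + y) = r x \<oplus>\<^bsub>H\<^esub> r y) \<and>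
     (\<forall>c x. r (c *\<^sub>C x) = c \<odot>\<^bsub>H\<^esub> r x) \<and>
     (\<forall>x. cspace_norm H (r x) = norm x)"

definition is_adjoint :: "'k cspace \<Rightarrow> ('h::complex_hilbert \<Rightarrow> 'k) \<Rightarrow> ('k \<Rightarrow> 'h) \<Rightarrow> bool" where
  "is_adjoint H r r' \<longleftrightarrow> (\<forall>y\<in>carrier H. \<forall>x. cinner (r' y) x = cip H y (r x))"

definition free_unitary_dilation ::
  "nat \<Rightarrow> 'h::complex_hilbert tuple \<Rightarrow> 'k cspace \<Rightarrow> ('h \<Rightarrow> 'k) \<Rightarrow> (nat \<Rightarrow> real \<Rightarrow> 'k \<Rightarrow> 'k) \<Rightarrow> bool" where
  "free_unitary_dilation d T H r U \<longleftrightarrow>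
     hilbert_space_on H \<and> isometry_into H r \<and>
     (\<forall>i\<in>{1..d}. unitary_representation H (U i)) \<and>
     (\<exists>r'. is_adjoint H r r' \<and>
        (\<forall>w. set w \<subseteq> {1..d} \<times> {0..} \<longrightarrow> word_op T w = r' \<circ> word_op U w \<circ> r))"

definition commuting_representations ::
  "nat \<Rightarrow> 'k cspace \<Rightarrow> (nat \<Rightarrow> real \<Rightarrow> 'k \<Rightarrow> 'k) \<Rightarrow> bool" where
  "commuting_representations d H U \<longleftrightarrow>
     (\<forall>i\<in>{1..d}. \<forall>j\<in>{1..d}. \<forall>s t. \<forall>x\<in>carrier H. U i s (U j t x) = U j t (U i s x))"

text \<open>
  A formula cannot quantify over the types carrying the dilation space, so one type large enough is
  fixed. Lemma \<open>commuting_dilation_universe\<close> below shows that nothing is lost: if some Hilbert space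
  on some type carries a commuting free unitary dilation of \<open>T\<close>, then so does one on this type.
\<close>

type_synonym 'h universe = "(nat \<times> real) list \<times> 'h \<Rightarrow> complex"

definition strictly_noncommuting_tuples :: "nat \<Rightarrow> 'h::complex_hilbert tuple set" where
  "strictly_noncommuting_tuples d =
     {T \<in> commuting_tuples d. \<forall>(H :: 'h universe cspace) r U.
        free_unitary_dilation d T H r U \<longrightarrow> \<not> commuting_representations d H U}"


subsection \<open>Independence of the type carrying the dilation space\<close>

lemma complex_ring_simps [simp]:
  "carrier complex_ring = UNIV" "a \<otimes>\<^bsub>complex_ring\<^esub> b = a * b" "\<one>\<^bsub>complex_ring\<^esub> = 1"
  "\<zero>\<^bsub>complex_ring\<^esub> = 0" "a \<oplus>\<^bsub>complex_ring\<^esub> b = a + b"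
  by (simp_all add: complex_ring_def)

lemma cring_complex_ring: "cring complex_ring"
proof (rule cringI)
  show "abelian_group complex_ring"
    by (rule abelian_groupI) (auto intro: exI[of _ "- _"] left_minus)
  show "Group.comm_monoid complex_ring"
    by (rule Group.comm_monoidI) auto
qed (auto simp: algebra_simps)

context hilbert_space_on
begin

lemma smult_in [simp, intro]: "x \<in> carrier H \<Longrightarrow> c \<odot> x \<in> carrier H"
  using smult_closed[of c x] by simp

lemma cip_add_right:
  assumes "x \<in> carrier H" "y \<in> carrier H" "z \<in> carrier H"
  shows "cip H z (x \<oplus> y) = cip H z x + cip H z y"
  using assms cip_commute[of z "x \<oplus> y"] cip_commute[of z x] cip_commute[of z y]
  by (simp add: cip_add_left)

lemma cip_smult_right:
  assumes "x \<in> carrier H" "y \<in> carrier H"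
  shows "cip H x (c \<odot> y) = cnj c * cip H x y"
  using assms cip_commute[of x "c \<odot> y"] cip_commute[of x y] by (simp add: cip_smult_left)

lemma cip_zero_left [simp]: "x \<in> carrier H \<Longrightarrow> cip H \<zero> x = 0"
  using cip_add_left[of \<zero> \<zero> x] by simp

lemma cip_zero_right [simp]: "x \<in> carrier H \<Longrightarrow> cip H x \<zero> = 0"
  using cip_add_right[of \<zero> \<zero> x] by simp

lemma cip_minus_left:
  assumes "x \<in> carrier H" "y \<in> carrier H"
  shows "cip H (\<ominus> x) y = - cip H x y"
  using cip_add_left[of "\<ominus> x" x y] assms by (simp add: M.l_neg add_eq_0_iff)

lemma cip_minus_right:
  assumes "x \<in> carrier H" "y \<in> carrier H"
  shows "cip H x (\<ominus> y) = - cip H x y"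
  using cip_add_right[of "\<ominus> y" y x] assms by (simp add: M.l_neg add_eq_0_iff)

lemma cip_diff_left:
  assumes "x \<in> carrier H" "y \<in> carrier H" "z \<in> carrier H"
  shows "cip H (x \<ominus> y) z = cip H x z - cip H y z"
  using assms by (simp add: a_minus_def cip_add_left cip_minus_left)

lemma cip_diff_right:
  assumes "x \<in> carrier H" "y \<in> carrier H" "z \<in> carrier H"
  shows "cip H z (x \<ominus> y) = cip H z x - cip H z y"
  using assms by (simp add: a_minus_def cip_add_right cip_minus_right)

lemma cip_self_real: "x \<in> carrier H \<Longrightarrow> cip H x x = complex_of_real (Re (cip H x x))"
  using cip_commute[of x x] by (simp add: complex_eq_iff)

lemma diff_eq_zero:
  assumes "x \<in> carrier H" "y \<in> carrier H"
  shows "x \<ominus> y = \<zero> \<longleftrightarrow> x = y"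
proof
  assume "x \<ominus> y = \<zero>"
  then have "x = \<ominus> (\<ominus> y)"
    using assms M.minus_equality[of x "\<ominus> y"] by (simp add: a_minus_def)
  then show "x = y" using assms by simp
qed (use assms in \<open>simp add: a_minus_def M.r_neg\<close>)

lemma minus_as_smult: "x \<in> carrier H \<Longrightarrow> \<ominus> x = (-1) \<odot> x"
proof -
  assume x: "x \<in> carrier H"
  have "(-1) \<odot> x \<oplus> x = (-1 + 1) \<odot> x"
    using smult_l_distr[of "-1" 1 x] smult_one[of x] x by simp
  also have "\<dots> = \<zero>" using smult_l_null[of x] x by simp
  finally show ?thesis using x M.minus_equality[of "(-1) \<odot> x" x] by simp
qed

lemma cauchy_schwarz:
  assumes x: "x \<in> carrier H" and y: "y \<in> carrier H"
  shows "cmod (cip H x y) \<le> cspace_norm H x * cspace_norm H y"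
proof (cases "cip H y y = 0")
  case True
  then have "y = \<zero>" using y cip_eq_zero by blast
  then show ?thesis using x by (simp add: cspace_norm_def)
next
  case False
  define a b p where "a = Re (cip H x x)" and "b = Re (cip H y y)" and "p = cip H x y"
  have b: "cip H y y = complex_of_real b" "cip H x x = complex_of_real a"
    unfolding a_def b_def using x y by (auto intro: cip_self_real)
  have "b \<ge> 0" unfolding b_def using y by (rule cip_ge_zero)
  moreover have "b \<noteq> 0" using False b(1) by auto
  ultimately have "b > 0" by simp
  define c where "c = p / complex_of_real b"
  have yx: "cip H y x = cnj p" using cip_commute[OF y x] by (simp add: p_def)
  have "cip H (x \<ominus> c \<odot> y) (x \<ominus> c \<odot> y) =
      cip H x x - cnj c * p - c * cnj p + c * cnj c * cip H y y"
    using x y by (simp add: cip_diff_left cip_diff_right cip_smult_left cip_smult_right yx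
        p_def[symmetric] algebra_simps)
  also have "\<dots> = complex_of_real (a - (cmod p)\<^sup>2 / b)"
  proof -
    have pp: "p * cnj p = complex_of_real ((cmod p)\<^sup>2)" by (rule complex_norm_square[symmetric])
    have "cnj c * p = complex_of_real ((cmod p)\<^sup>2 / b)" "c * cnj p = complex_of_real ((cmod p)\<^sup>2 / b)"
      using pp by (simp_all add: c_def mult.commute)
    moreover have "c * cnj c * cip H y y = c * cnj p"
      using \<open>b > 0\<close> by (simp add: b c_def)
    ultimately show ?thesis by (simp add: b)
  qed
  finally have "a - (cmod p)\<^sup>2 / b \<ge> 0"
    using cip_ge_zero[of "x \<ominus> c \<odot> y"] x y by simp
  then have "(cmod p)\<^sup>2 \<le> a * b" using \<open>b > 0\<close> by (simp add: field_simps)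
  then have "cmod p \<le> sqrt (a * b)" by (simp add: real_le_rsqrt)
  then show ?thesis by (simp add: cspace_norm_def real_sqrt_mult a_def b_def p_def)
qed

lemma cspace_norm_nonneg [simp]: "x \<in> carrier H \<Longrightarrow> 0 \<le> cspace_norm H x"
  by (simp add: cspace_norm_def cip_ge_zero)

lemma cspace_norm_sq: "x \<in> carrier H \<Longrightarrow> (cspace_norm H x)\<^sup>2 = Re (cip H x x)"
  by (simp add: cspace_norm_def cip_ge_zero)

lemma cspace_norm_triangle:
  assumes x: "x \<in> carrier H" and y: "y \<in> carrier H"
  shows "cspace_norm H (x \<oplus> y) \<le> cspace_norm H x + cspace_norm H y"
proof (rule power2_le_imp_le)
  have "Re (cip H x y) \<le> cspace_norm H x * cspace_norm H y"
    using cauchy_schwarz[OF x y] complex_Re_le_cmod order_trans by blast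
  moreover have "Re (cip H y x) = Re (cip H x y)"
    using cip_commute[OF x y] by simp
  ultimately show "(cspace_norm H (x \<oplus> y))\<^sup>2 \<le> (cspace_norm H x + cspace_norm H y)\<^sup>2"
    using x y by (simp add: cspace_norm_sq power2_sum cip_add_left cip_add_right)
qed (use x y in auto)

lemma cspace_dist_eq:
  "\<lbrakk>x \<in> carrier H; y \<in> carrier H\<rbrakk> \<Longrightarrow> cspace_dist H x y = cspace_norm H (x \<ominus> y)"
  by (simp add: cspace_dist_def)

lemma metric_space_on: "Metric_space (carrier H) (cspace_dist H)"
proof
  show "0 \<le> cspace_dist H x y" for x y
    by (simp add: cspace_dist_def)
  show "cspace_dist H x y = cspace_dist H y x" for x y
    by (simp add: cspace_dist_def cspace_norm_def cip_diff_left cip_diff_right)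
  show "cspace_dist H x y = 0 \<longleftrightarrow> x = y" if "x \<in> carrier H" "y \<in> carrier H" for x y
  proof
    assume "cspace_dist H x y = 0"
    then have "Re (cip H (x \<ominus> y) (x \<ominus> y)) = 0"
      using that cspace_norm_sq[of "x \<ominus> y"] by (simp add: cspace_dist_eq)
    then have "x \<ominus> y = \<zero>"
      using that cip_eq_zero[of "x \<ominus> y"] by (metis M.minus_closed cip_self_real of_real_0)
    then show "x = y" using that diff_eq_zero by blast
  qed (use that diff_eq_zero[of x y] in \<open>simp add: cspace_dist_eq cspace_norm_def\<close>)
  show "cspace_dist H x z \<le> cspace_dist H x y + cspace_dist H y z"
    if "x \<in> carrier H" "y \<in> carrier H" "z \<in> carrier H" for x y z
  proof -
    have "x \<ominus> z = (x \<ominus> y) \<oplus> (y \<ominus> z)"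
      using that by (simp add: a_minus_def M.a_assoc M.r_neg1)
    then show ?thesis
      using that cspace_norm_triangle[of "x \<ominus> y" "y \<ominus> z"] by (simp add: cspace_dist_eq)
  qed
qed

end

definition transported_space :: "'k cspace \<Rightarrow> ('k \<Rightarrow> 'l) \<Rightarrow> 'k set \<Rightarrow> 'l cspace" where
  "transported_space H f K =
     \<lparr>carrier = f ` K, mult = (\<lambda>_ _. undefined), one = undefined, zero = f \<zero>\<^bsub>H\<^esub>,
      add = (\<lambda>a b. f (inv_into K f a \<oplus>\<^bsub>H\<^esub> inv_into K f b)),
      smult = (\<lambda>c a. f (c \<odot>\<^bsub>H\<^esub> inv_into K f a)),
      cip = (\<lambda>a b. cip H (inv_into K f a) (inv_into K f b))\<rparr>"

locale transported = hilbert_space_on H for H :: "'k cspace" (structure) +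
  fixes f :: "'k \<Rightarrow> 'l" and K :: "'k set"
  assumes inj: "inj_on f K" and K_sub: "K \<subseteq> carrier H" and K_zero: "\<zero> \<in> K"
    and K_add: "\<And>x y. \<lbrakk>x \<in> K; y \<in> K\<rbrakk> \<Longrightarrow> x \<oplus> y \<in> K"
    and K_smult: "\<And>c x. x \<in> K \<Longrightarrow> c \<odot> x \<in> K"
    and K_closed: "\<And>x. \<lbrakk>x \<in> carrier H;
        \<And>y. \<lbrakk>y \<in> carrier H; \<And>k. k \<in> K \<Longrightarrow> cip H k y = 0\<rbrakk> \<Longrightarrow> cip H x y = 0\<rbrakk> \<Longrightarrow> x \<in> K"
begin

abbreviation (input) L :: "'l cspace" where "L \<equiv> transported_space H f K"

lemma inv_f [simp]: "x \<in> K \<Longrightarrow> inv_into K f (f x) = x"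
  using inj by simp

lemma K_in [simp]: "x \<in> K \<Longrightarrow> x \<in> carrier H"
  using K_sub by blast

lemma K_minus: "x \<in> K \<Longrightarrow> \<ominus> x \<in> K"
  using K_smult minus_as_smult by simp

lemma K_diff: "\<lbrakk>x \<in> K; y \<in> K\<rbrakk> \<Longrightarrow> x \<ominus> y \<in> K"
  by (simp add: a_minus_def K_add K_minus)

lemma L_simps [simp]:
  "carrier L = f ` K"
  "\<zero>\<^bsub>L\<^esub> = f \<zero>"
  "\<lbrakk>x \<in> K; y \<in> K\<rbrakk> \<Longrightarrow> f x \<oplus>\<^bsub>L\<^esub> f y = f (x \<oplus> y)"
  "x \<in> K \<Longrightarrow> c \<odot>\<^bsub>L\<^esub> f x = f (c \<odot> x)"
  "\<lbrakk>x \<in> K; y \<in> K\<rbrakk> \<Longrightarrow> cip L (f x) (f y) = cip H x y"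
  by (simp_all add: transported_space_def)

lemma abelian_group_L: "abelian_group L"
proof (rule abelian_groupI)
  fix a assume "a \<in> carrier L"
  then obtain x where x: "a = f x" "x \<in> K" by auto
  then have "f (\<ominus> x) \<oplus>\<^bsub>L\<^esub> a = \<zero>\<^bsub>L\<^esub>" "f (\<ominus> x) \<in> carrier L"
    by (simp_all add: K_minus M.l_neg)
  then show "\<exists>y\<in>carrier L. y \<oplus>\<^bsub>L\<^esub> a = \<zero>\<^bsub>L\<^esub>" by blast
qed (auto simp: K_add K_zero M.a_ac)

lemma module_L: "Module.module complex_ring L"
proof (rule moduleI[OF cring_complex_ring abelian_group_L])
  show "(a \<oplus>\<^bsub>complex_ring\<^esub> b) \<odot>\<^bsub>L\<^esub> x = a \<odot>\<^bsub>L\<^esub> x \<oplus>\<^bsub>L\<^esub> b \<odot>\<^bsub>L\<^esub> x"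
    if "x \<in> carrier L" for a b x
    using that smult_l_distr by (auto simp: K_smult)
  show "a \<odot>\<^bsub>L\<^esub> (x \<oplus>\<^bsub>L\<^esub> y) = a \<odot>\<^bsub>L\<^esub> x \<oplus>\<^bsub>L\<^esub> a \<odot>\<^bsub>L\<^esub> y"
    if "x \<in> carrier L" "y \<in> carrier L" for a x y
    using that smult_r_distr by (auto simp: K_smult K_add)
  show "(a \<otimes>\<^bsub>complex_ring\<^esub> b) \<odot>\<^bsub>L\<^esub> x = a \<odot>\<^bsub>L\<^esub> (b \<odot>\<^bsub>L\<^esub> x)"
    if "x \<in> carrier L" for a b x
    using that smult_assoc1 by (auto simp: K_smult)
  show "\<one>\<^bsub>complex_ring\<^esub> \<odot>\<^bsub>L\<^esub> x = x" if "x \<in> carrier L" for x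
    using that smult_one by auto
qed (auto simp: K_smult)

lemma minus_L:
  assumes "x \<in> K" "y \<in> K"
  shows "f x \<ominus>\<^bsub>L\<^esub> f y = f (x \<ominus> y)"
proof -
  interpret L: abelian_group L by (rule abelian_group_L)
  have "\<ominus>\<^bsub>L\<^esub> f y = f (\<ominus> y)"
    by (rule L.minus_equality) (use assms in \<open>simp_all add: K_minus M.l_neg\<close>)
  then show ?thesis using assms by (simp add: a_minus_def K_minus)
qed

lemma dist_L:
  assumes "x \<in> K" "y \<in> K"
  shows "cspace_dist L (f x) (f y) = cspace_dist H x y"
  using assms by (simp add: cspace_dist_def cspace_norm_def minus_L K_diff)

lemma pre_hilbert_L:
  "\<lbrakk>x \<in> carrier L; y \<in> carrier L\<rbrakk> \<Longrightarrow> cip L x y = cnj (cip L y x)"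
  "\<lbrakk>x \<in> carrier L; y \<in> carrier L; z \<in> carrier L\<rbrakk> \<Longrightarrow> cip L (x \<oplus>\<^bsub>L\<^esub> y) z = cip L x z + cip L y z"
  "\<lbrakk>x \<in> carrier L; y \<in> carrier L\<rbrakk> \<Longrightarrow> cip L (c \<odot>\<^bsub>L\<^esub> x) y = c * cip L x y"
  "x \<in> carrier L \<Longrightarrow> 0 \<le> Re (cip L x x)"
  "\<lbrakk>x \<in> carrier L; cip L x x = 0\<rbrakk> \<Longrightarrow> x = \<zero>\<^bsub>L\<^esub>"
proof -
  assume "x \<in> carrier L" "y \<in> carrier L"
  then obtain a b where "x = f a" "y = f b" "a \<in> K" "b \<in> K" by auto
  then show "cip L x y = cnj (cip L y x)" using cip_commute[of a b] by simp
next
  assume "x \<in> carrier L" "y \<in> carrier L" "z \<in> carrier L"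
  then obtain a b c where "x = f a" "y = f b" "z = f c" "a \<in> K" "b \<in> K" "c \<in> K" by auto
  then show "cip L (x \<oplus>\<^bsub>L\<^esub> y) z = cip L x z + cip L y z" by (simp add: K_add cip_add_left)
next
  assume "x \<in> carrier L" "y \<in> carrier L"
  then show "cip L (c \<odot>\<^bsub>L\<^esub> x) y = c * cip L x y" by (auto simp: K_smult cip_smult_left)
next
  assume "x \<in> carrier L"
  then show "0 \<le> Re (cip L x x)" by (auto simp: cip_ge_zero)
next
  assume "x \<in> carrier L" "cip L x x = 0"
  then obtain a where a: "x = f a" "a \<in> K" "cip H a a = 0" by auto
  then have "a = \<zero>" using cip_eq_zero[of a] by simp
  then show "x = \<zero>\<^bsub>L\<^esub>" using a(1) by simp
qed

lemma metric_space_L: "Metric_space (carrier L) (cspace_dist L)"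
proof
  interpret H: Metric_space "carrier H" "cspace_dist H" by (rule metric_space_on)
  show "0 \<le> cspace_dist L x y" for x y
  proof (cases "x \<in> carrier L \<and> y \<in> carrier L")
    case True
    then obtain a b where "x = f a" "y = f b" "a \<in> K" "b \<in> K" by auto
    then show ?thesis by (simp add: dist_L)
  next
    case False
    then show ?thesis unfolding cspace_dist_def by (simp only: if_False order_refl)
  qed
  show "cspace_dist L x y = cspace_dist L y x" for x y
  proof (cases "x \<in> carrier L \<and> y \<in> carrier L")
    case True
    then obtain a b where "x = f a" "y = f b" "a \<in> K" "b \<in> K" by auto
    then show ?thesis by (simp add: dist_L H.commute)
  next
    case False
    then have "\<not> (y \<in> carrier L \<and> x \<in> carrier L)" by blast
    with False show ?thesis unfolding cspace_dist_def by (simp only: if_False)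
  qed
  show "cspace_dist L x y = 0 \<longleftrightarrow> x = y" if "x \<in> carrier L" "y \<in> carrier L" for x y
  proof -
    obtain a b where "x = f a" "y = f b" "a \<in> K" "b \<in> K" using \<open>x \<in> carrier L\<close> \<open>y \<in> carrier L\<close> by auto
    then show ?thesis using inj by (simp add: dist_L inj_on_eq_iff)
  qed
  show "cspace_dist L x z \<le> cspace_dist L x y + cspace_dist L y z"
    if xyz: "x \<in> carrier L" "y \<in> carrier L" "z \<in> carrier L" for x y z
  proof -
    obtain a b c where "x = f a" "y = f b" "z = f c" "a \<in> K" "b \<in> K" "c \<in> K" using xyz by auto
    then show ?thesis by (simp add: dist_L H.triangle)
  qed
qed

lemma complete_L: "Metric_space.mcomplete (carrier L) (cspace_dist L)"
proof -
  interpret H: Metric_space "carrier H" "cspace_dist H" by (rule metric_space_on)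
  interpret L: Metric_space "carrier L" "cspace_dist L" by (rule metric_space_L)
  show ?thesis
    unfolding L.mcomplete_def
  proof (intro allI impI)
    fix \<sigma> assume \<sigma>: "L.MCauchy \<sigma>"
    define \<tau> where "\<tau> = (\<lambda>n. inv_into K f (\<sigma> n))"
    have "range \<sigma> \<subseteq> carrier L" using \<sigma> unfolding L.MCauchy_def by blast
    then have "\<sigma> n \<in> f ` K" for n by auto
    then have \<tau>: "\<sigma> n = f (\<tau> n)" "\<tau> n \<in> K" for n
      unfolding \<tau>_def by (simp_all add: f_inv_into_f inv_into_into)
    have "H.MCauchy \<tau>"
      using \<sigma> \<tau> unfolding L.MCauchy_def H.MCauchy_def by (simp add: dist_L image_subset_iff)
    then obtain x where x: "limitin H.mtopology \<tau> x sequentially"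
      using complete unfolding H.mcomplete_def by blast
    then have xH: "x \<in> carrier H" by (simp add: H.limit_metric_sequentially)
    have lim: "\<exists>N. \<forall>n\<ge>N. cspace_dist H (\<tau> n) x < e" if "e > 0" for e
    proof -
      have "\<exists>N. \<forall>n\<ge>N. \<tau> n \<in> carrier H \<and> cspace_dist H (\<tau> n) x < e"
        using x that unfolding H.limit_metric_sequentially by blast
      then show ?thesis by blast
    qed
    have "x \<in> K"
    proof (rule K_closed[OF xH])
      fix y assume y: "y \<in> carrier H" "\<And>k. k \<in> K \<Longrightarrow> cip H k y = 0"
      have "cmod (cip H x y) \<le> 0"
      proof (rule field_le_epsilon)
        fix e :: real assume "e > 0"
        define M where "M = cspace_norm H y + 1"
        have "M > 0" unfolding M_def using cspace_norm_nonneg[OF y(1)] by linarith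
        then obtain n where n: "cspace_dist H (\<tau> n) x < e / M"
          using lim[of "e / M"] \<open>e > 0\<close> by auto
        have "cip H x y = - cip H (\<tau> n \<ominus> x) y"
          using \<tau>(2)[of n] xH y by (simp add: cip_diff_left)
        then have "cmod (cip H x y) \<le> cspace_norm H (\<tau> n \<ominus> x) * cspace_norm H y"
          using cauchy_schwarz[of "\<tau> n \<ominus> x" y] \<tau>(2)[of n] xH y(1) by simp
        also have "\<dots> \<le> (e / M) * M"
        proof (rule mult_mono)
          show "cspace_norm H (\<tau> n \<ominus> x) \<le> e / M"
            using n \<tau>(2)[of n] xH by (simp add: cspace_dist_eq)
          show "cspace_norm H y \<le> M" by (simp add: M_def)
        qed (use \<open>e > 0\<close> \<open>M > 0\<close> y(1) in auto)
        finally show "cmod (cip H x y) \<le> 0 + e" using \<open>M > 0\<close> by simp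
      qed
      then show "cip H x y = 0" by simp
    qed
    then have "limitin L.mtopology \<sigma> (f x) sequentially"
      unfolding L.limit_metric_sequentially using lim \<tau> by (simp add: dist_L)
    then show "\<exists>x. limitin L.mtopology \<sigma> x sequentially" by blast
  qed
qed

lemma hilbert_space_on_L: "hilbert_space_on L"
  by (intro hilbert_space_on.intro hilbert_space_on_axioms.intro module_L pre_hilbert_L complete_L)

lemma unitary_representation_L:
  assumes U: "unitary_representation H U" and UK: "\<And>t x. x \<in> K \<Longrightarrow> U t x \<in> K"
  shows "unitary_representation L (\<lambda>t a. f (U t (inv_into K f a)))"
proof -
  have bij: "bij_betw (\<lambda>a. f (U t (inv_into K f a))) (carrier L) (carrier L)" for t
  proof (rule bij_betwI)
    have *: "U t (U (- t) x) = x" "U (- t) (U t x) = x" if "x \<in> K" for x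
      using U that K_in[OF that] unfolding unitary_representation_def
      by (metis add.right_inverse, metis add.left_inverse)
    show "(\<lambda>a. f (U t (inv_into K f a))) \<in> carrier L \<rightarrow> carrier L"
      "(\<lambda>a. f (U (- t) (inv_into K f a))) \<in> carrier L \<rightarrow> carrier L"
      using UK by auto
    show "f (U (- t) (inv_into K f (f (U t (inv_into K f a))))) = a" if "a \<in> carrier L" for a
      using that UK * by auto
    show "f (U t (inv_into K f (f (U (- t) (inv_into K f a))))) = a" if "a \<in> carrier L" for a
      using that UK * by auto
  qed
  have "((\<lambda>s. cspace_dist L (f (U s x)) (f (U t x))) \<longlongrightarrow> 0) (at t)" if "x \<in> K" for x t
    using U that UK by (simp add: dist_L unitary_representation_def)
  then show ?thesis
    using U UK bij unfolding unitary_representation_def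
    by (simp add: K_add K_smult)
qed

end


theorem commuting_dilation_universe:
  fixes H :: "'k cspace" and T :: "'h::complex_hilbert tuple"
  assumes dil: "free_unitary_dilation d T H r U" and comm: "commuting_representations d H U"
  shows "\<exists>(H' :: 'h universe cspace) r' U'.
    free_unitary_dilation d T H' r' U' \<and> commuting_representations d H' U'"
proof -
  interpret hilbert_space_on H using dil by (simp add: free_unitary_dilation_def)
  have r: "isometry_into H r" and U: "\<And>i. i \<in> {1..d} \<Longrightarrow> unitary_representation H (U i)"
    using dil by (auto simp: free_unitary_dilation_def)
  obtain r' where r': "is_adjoint H r r'"
    and T: "\<And>w. set w \<subseteq> {1..d} \<times> {0..} \<Longrightarrow> word_op T w = r' \<circ> word_op U w \<circ> r"
    using dil by (auto simp: free_unitary_dilation_def)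
  have r_in [simp]: "r \<xi> \<in> carrier H" for \<xi> using r by (simp add: isometry_into_def)
  have U_in: "U i t x \<in> carrier H" if "i \<in> {1..d}" "x \<in> carrier H" for i t x
    using U[OF that(1)] that(2) unfolding unitary_representation_def by (meson bij_betwE)
  have U_cip: "cip H (U i t x) (U i t y) = cip H x y"
    if "i \<in> {1..d}" "x \<in> carrier H" "y \<in> carrier H" for i t x y
    using U[OF that(1)] that unfolding unitary_representation_def by blast
  have U_inv: "U i t (U i (- t) x) = x" if "i \<in> {1..d}" "x \<in> carrier H" for i t x
    using U[OF that(1)] that unfolding unitary_representation_def by (metis add.right_inverse)
  have U_adj: "cip H (U i t x) y = cip H x (U i (- t) y)"
    if "i \<in> {1..d}" "x \<in> carrier H" "y \<in> carrier H" for i t x y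
    using U_cip[of i x "U i (- t) y" t] U_inv[of i y t] U_in that by simp
  define W :: "(nat \<times> real) list set" where "W = lists ({1..d} \<times> UNIV)"
  have word_Cons: "word_op V ((i, t) # w) x = V i t (word_op V w x)"
    for V :: "nat \<Rightarrow> real \<Rightarrow> 'c \<Rightarrow> 'c" and i t w x by (simp add: word_op_def)
  have word_Nil: "word_op V [] x = x" for V :: "nat \<Rightarrow> real \<Rightarrow> 'c \<Rightarrow> 'c" and x
    by (simp add: word_op_def)
  have word_in: "word_op U w x \<in> carrier H" if "w \<in> W" "x \<in> carrier H" for w x
    using that(1) unfolding W_def
    by induction (use that(2) U_in in \<open>auto simp: word_Cons word_Nil\<close>)
  define M where "M = {word_op U w (r \<xi>) | w \<xi>. w \<in> W}"
  have M_in: "m \<in> carrier H" if "m \<in> M" for m using that word_in by (auto simp: M_def)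
  have M_U: "U i t m \<in> M" if "i \<in> {1..d}" "m \<in> M" for i t m
  proof -
    obtain w \<xi> where "m = word_op U w (r \<xi>)" "w \<in> W" using \<open>m \<in> M\<close> by (auto simp: M_def)
    then have "U i t m = word_op U ((i, t) # w) (r \<xi>)" "(i, t) # w \<in> W"
      using \<open>i \<in> {1..d}\<close> by (auto simp: word_Cons W_def)
    then show ?thesis unfolding M_def by blast
  qed
  define K where "K = {x \<in> carrier H. \<forall>y\<in>carrier H. (\<forall>m\<in>M. cip H m y = 0) \<longrightarrow> cip H x y = 0}"
  have M_K: "M \<subseteq> K" using M_in by (auto simp: K_def)
  have K_U: "U i t x \<in> K" if i: "i \<in> {1..d}" and x: "x \<in> K" for i t x
  proof -
    have xH: "x \<in> carrier H" using x by (simp add: K_def)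
    have "cip H (U i t x) y = 0" if y: "y \<in> carrier H" "\<forall>m\<in>M. cip H m y = 0" for y
    proof -
      have "\<forall>m\<in>M. cip H m (U i (- t) y) = 0"
        using U_adj[OF i M_in y(1)] M_U[OF i] y(2) by metis
      then have "cip H x (U i (- t) y) = 0"
        using x U_in[OF i y(1)] by (simp add: K_def)
      then show ?thesis using U_adj[OF i xH y(1)] by simp
    qed
    then show ?thesis using U_in[OF i xH] by (simp add: K_def)
  qed
  define f :: "'k \<Rightarrow> 'h universe" where
    "f = (\<lambda>x (w, \<xi>). if w \<in> W then cip H x (word_op U w (r \<xi>)) else 0)"
  interpret transported H f K
  proof
    show "inj_on f K"
    proof (rule inj_onI)
      fix x y assume xy: "x \<in> K" "y \<in> K" "f x = f y"
      have H: "x \<in> carrier H" "y \<in> carrier H" using xy by (auto simp: K_def)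
      then have xyH: "x \<ominus>\<^bsub>H\<^esub> y \<in> carrier H" by simp
      have *: "cip H m (x \<ominus>\<^bsub>H\<^esub> y) = 0" if "m \<in> M" for m
      proof -
        obtain w \<xi> where m: "m = word_op U w (r \<xi>)" "w \<in> W" using \<open>m \<in> M\<close> by (auto simp: M_def)
        have "f x (w, \<xi>) = f y (w, \<xi>)" using xy(3) by simp
        then have "cip H (x \<ominus>\<^bsub>H\<^esub> y) m = 0" using m H M_in[OF that] by (simp add: f_def cip_diff_left)
        then show ?thesis using cip_commute[OF M_in[OF that] xyH] by simp
      qed
      then have "cip H x (x \<ominus>\<^bsub>H\<^esub> y) = 0" "cip H y (x \<ominus>\<^bsub>H\<^esub> y) = 0"
        using xy xyH by (auto simp: K_def)
      then have "cip H (x \<ominus>\<^bsub>H\<^esub> y) (x \<ominus>\<^bsub>H\<^esub> y) = 0"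
        using H xyH by (simp add: cip_diff_left)
      then show "x = y" using cip_eq_zero[OF xyH] diff_eq_zero[OF H] by blast
    qed
  next
    fix x assume x: "x \<in> carrier H"
      and *: "\<And>y. \<lbrakk>y \<in> carrier H; \<And>k. k \<in> K \<Longrightarrow> cip H k y = 0\<rbrakk> \<Longrightarrow> cip H x y = 0"
    show "x \<in> K"
      unfolding K_def
    proof (intro CollectI conjI ballI impI x)
      fix y assume "y \<in> carrier H" "\<forall>m\<in>M. cip H m y = 0"
      then show "cip H x y = 0" by (intro *) (auto simp: K_def)
    qed
  qed (auto simp: K_def cip_add_left cip_smult_left)
  have r_K: "r \<xi> \<in> K" for \<xi>
  proof -
    have "r \<xi> \<in> M" unfolding M_def W_def by (auto intro!: exI[of _ "[]"] simp: word_Nil)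
    then show ?thesis using M_K by blast
  qed
  let ?L = "transported_space H f K"
  define V where "V = (\<lambda>i t a. f (U i t (inv_into K f a)))"
  have word_V: "word_op V w (f x) = f (word_op U w x) \<and> word_op U w x \<in> K"
    if "set w \<subseteq> {1..d} \<times> {0..}" "x \<in> K" for w x
    using that(1)
  proof (induction w)
    case (Cons p w)
    then obtain i t where "p = (i, t)" "i \<in> {1..d}" by auto
    with Cons show ?case using K_U by (simp add: word_Cons V_def)
  qed (use that in \<open>simp add: word_Nil\<close>)
  have "isometry_into ?L (f \<circ> r)"
    using r r_K by (simp add: isometry_into_def cspace_norm_def)
  moreover have "unitary_representation ?L (V i)" if "i \<in> {1..d}" for i
    unfolding V_def by (rule unitary_representation_L[OF U[OF that] K_U[OF that]])
  moreover have "is_adjoint ?L (f \<circ> r) (r' \<circ> inv_into K f)"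
    using r' r_K by (auto simp: is_adjoint_def)
  moreover have "word_op T w = (r' \<circ> inv_into K f) \<circ> word_op V w \<circ> (f \<circ> r)"
    if "set w \<subseteq> {1..d} \<times> {0..}" for w
  proof
    fix \<xi>
    have "word_op V w (f (r \<xi>)) = f (word_op U w (r \<xi>))" "word_op U w (r \<xi>) \<in> K"
      using word_V[OF that r_K] by blast+
    then show "word_op T w \<xi> = ((r' \<circ> inv_into K f) \<circ> word_op V w \<circ> (f \<circ> r)) \<xi>"
      using T[OF that] by simp
  qed
  ultimately have "free_unitary_dilation d T ?L (f \<circ> r) V"
    unfolding free_unitary_dilation_def using hilbert_space_on_L by blast
  moreover have "commuting_representations d ?L V"
    using comm K_U by (simp add: commuting_representations_def V_def)
  ultimately show ?thesis by blast
qed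

corollary no_commuting_dilation:
  fixes H :: "'k cspace" and T :: "'h::complex_hilbert tuple"
  assumes "T \<in> strictly_noncommuting_tuples d" "free_unitary_dilation d T H r U"
  shows "\<not> commuting_representations d H U"
  using assms commuting_dilation_universe[of d T H r U]
  by (auto simp: strictly_noncommuting_tuples_def)

end

theory Submission
  imports Defs
begin

text \<open>
  \<^bold>\<open>At most two semigroups.\<close> A commuting unitary dilation of \<open>(T\<^sub>1, T\<^sub>2)\<close> amounts to a positive
  semidefinite, translation-invariant kernel on \<open>\<real>\<^sup>2 \<times> \<H>\<close> that restricts to
  \<open>\<langle>T\<^sub>1(s) T\<^sub>2(t) \<xi>, \<eta>\<rangle>\<close> on the positive quadrant: its reproducing kernel Hilbert space carries the dilation,
  and the unitaries are the translations (locale \<open>translation_kernel\<close>). For the lattice generated by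
  two strict contractions, Ando's theorem provides such a kernel on \<open>\<int>\<^sup>2 \<times> \<H>\<close> (theorem \<open>psd_\<Phi>\<close>). Applied to
  \<open>T\<^sub>1(1/n)\<close> and \<open>T\<^sub>2(1/n)\<close>, damped by a factor tending to 1, and pulled back to \<open>\<real>\<^sup>2\<close> by rounding down, it gives
  kernels that are pointwise bounded in \<open>n\<close>; a cluster point, which exists by Tychonoff's theorem, is the
  desired kernel (theorem \<open>two_parameter_kernel\<close>). It is translation invariant because
  rounding shifts a lattice point by at most one step, and a step of length \<open>1/n\<close> moves vectors of \<open>\<H>\<close> by
  an amount tending to 0.

  Strictness of the contractions makes the defect forms \<open>\<langle>x, y\<rangle> - \<langle>T x, T y\<rangle>\<close> inner products
  equivalent to the given one, so that Ando's construction runs on copies of \<open>\<H>\<close> with these inner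
  products and no square roots of operators occur.

  \<^bold>\<open>Three and more semigroups.\<close> Parrott's example consists of three commuting contractions
  \<open>N\<^sub>1, N\<^sub>2, N\<^sub>3\<close> on \<open>\<complex>\<^sup>2 \<oplus> \<complex>\<^sup>2\<close> that map the first summand into the second. Commuting unitary dilations of
  these would have to coincide with them on vectors whose norm they preserve, and then could not
  commute. The semigroups \<open>e\<^bsup>-t/2\<^esup>(1 + t N\<^sub>i)\<close> are contractive, and a Moebius function of their time-\<open>\<tau>\<close> operator is
  \<open>N\<^sub>i\<close> up to a factor close to 1. The argument is stable: finitely many strict inequalities between matrix
  coefficients exclude a commuting dilation (theorem \<open>parrott_like_not_dilatable\<close>), so it
  yields an open set of tuples. This set is dense, because on an infinite-dimensional space the example can be
  added to any given tuple as a direct summand without changing its matrix coefficients on a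
  prescribed finite set of vectors (theorem \<open>parrott_like_dense\<close>): an isometry that fixes this set
  makes room for it. A set containing a dense open set is residual, and nonempty.
\<close>

section \<open>Complex Hilbert spaces\<close>

lemma cinner_add_right: "cinner x (y + z) = cinner x y + cinner x (z::'h::complex_hilbert)"
  by (metis cinner_add_left cinner_commute complex_cnj_add)

lemma cinner_scaleC_right: "cinner x (c *\<^sub>C y) = cnj c * cinner x (y::'h::complex_hilbert)"
  by (metis cinner_commute cinner_scaleC_left complex_cnj_mult)

lemma cinner_zero_left [simp]: "cinner 0 (y::'h::complex_hilbert) = 0"
  using cinner_add_left[of 0 0 y] by simp

lemma cinner_zero_right [simp]: "cinner (y::'h::complex_hilbert) 0 = 0"
  using cinner_add_right[of y 0 0] by simp

lemma cinner_minus_left: "cinner (- x) y = - cinner x (y::'h::complex_hilbert)"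
  using cinner_add_left[of "-x" x y] by (simp add: add_eq_0_iff)

lemma cinner_diff_right: "cinner z (x - y) = cinner z x - cinner z (y::'h::complex_hilbert)"
  by (metis add_diff_cancel cinner_add_right diff_add_cancel)

lemma cinner_minus_right: "cinner x (- y) = - cinner x (y::'h::complex_hilbert)"
  using cinner_add_right[of x "-y" y] by (simp add: add_eq_0_iff)

lemma cinner_scaleR_left: "cinner (a *\<^sub>R x) y = of_real a * cinner x (y::'h::complex_hilbert)"
  by (metis cinner_scaleC_left scaleC_of_real)

lemma cinner_scaleR_right: "cinner x (a *\<^sub>R y) = of_real a * cinner x (y::'h::complex_hilbert)"
  by (metis cinner_scaleC_right scaleC_of_real complex_cnj_complex_of_real)

lemma cinner_sum_left: "cinner (sum f A) (y::'h::complex_hilbert) = (\<Sum>i\<in>A. cinner (f i) y)"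
  by (induction A rule: infinite_finite_induct) (auto simp: cinner_add_left)

lemma cinner_sum_right: "cinner (y::'h::complex_hilbert) (sum f A) = (\<Sum>i\<in>A. cinner y (f i))"
  by (induction A rule: infinite_finite_induct) (auto simp: cinner_add_right)

lemmas cinner_simps = cinner_add_left cinner_add_right cinner_diff_left cinner_diff_right
  cinner_minus_left cinner_minus_right cinner_scaleC_left cinner_scaleC_right
  cinner_scaleR_left cinner_scaleR_right

lemma scaleC_one [simp]: "1 *\<^sub>C x = (x::'h::complex_hilbert)"
  using scaleC_of_real[of 1 x] by simp

lemma scaleC_zero [simp]: "0 *\<^sub>C x = (0::'h::complex_hilbert)"
  using scaleC_of_real[of 0 x] by simp

lemma scaleC_zero_right [simp]: "c *\<^sub>C 0 = (0::'h::complex_hilbert)"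
  using scaleC_add_right[of c 0 "0::'h"] by simp

lemma scaleC_diff_right: "c *\<^sub>C (x - y) = c *\<^sub>C x - c *\<^sub>C (y::'h::complex_hilbert)"
  by (metis add_diff_cancel diff_add_cancel scaleC_add_right)

lemma scaleC_scaleR: "c *\<^sub>C (a *\<^sub>R x) = a *\<^sub>R (c *\<^sub>C (x::'h::complex_hilbert))"
  by (metis scaleC_of_real scaleC_scaleC mult.commute)

lemma cinner_self: "cinner x x = of_real ((norm (x::'h::complex_hilbert))\<^sup>2)"
proof (rule complex_eqI)
  show "Re (cinner x x) = Re (of_real ((norm x)\<^sup>2))" by (simp add: Re_cinner power2_norm_eq_inner)
  show "Im (cinner x x) = Im (of_real ((norm x)\<^sup>2))"
    using cinner_commute[of x x] by (simp add: complex_eq_iff)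
qed

lemma norm_scaleC: "norm (c *\<^sub>C x) = cmod c * norm (x::'h::complex_hilbert)"
proof -
  have "of_real ((norm (c *\<^sub>C x))\<^sup>2) = (of_real ((cmod c * norm x)\<^sup>2) :: complex)"
    by (simp only: cinner_self[symmetric] cinner_scaleC_left cinner_scaleC_right)
      (simp only: cinner_self of_real_mult power_mult_distrib complex_norm_square mult.assoc mult.commute mult.left_commute)
  then show ?thesis by (simp only: of_real_eq_iff) (simp add: power2_eq_iff_nonneg)
qed

lemma cinner_bound: "cmod (cinner x y) \<le> norm x * norm (y::'h::complex_hilbert)"
proof (cases "cinner x y = 0")
  case False
  define c where "c = cnj (cinner x y) / of_real (cmod (cinner x y))"
  have "c * cinner x y = of_real (cmod (cinner x y))"
    using False complex_norm_square[of "cinner x y"]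
    by (simp add: c_def power2_eq_square nonzero_divide_eq_eq mult.commute)
  moreover have "cmod c = 1" using False by (simp add: c_def norm_divide)
  moreover have "Re (cinner (c *\<^sub>C x) y) \<le> norm (c *\<^sub>C x) * norm y"
    by (simp add: Re_cinner norm_cauchy_schwarz)
  ultimately show ?thesis by (simp add: cinner_scaleC_left norm_scaleC)
qed simp

lemma cinner_ext:
  assumes "\<And>y. cinner x y = cinner x' (y::'h::complex_hilbert)"
  shows "x = x'"
proof -
  have "cinner (x - x') (x - x') = 0" using assms by (simp add: cinner_diff_left)
  then show ?thesis by (simp add: cinner_self)
qed

lemma bounded_linear_cinner_left: "bounded_linear (\<lambda>x. cinner x (y::'h::complex_hilbert))"
  by (rule bounded_linear_intro[where K = "norm y"])
    (auto simp: cinner_add_left cinner_scaleR_left cinner_bound scaleR_conv_of_real)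

lemmas tendsto_cinner_left = bounded_linear.tendsto[OF bounded_linear_cinner_left]

text \<open>The Lax--Milgram theorem for symmetric forms: a minimising sequence of the energy
  \<open>B x x - 2 f x\<close> is Cauchy by the parallelogram identity, and the energy is stationary at its limit.
  Applied to an inner product other than the given one, it yields adjoints between renormed spaces.\<close>

lemma riesz_real:
  fixes B :: "'a::{real_inner,complete_space} \<Rightarrow> 'a \<Rightarrow> real" and f :: "'a \<Rightarrow> real"
  assumes B: "bounded_bilinear B" and sym: "\<And>x y. B x y = B y x"
    and coercive: "c > 0" "\<And>x. c * (norm x)\<^sup>2 \<le> B x x" and f: "bounded_linear f"
  shows "\<exists>z. \<forall>x. f x = B x z"
proof -
  interpret B: bounded_bilinear B by (rule B)
  interpret f: bounded_linear f by (rule f)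
  define J where "J = (\<lambda>x. B x x - 2 * f x)"
  obtain L where L: "\<And>x. norm (f x) \<le> norm x * L" "L \<ge> 0" using f.nonneg_bounded by blast
  have lower: "J x \<ge> - L\<^sup>2 / c" for x
  proof -
    have "f x \<le> norm x * L" using L(1)[of x] by simp
    then have "J x \<ge> c * (norm x)\<^sup>2 - 2 * (norm x * L)" using coercive(2)[of x] by (simp add: J_def)
    also have "c * (norm x)\<^sup>2 - 2 * (norm x * L) = (c * norm x - L)\<^sup>2 / c - L\<^sup>2 / c"
      using coercive(1) by (simp add: field_simps power2_eq_square)
    finally show ?thesis using coercive(1) by (smt (verit) divide_nonneg_pos minus_divide_left zero_le_power2)
  qed
  then have bdd: "bdd_below (range J)" by (auto intro!: bdd_belowI)
  define \<mu> where "\<mu> = Inf (range J)"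
  have mu: "\<mu> \<le> J x" for x unfolding \<mu>_def using bdd by (simp add: cInf_lower)
  have "\<exists>x. J x < \<mu> + inverse (real (Suc n))" for n
    using cInf_lessD[of "range J" "\<mu> + inverse (real (Suc n))"] unfolding \<mu>_def by auto
  then obtain x where x: "\<And>n. J (x n) < \<mu> + inverse (real (Suc n))" by metis
  have par: "c * (norm (y - z))\<^sup>2 \<le> 2 * (J y - \<mu>) + 2 * (J z - \<mu>)" for y z
  proof -
    have "B (y - z) (y - z) = 2 * J y + 2 * J z - 4 * J ((1/2) *\<^sub>R (y + z))"
      unfolding J_def B.diff_left B.diff_right B.scaleR_left B.scaleR_right B.add_left B.add_right
        f.scaleR f.add using sym[of y z] by (simp add: field_simps)
    then show ?thesis using coercive(2)[of "y - z"] mu[of "(1/2) *\<^sub>R (y + z)"] by simp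
  qed
  have "Cauchy x"
  proof (rule metric_CauchyI)
    fix e :: real assume "e > 0"
    then have "c * e\<^sup>2 / 4 > 0" using coercive by simp
    then obtain N where N: "inverse (real (Suc N)) < c * e\<^sup>2 / 4" using reals_Archimedean by blast
    have small: "J (x n) - \<mu> < c * e\<^sup>2 / 4" if "n \<ge> N" for n
    proof -
      have "inverse (real (Suc n)) \<le> inverse (real (Suc N))" using that by (simp add: field_simps)
      with x[of n] N show ?thesis by linarith
    qed
    show "\<exists>N. \<forall>m\<ge>N. \<forall>n\<ge>N. dist (x m) (x n) < e"
    proof (intro exI allI impI)
      fix m n assume "m \<ge> N" "n \<ge> N"
      then have "c * (norm (x m - x n))\<^sup>2 < c * e\<^sup>2"
        using par[of "x m" "x n"] small[of m] small[of n] by simp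
      then have "(norm (x m - x n))\<^sup>2 < e\<^sup>2" using coercive(1) by simp
      then show "dist (x m) (x n) < e" using \<open>e > 0\<close> by (simp add: dist_norm power_less_imp_less_base)
    qed
  qed
  then obtain z where z: "x \<longlonglongrightarrow> z" using Cauchy_convergent convergent_def by blast
  have "(\<lambda>n. J (x n)) \<longlonglongrightarrow> J z" unfolding J_def
    by (intro tendsto_intros B.tendsto f.tendsto z)
  moreover have "(\<lambda>n. \<mu> + inverse (real (Suc n))) \<longlonglongrightarrow> \<mu> + 0"
    by (intro tendsto_intros LIMSEQ_inverse_real_of_nat)
  ultimately have "J z \<le> \<mu> + 0"
    by (rule LIMSEQ_le) (use x in \<open>auto intro!: exI[of _ 0] less_imp_le simp del: of_nat_Suc\<close>)
  then have minimal: "J z \<le> J y" for y using mu[of y] by simp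
  have "f y = B y z" for y
  proof (rule ccontr)
    assume "f y \<noteq> B y z"
    define p where "p = B y z - f y"
    define b where "b = B y y"
    have "p \<noteq> 0" using \<open>f y \<noteq> B y z\<close> by (simp add: p_def)
    have expand: "J (z + t *\<^sub>R y) = J z + 2 * t * p + t\<^sup>2 * b" for t
      unfolding J_def B.add_left B.add_right B.scaleR_left B.scaleR_right f.add f.scaleR p_def b_def
      using sym[of y z] by (simp add: algebra_simps power2_eq_square)
    have "b \<ge> 0" using coercive(2)[of y] coercive(1) unfolding b_def by (smt (verit) mult_nonneg_nonneg zero_le_power2)
    have "0 \<le> 2 * t * p + t\<^sup>2 * b" for t using minimal[of "z + t *\<^sub>R y"] expand[of t] by simp
    then have "0 \<le> (2 * t * p + t\<^sup>2 * b) * (b + 1)\<^sup>2" for t by (simp add: mult_nonneg_nonneg)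
    moreover have "(2 * t * p + t\<^sup>2 * b) * (b + 1)\<^sup>2 =
        2 * (t * (b + 1)) * p * (b + 1) + (t * (b + 1))\<^sup>2 * b" for t
      by (simp add: algebra_simps power2_eq_square)
    ultimately have "0 \<le> 2 * (t * (b + 1)) * p * (b + 1) + (t * (b + 1))\<^sup>2 * b" for t by metis
    from this[of "- p / (b + 1)"] have "0 \<le> 2 * (- p) * p * (b + 1) + (- p)\<^sup>2 * b"
      using \<open>b \<ge> 0\<close> by simp
    also have "\<dots> = - (p\<^sup>2 * (b + 2))" by (simp add: algebra_simps power2_eq_square)
    finally have "p\<^sup>2 * (b + 2) \<le> 0" by simp
    then show False using \<open>b \<ge> 0\<close> \<open>p \<noteq> 0\<close> by (simp add: mult_le_0_iff)
  qed
  then show ?thesis by blast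
qed

theorem riesz_hermitian_form:
  fixes B :: "'h::complex_hilbert \<Rightarrow> 'h \<Rightarrow> complex" and f :: "'h \<Rightarrow> complex"
  assumes B: "bounded_bilinear B" and B_scaleC: "\<And>c x y. B (c *\<^sub>C x) y = c * B x y"
    and herm: "\<And>x y. B x y = cnj (B y x)"
    and coercive: "c > 0" "\<And>x. c * (norm x)\<^sup>2 \<le> Re (B x x)"
    and f: "bounded_linear f" and f_scaleC: "\<And>c x. f (c *\<^sub>C x) = c * f x"
  shows "\<exists>z. \<forall>x. f x = B x z"
proof -
  interpret B: bounded_bilinear B by (rule B)
  have "bounded_bilinear (\<lambda>x y. Re (B x y))"
  proof
    obtain K where "\<And>a b. norm (B a b) \<le> norm a * norm b * K" using B.bounded by blast
    then have "norm (Re (B a b)) \<le> norm a * norm b * K" for a b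
      using abs_Re_le_cmod[of "B a b"] by (metis order_trans real_norm_def)
    then show "\<exists>K. \<forall>a b. norm (Re (B a b)) \<le> norm a * norm b * K" by blast
  qed (simp_all add: B.add_left B.add_right B.scaleR_left B.scaleR_right)
  moreover have "Re (B x y) = Re (B y x)" for x y using herm[of x y] by simp
  moreover have "bounded_linear (\<lambda>x. Re (f x))"
    by (rule bounded_linear_compose[OF bounded_linear_Re f])
  ultimately obtain z where z: "\<And>x. Re (f x) = Re (B x z)"
    using riesz_real[of "\<lambda>x y. Re (B x y)" c "\<lambda>x. Re (f x)"] coercive by blast
  have "f x = B x z" for x
  proof (rule complex_eqI)
    show "Im (f x) = Im (B x z)" using z[of "\<i> *\<^sub>C x"] by (simp add: f_scaleC B_scaleC)
  qed (rule z)
  then show ?thesis by blast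
qed

lemma bounded_bilinear_cinner: "bounded_bilinear (cinner :: 'h::complex_hilbert \<Rightarrow> 'h \<Rightarrow> complex)"
  by standard (auto simp: cinner_simps scaleR_conv_of_real intro!: exI[of _ 1] cinner_bound)

corollary riesz:
  fixes f :: "'h::complex_hilbert \<Rightarrow> complex"
  assumes "bounded_linear f" "\<And>c x. f (c *\<^sub>C x) = c * f x"
  shows "\<exists>z. \<forall>x. f x = cinner x z"
  by (rule riesz_hermitian_form[OF bounded_bilinear_cinner _ _ _ _ assms, where c = 1])
    (auto simp: cinner_scaleC_left cinner_self intro: cinner_commute)

section \<open>Positive semidefinite kernels\<close>

text \<open>
  A list of pairs \<open>(c, x)\<close> is the formal combination \<open>\<Sum> c x\<close> of points; concatenation is addition. The
  sesquilinear extension of a kernel is thereby bilinear by definition, and positivity involves finite sums only.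
\<close>

definition kform :: "('x \<Rightarrow> 'x \<Rightarrow> complex) \<Rightarrow> (complex \<times> 'x) list \<Rightarrow> (complex \<times> 'x) list \<Rightarrow> complex" where
  "kform k l m = (\<Sum>(c, x)\<leftarrow>l. \<Sum>(d, y)\<leftarrow>m. c * cnj d * k x y)"

definition psd_kernel :: "('x \<Rightarrow> 'x \<Rightarrow> complex) \<Rightarrow> bool" where
  "psd_kernel k \<longleftrightarrow> (\<forall>x y. k x y = cnj (k y x)) \<and> (\<forall>l. 0 \<le> Re (kform k l l))"

lemma kform_Nil [simp]: "kform k [] m = 0" "kform k l [] = 0"
  by (auto simp: kform_def sum_list_0 split_def)

lemma kform_Cons_left: "kform k ((c, x) # l) m = c * kform k [(1, x)] m + kform k l m"
  by (simp add: kform_def sum_list_const_mult[symmetric] split_def mult.assoc)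

lemma kform_append_left: "kform k (l @ l') m = kform k l m + kform k l' m"
  by (simp add: kform_def)

lemma kform_append_right: "kform k l (m @ m') = kform k l m + kform k l m'"
  by (simp add: kform_def sum_list_addf split_def)

lemma kform_cong:
  assumes "\<And>x y. x \<in> snd ` set l \<Longrightarrow> y \<in> snd ` set m \<Longrightarrow> k x y = k' x y"
  shows "kform k l m = kform k' l m"
  unfolding kform_def split_def
  by (intro arg_cong[of _ _ sum_list] map_cong refl) (use assms in auto)

lemma kform_add: "kform (\<lambda>x y. k x y + k' x y) l m = kform k l m + kform k' l m"
  by (simp add: kform_def sum_list_addf split_def distrib_left)

lemma kform_sum: "kform (\<lambda>x y. \<Sum>n\<in>A. k n x y) l m = (\<Sum>n\<in>A. kform (k n) l m)"
proof (induction A rule: infinite_finite_induct)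
  case (insert n A) then show ?case by (simp add: kform_add)
qed (simp_all add: kform_def split_def)

lemma kform_cinner:
  fixes u :: "'x \<Rightarrow> 'h::complex_hilbert"
  shows "kform (\<lambda>x y. cinner (u x) (u y)) l m =
    cinner (\<Sum>(c, x)\<leftarrow>l. c *\<^sub>C u x) (\<Sum>(d, y)\<leftarrow>m. d *\<^sub>C u y)"
proof (induction l)
  case (Cons p l)
  have "(\<Sum>q\<leftarrow>m. fst p * cnj (fst q) * cinner (u (snd p)) (u (snd q))) =
      cinner (fst p *\<^sub>C u (snd p)) (\<Sum>(d, y)\<leftarrow>m. d *\<^sub>C u y)"
    by (induction m) (auto simp: cinner_simps algebra_simps)
  with Cons show ?case by (simp add: kform_def split_def cinner_add_left)
qed simp

section \<open>Ando's theorem for strict contractions\<close>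

text \<open>
  The inner product of the defect space of \<open>X\<close>: the square of the norm of \<open>(1 - X\<^sup>* X)\<^bsup>1/2\<^esup> x\<close> is \<open>defect_form X x x\<close>.
\<close>

definition defect_form :: "('h \<Rightarrow> 'h) \<Rightarrow> 'h \<Rightarrow> 'h::complex_hilbert \<Rightarrow> complex" where
  "defect_form X x y = cinner x y - cinner (X x) (X y)"

locale strict_contraction =
  fixes X :: "'h \<Rightarrow> 'h::complex_hilbert" and \<rho> :: real
  assumes bounded_linear: "bounded_linear X" and scaleC: "X (c *\<^sub>C x) = c *\<^sub>C X x"
    and rho: "0 \<le> \<rho>" "\<rho> < 1" and norm_le: "norm (X x) \<le> \<rho> * norm x"
begin

sublocale bounded_linear X by (rule bounded_linear)

lemma norm_le': "norm (X x) \<le> norm x"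
  using norm_le[of x] rho mult_right_mono[of \<rho> 1 "norm x"] by simp

lemma defect_bilinear: "bounded_bilinear (defect_form X)"
proof
  show "\<exists>K. \<forall>a b. norm (defect_form X a b) \<le> norm a * norm b * K"
  proof (intro exI allI)
    fix a b
    have "cmod (cinner (X a) (X b)) \<le> norm a * norm b"
      by (meson cinner_bound norm_le' mult_mono norm_ge_zero order_trans)
    then show "norm (defect_form X a b) \<le> norm a * norm b * 2"
      unfolding defect_form_def using norm_triangle_ineq4[of "cinner a b" "cinner (X a) (X b)"] cinner_bound[of a b] by linarith
  qed
qed (simp_all add: defect_form_def add scaleR cinner_simps algebra_simps scaleR_conv_of_real)

lemma defect_commute: "defect_form X x y = cnj (defect_form X y x)"
  unfolding defect_form_def using cinner_commute by (metis complex_cnj_diff)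

lemma defect_scaleC: "defect_form X (c *\<^sub>C x) y = c * defect_form X x y"
  by (simp add: defect_form_def scaleC cinner_simps algebra_simps)

lemma defect_coercive: "(1 - \<rho>\<^sup>2) * (norm x)\<^sup>2 \<le> Re (defect_form X x x)"
proof -
  have "(norm (X x))\<^sup>2 \<le> (\<rho> * norm x)\<^sup>2" using norm_le by (simp add: power_mono)
  then show ?thesis by (simp add: defect_form_def cinner_self power_mult_distrib algebra_simps)
qed

lemma coercive_pos: "1 - \<rho>\<^sup>2 > 0"
  using rho by (simp add: power_less_one_iff abs_square_less_1)

lemma defect_ext: 
  assumes "\<And>h. defect_form X h x = defect_form X h y"
  shows "x = y"
proof -
  interpret D: bounded_bilinear "defect_form X" by (rule defect_bilinear)
  have "defect_form X (x - y) (x - y) = 0" using assms by (simp add: D.diff_right)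
  then have "(norm (x - y))\<^sup>2 \<le> 0" using defect_coercive[of "x - y"] coercive_pos by (simp add: mult_le_0_iff)
  then show ?thesis by simp
qed

lemma kform_defect_nonneg: "0 \<le> Re (kform (\<lambda>x y. defect_form X (u x) (u y)) l l)"
proof -
  define z where "z = (\<Sum>(c, x)\<leftarrow>l. c *\<^sub>C u x)"
  have X: "X z = (\<Sum>(c, x)\<leftarrow>l. c *\<^sub>C X (u x))"
    unfolding z_def by (induction l) (auto simp: zero add scaleC)
  have "kform (\<lambda>x y. defect_form X (u x) (u y) + cinner (X (u x)) (X (u y))) l l = cinner z z"
    unfolding z_def by (simp add: defect_form_def kform_cinner[symmetric])
  then have "kform (\<lambda>x y. defect_form X (u x) (u y)) l l + kform (\<lambda>x y. cinner (X (u x)) (X (u y))) l l = cinner z z"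
    by (simp only: kform_add)
  moreover have "kform (\<lambda>x y. cinner (X (u x)) (X (u y))) l l = cinner (X z) (X z)"
    unfolding X by (rule kform_cinner)
  ultimately have "kform (\<lambda>x y. defect_form X (u x) (u y)) l l = defect_form X z z"
    unfolding defect_form_def[of X z z] by (metis add_diff_cancel_right')
  moreover have "0 \<le> (1 - \<rho>\<^sup>2) * (norm z)\<^sup>2" using coercive_pos by simp
  ultimately show ?thesis using defect_coercive[of z] by simp
qed

end

locale commuting_strict_contractions =
  T1: strict_contraction T1 \<rho> + T2: strict_contraction T2 \<rho>
  for T1 T2 :: "'h \<Rightarrow> 'h::complex_hilbert" and \<rho> +
  assumes commute: "T1 (T2 x) = T2 (T1 x)"
begin

sublocale T12: strict_contraction "\<lambda>x. T1 (T2 x)" \<rho>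
proof (rule strict_contraction.intro)
  show "bounded_linear (\<lambda>x. T1 (T2 x))"
    by (rule bounded_linear_compose[OF T1.bounded_linear T2.bounded_linear])
  show "norm (T1 (T2 x)) \<le> \<rho> * norm x" for x
    using T1.norm_le'[of "T2 x"] T2.norm_le[of x] by linarith
qed (use T1.rho in \<open>auto simp: T1.scaleC T2.scaleC\<close>)

abbreviation "d1 \<equiv> defect_form T1"
abbreviation "d2 \<equiv> defect_form T2"
abbreviation "d12 \<equiv> defect_form (\<lambda>x. T1 (T2 x))"

text \<open>
  The direct sum of the two defect spaces. It contains the defect space of the product in two ways:
  \<open>\<parallel>x\<parallel>\<^sup>2 - \<parallel>T\<^sub>1 T\<^sub>2 x\<parallel>\<^sup>2\<close> splits as \<open>(\<parallel>T\<^sub>2 x\<parallel>\<^sup>2 - \<parallel>T\<^sub>1 T\<^sub>2 x\<parallel>\<^sup>2) + (\<parallel>x\<parallel>\<^sup>2 - \<parallel>T\<^sub>2 x\<parallel>\<^sup>2)\<close>, which makes \<open>a\<close> isometric, and symmetrically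
  through \<open>T\<^sub>1 x\<close>, which makes \<open>b\<close> isometric.
\<close>

definition form2 :: "'h \<times> 'h \<Rightarrow> 'h \<times> 'h \<Rightarrow> complex" where
  "form2 u v = d1 (fst u) (fst v) + d2 (snd u) (snd v)"

definition a :: "'h \<Rightarrow> 'h \<times> 'h" where "a h = (T2 h, h)"
definition b :: "'h \<Rightarrow> 'h \<times> 'h" where "b h = (h, T1 h)"

sublocale D1: bounded_bilinear d1 by (rule T1.defect_bilinear)
sublocale D2: bounded_bilinear d2 by (rule T2.defect_bilinear)
sublocale D12: bounded_bilinear d12 by (rule T12.defect_bilinear)

lemma form2_zero [simp]: "form2 0 v = 0" "form2 u 0 = 0"
  by (simp_all add: form2_def D1.zero_left D1.zero_right D2.zero_left D2.zero_right)

lemma form2_add: "form2 (u + u') v = form2 u v + form2 u' v" "form2 u (v + v') = form2 u v + form2 u v'"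
  by (simp_all add: form2_def D1.add_left D2.add_left D1.add_right D2.add_right)

lemma form2_diff: "form2 (u - u') v = form2 u v - form2 u' v" "form2 u (v - v') = form2 u v - form2 u v'"
  by (simp_all add: form2_def D1.diff_left D2.diff_left D1.diff_right D2.diff_right)

lemma form2_commute: "form2 u v = cnj (form2 v u)"
  unfolding form2_def using T1.defect_commute T2.defect_commute by (metis complex_cnj_add)

lemma a_isometric: "form2 (a h) (a h') = d12 h h'"
  by (simp add: a_def form2_def defect_form_def)

lemma b_isometric: "form2 (b h) (b h') = d12 h h'"
  by (simp add: b_def form2_def defect_form_def commute)

lemma a_add: "a (h + h') = a h + a h'" and b_add: "b (h + h') = b h + b h'"
  by (simp_all add: a_def b_def T1.add T2.add)
lemma a_diff: "a (h - h') = a h - a h'" and b_diff: "b (h - h') = b h - b h'"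
  by (simp_all add: a_def b_def T1.diff T2.diff)
lemma a_minus: "a (- h) = - a h" and b_minus: "b (- h) = - b h"
  by (simp_all add: a_def b_def T1.neg T2.neg)

lemma form2_a_b_functional:
  "\<exists>z. \<forall>h. form2 (a h) u = d12 h z" "\<exists>z. \<forall>h. form2 (b h) u = d12 h z"
proof -
  note bl1 = D1.bounded_linear_left and bl2 = D2.bounded_linear_left
  have "bounded_linear (\<lambda>h. form2 (a h) u)"
    unfolding form2_def a_def fst_conv snd_conv
    by (intro bounded_linear_add bl2 bounded_linear_compose[OF bl1 T2.bounded_linear])
  moreover have "form2 (a (c *\<^sub>C h)) u = c * form2 (a h) u" for c h
    by (simp add: form2_def a_def T1.defect_scaleC T2.defect_scaleC T2.scaleC algebra_simps)
  ultimately show "\<exists>z. \<forall>h. form2 (a h) u = d12 h z"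
    by (intro riesz_hermitian_form[OF T12.defect_bilinear T12.defect_scaleC T12.defect_commute T12.coercive_pos T12.defect_coercive])
  have "bounded_linear (\<lambda>h. form2 (b h) u)"
    unfolding form2_def b_def fst_conv snd_conv
    by (intro bounded_linear_add bl1 bounded_linear_compose[OF bl2 T1.bounded_linear])
  moreover have "form2 (b (c *\<^sub>C h)) u = c * form2 (b h) u" for c h
    by (simp add: form2_def b_def T1.defect_scaleC T2.defect_scaleC T1.scaleC algebra_simps)
  ultimately show "\<exists>z. \<forall>h. form2 (b h) u = d12 h z"
    by (intro riesz_hermitian_form[OF T12.defect_bilinear T12.defect_scaleC T12.defect_commute T12.coercive_pos T12.defect_coercive])
qed

text \<open>
  The adjoints of \<open>a\<close> and \<open>b\<close> with respect to the defect inner products.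
\<close>

definition a' :: "'h \<times> 'h \<Rightarrow> 'h" where "a' u = (SOME z. \<forall>h. form2 (a h) u = d12 h z)"
definition b' :: "'h \<times> 'h \<Rightarrow> 'h" where "b' u = (SOME z. \<forall>h. form2 (b h) u = d12 h z)"

lemma a'_adjoint: "form2 (a h) u = d12 h (a' u)"
  unfolding a'_def using someI_ex[OF form2_a_b_functional(1)] by blast
lemma b'_adjoint: "form2 (b h) u = d12 h (b' u)"
  unfolding b'_def using someI_ex[OF form2_a_b_functional(2)] by blast

lemma a'_adjoint': "form2 u (a h) = d12 (a' u) h"
  by (metis a'_adjoint form2_commute T12.defect_commute)
lemma b'_adjoint': "form2 u (b h) = d12 (b' u) h"
  by (metis b'_adjoint form2_commute T12.defect_commute)

lemma a'_a [simp]: "a' (a h) = h"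
  by (rule T12.defect_ext) (simp add: a'_adjoint[symmetric] a_isometric)
lemma b'_b [simp]: "b' (b h) = h"
  by (rule T12.defect_ext) (simp add: b'_adjoint[symmetric] b_isometric)

lemma a'_add: "a' (u + v) = a' u + a' v"
  by (rule T12.defect_ext) (simp add: a'_adjoint[symmetric] D12.add_right form2_add)
lemma b'_add: "b' (u + v) = b' u + b' v"
  by (rule T12.defect_ext) (simp add: b'_adjoint[symmetric] D12.add_right form2_add)
lemma a'_diff: "a' (u - v) = a' u - a' v"
  by (rule T12.defect_ext) (simp add: a'_adjoint[symmetric] D12.diff_right form2_diff)
lemma b'_diff: "b' (u - v) = b' u - b' v"
  by (rule T12.defect_ext) (simp add: b'_adjoint[symmetric] D12.diff_right form2_diff)

lemmas ab_simps = a_add b_add a_diff b_diff a_minus b_minus a'_add b'_add a'_diff b'_diff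

type_synonym 'k block = "('k \<times> 'k) \<times> ('k \<times> 'k)"

definition form4 :: "'h block \<Rightarrow> 'h block \<Rightarrow> complex" where
  "form4 x y = form2 (fst x) (fst y) + form2 (snd x) (snd y)"

text \<open>
  Halmos' unitary dilation of the partial isometry \<open>b a'\<close>. Its defect operators \<open>1 - b b'\<close> and \<open>1 - a a'\<close> are
  projections, hence their own square roots. It is a unitary that extends \<open>a h \<mapsto> b h\<close>, as Ando's
  construction requires.
\<close>

definition G :: "'h block \<Rightarrow> 'h block" where
  "G x = (b (a' (fst x)) + snd x - b (b' (snd x)), fst x - a (a' (fst x)) - a (b' (snd x)))"

definition Gi :: "'h block \<Rightarrow> 'h block" where
  "Gi x = (a (b' (fst x)) + snd x - a (a' (snd x)), fst x - b (b' (fst x)) - b (a' (snd x)))"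

lemma Gi_G [simp]: "Gi (G x) = x"
  by (simp add: G_def Gi_def ab_simps prod_eq_iff)

lemma G_Gi [simp]: "G (Gi x) = x"
  by (simp add: G_def Gi_def ab_simps prod_eq_iff)

lemma G_adjoint: "form4 (G x) y = form4 x (Gi y)"
  by (simp add: form4_def G_def Gi_def form2_add form2_diff a'_adjoint b'_adjoint a'_adjoint' b'_adjoint')

lemma G_isometric: "form4 (G x) (G y) = form4 x y"
  by (simp add: G_adjoint)

lemma Gi_isometric: "form4 (Gi x) (Gi y) = form4 x y"
  by (simp add: G_adjoint[symmetric])

lemma G_zero: "G 0 = 0" and Gi_zero: "Gi 0 = 0"
proof -
  have z: "a 0 = 0" "b 0 = 0" "a' 0 = 0" "b' 0 = 0"
    using a_diff[of 0 0] b_diff[of 0 0] a'_diff[of 0 0] b'_diff[of 0 0] by simp_all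
  show "G 0 = 0" "Gi 0 = 0" by (simp_all add: G_def Gi_def z zero_prod_def[symmetric])
qed

lemma G_a: "G (a h, 0) = (b h, 0)"
  using a'_diff[of 0 0] b'_diff[of 0 0] b_diff[of 0 0] a_diff[of 0 0] by (simp add: G_def)

text \<open>
  The components in the first defect space come from \<open>u\<close>, those in the second from \<open>v\<close>: these are the two
  complementary projections of the Berger--Coburn--Lebow model.
\<close>

definition mix :: "'h block \<Rightarrow> 'h block \<Rightarrow> 'h block" where
  "mix u v = ((fst (fst u), snd (fst v)), (fst (snd u), snd (snd v)))"

definition formQ :: "'h block \<Rightarrow> 'h block \<Rightarrow> complex" where
  "formQ u v = d1 (fst (fst u)) (fst (fst v)) + d1 (fst (snd u)) (fst (snd v))"
definition formP :: "'h block \<Rightarrow> 'h block \<Rightarrow> complex" where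
  "formP u v = d2 (snd (fst u)) (snd (fst v)) + d2 (snd (snd u)) (snd (snd v))"

lemma form4_split: "form4 u v = formQ u v + formP u v"
  by (simp add: form4_def formQ_def formP_def form2_def)

lemma form4_mix: "form4 (mix u v) (mix u' v') = formQ u u' + formP v v'"
  by (simp add: form4_split formQ_def formP_def mix_def)

lemma mix_mix [simp]: "mix (mix u v) w = mix u w" "mix u (mix v w) = mix u w" "mix u u = u"
  by (simp_all add: mix_def)

lemma form_zero [simp]: "formQ 0 v = 0" "formP 0 v = 0" "form4 0 v = 0" "mix 0 0 = 0" "form4 v 0 = 0"
  by (simp_all add: formQ_def formP_def form4_def mix_def D1.zero_left D2.zero_left zero_prod_def[symmetric])

type_synonym 'k vec = "'k \<times> (nat \<Rightarrow> 'k block)"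

text \<open>
  Ando's commuting isometric dilations in Berger--Coburn--Lebow form. With \<open>P\<close> the projection onto the
  components in the second defect space and \<open>z\<close> the shift of the sequence, they act on the sequence as
  \<open>G (P + z P\<^sup>\<bottom>)\<close> and \<open>(P\<^sup>\<bottom> + z P) G\<inverse>\<close>, both of whose products are \<open>z\<close>. The component that the shift
  leaves empty receives the defect of the contraction.
\<close>

definition V1 :: "'h vec \<Rightarrow> 'h vec" where
  "V1 x = (T1 (fst x), \<lambda>n. G (mix (case n of 0 \<Rightarrow> ((fst x, 0), 0) | Suc k \<Rightarrow> snd x k) (snd x n)))"

definition V2 :: "'h vec \<Rightarrow> 'h vec" where
  "V2 x = (T2 (fst x), \<lambda>n. mix (Gi (snd x n)) (case n of 0 \<Rightarrow> ((0, fst x), 0) | Suc k \<Rightarrow> Gi (snd x k)))"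

text \<open>
  On the sequences both products are the shift; the initial terms agree because \<open>G\<close> maps \<open>a h\<close> to \<open>b h\<close>.
\<close>

lemma V_commute: "V1 (V2 x) = V2 (V1 x)"
proof (rule prod_eqI)
  show "fst (V1 (V2 x)) = fst (V2 (V1 x))" by (simp add: V1_def V2_def commute)
  have "snd (V1 (V2 x)) n = snd (V2 (V1 x)) n" for n
  proof (cases n)
    case 0
    have "mix ((T2 (fst x), 0), 0) ((0, fst x), 0) = (a (fst x), 0)"
      "mix ((fst x, 0), 0) ((0, T1 (fst x)), 0) = (b (fst x), 0)"
      by (simp_all add: mix_def a_def b_def zero_prod_def)
    with 0 show ?thesis by (simp add: V1_def V2_def G_a)
  next
    case (Suc k)
    then show ?thesis by (simp add: V1_def V2_def)
  qed
  then show "snd (V1 (V2 x)) = snd (V2 (V1 x))" by blast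
qed

definition fin :: "'h vec \<Rightarrow> bool" where "fin x \<longleftrightarrow> (\<forall>\<^sub>F n in sequentially. snd x n = 0)"

definition ip :: "'h vec \<Rightarrow> 'h vec \<Rightarrow> complex" where
  "ip x y = cinner (fst x) (fst y) + (\<Sum>n. form4 (snd x n) (snd y n))"

lemma fin_V: assumes "fin x" shows "fin (V1 x)" "fin (V2 x)"
proof -
  obtain N where N: "\<And>n. n \<ge> N \<Longrightarrow> snd x n = 0" using assms by (auto simp: fin_def eventually_sequentially)
  have "snd (V1 x) n = 0 \<and> snd (V2 x) n = 0" if "n \<ge> Suc N" for n
  proof -
    obtain k where "n = Suc k" "k \<ge> N" using \<open>n \<ge> Suc N\<close> by (cases n) auto
    then show ?thesis using N[of n] N[of k] by (simp add: V1_def V2_def G_zero Gi_zero)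
  qed
  then show "fin (V1 x)" "fin (V2 x)" unfolding fin_def eventually_sequentially by blast+
qed

lemma eventually_zero_sums:
  assumes "\<forall>\<^sub>F n in sequentially. f n = (0::complex)"
  shows "f sums suminf f"
proof -
  obtain N where "\<And>n. n \<ge> N \<Longrightarrow> f n = 0" using assms by (auto simp: eventually_sequentially)
  then have "summable f" by (intro summable_finite[of "{..<N}"]) auto
  then show ?thesis by (rule summable_sums)
qed

lemma ip_shift:
  assumes "(\<lambda>n. A n) sums sA" "(\<lambda>n. B n) sums sB"
  shows "(\<Sum>n. (case n of 0 \<Rightarrow> c | Suc k \<Rightarrow> A k) + B n) = (c::complex) + (sA + sB)"
proof -
  have "(\<lambda>n. case n of 0 \<Rightarrow> c | Suc k \<Rightarrow> A k) sums (sA + c)"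
    using sums_Suc[of "\<lambda>n. case n of 0 \<Rightarrow> c | Suc k \<Rightarrow> A k" sA] assms(1) by simp
  from sums_add[OF this assms(2)] show ?thesis by (simp add: sums_iff algebra_simps)
qed

lemma V_isometric:
  assumes x: "fin x"
  shows "ip (V1 x) (V1 y) = ip x y" "ip (V2 x) (V2 y) = ip x y"
proof -
  have ev: "\<forall>\<^sub>F n in sequentially. snd x n = 0" using x by (simp add: fin_def)
  define Q P where "Q = (\<lambda>n. formQ (snd x n) (snd y n))" and "P = (\<lambda>n. formP (snd x n) (snd y n))"
  define Q' P' where "Q' = (\<lambda>n. formQ (Gi (snd x n)) (Gi (snd y n)))" and "P' = (\<lambda>n. formP (Gi (snd x n)) (Gi (snd y n)))"
  have s: "Q sums suminf Q" "P sums suminf P" "Q' sums suminf Q'" "P' sums suminf P'"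
    unfolding Q_def P_def Q'_def P'_def
    by (intro eventually_zero_sums eventually_mono[OF ev]; simp add: Gi_zero)+
  have "form4 (snd x n) (snd y n) = Q n + P n" for n by (simp add: Q_def P_def form4_split)
  moreover have "form4 (snd x n) (snd y n) = Q' n + P' n" for n
    by (simp add: Q'_def P'_def form4_split[symmetric] Gi_isometric)
  ultimately have tot: "(\<Sum>n. form4 (snd x n) (snd y n)) = suminf Q + suminf P"
      "(\<Sum>n. form4 (snd x n) (snd y n)) = suminf Q' + suminf P'"
    using sums_add[OF s(1,2)] sums_add[OF s(3,4)] by (simp_all add: sums_iff)
  have "form4 (snd (V1 x) n) (snd (V1 y) n) = (case n of 0 \<Rightarrow> d1 (fst x) (fst y) | Suc k \<Rightarrow> Q k) + P n" for n
    by (cases n) (simp_all add: V1_def G_isometric form4_mix Q_def P_def, simp add: formQ_def D1.zero_left)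
  then show "ip (V1 x) (V1 y) = ip x y"
    unfolding ip_def using ip_shift[OF s(1,2)] tot(1) by (simp add: V1_def defect_form_def)
  have "form4 (snd (V2 x) n) (snd (V2 y) n) = (case n of 0 \<Rightarrow> d2 (fst x) (fst y) | Suc k \<Rightarrow> P' k) + Q' n" for n
    by (cases n) (simp_all add: V2_def form4_mix Q'_def P'_def, simp add: formP_def D2.zero_left)
  then show "ip (V2 x) (V2 y) = ip x y"
    unfolding ip_def using ip_shift[OF s(4,3)] tot(2) by (simp add: V2_def defect_form_def)
qed

lemma psd_ip:
  assumes "\<And>x. fin (w x)"
  shows "0 \<le> Re (kform (\<lambda>x y. ip (w x) (w y)) l l)"
proof -
  have "\<forall>\<^sub>F n in sequentially. \<forall>x\<in>snd ` set l. snd (w x) n = 0"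
    using assms by (intro eventually_ball_finite) (auto simp: fin_def)
  then obtain N where N: "\<And>n x. n \<ge> N \<Longrightarrow> x \<in> snd ` set l \<Longrightarrow> snd (w x) n = 0"
    by (auto simp: eventually_sequentially)
  let ?f = "\<lambda>n x. snd (w x) n"
  define k where "k = (\<lambda>n x y. d1 (fst (fst (?f n x))) (fst (fst (?f n y))) + d2 (snd (fst (?f n x))) (snd (fst (?f n y)))
    + (d1 (fst (snd (?f n x))) (fst (snd (?f n y))) + d2 (snd (snd (?f n x))) (snd (snd (?f n y)))))"
  have "ip (w x) (w y) = cinner (fst (w x)) (fst (w y)) + (\<Sum>n<N. k n x y)" if "x \<in> snd ` set l" for x y
  proof -
    have "(\<Sum>n. form4 (?f n x) (?f n y)) = (\<Sum>n<N. form4 (?f n x) (?f n y))"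
      by (rule suminf_finite) (use N that in auto)
    then show ?thesis by (simp add: ip_def k_def form4_def form2_def)
  qed
  then have "kform (\<lambda>x y. ip (w x) (w y)) l l =
      kform (\<lambda>x y. cinner (fst (w x)) (fst (w y)) + (\<Sum>n<N. k n x y)) l l"
    by (intro kform_cong)
  also have "Re \<dots> \<ge> 0"
    unfolding kform_add kform_sum k_def
    by (auto simp: kform_cinner cinner_self intro!: sum_nonneg add_nonneg_nonneg
      T1.kform_defect_nonneg T2.kform_defect_nonneg)
  finally show ?thesis .
qed

definition W :: "nat \<Rightarrow> nat \<Rightarrow> 'h \<Rightarrow> 'h vec" where
  "W k l \<xi> = (V1 ^^ k) ((V2 ^^ l) (\<xi>, \<lambda>_. 0))"

lemma V_pow:
  assumes x: "fin x"
  shows "fin ((V1 ^^ k) x)" "fin ((V2 ^^ k) x)"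
    "ip ((V1 ^^ k) x) ((V1 ^^ k) y) = ip x y" "ip ((V2 ^^ k) x) ((V2 ^^ k) y) = ip x y"
proof -
  have f1: "fin ((V1 ^^ k) x)" for k using x by (induction k) (auto intro: fin_V)
  have f2: "fin ((V2 ^^ k) x)" for k using x by (induction k) (auto intro: fin_V)
  show "fin ((V1 ^^ k) x)" "fin ((V2 ^^ k) x)" by (rule f1, rule f2)
  show "ip ((V1 ^^ k) x) ((V1 ^^ k) y) = ip x y" by (induction k) (simp_all add: V_isometric f1)
  show "ip ((V2 ^^ k) x) ((V2 ^^ k) y) = ip x y" by (induction k) (simp_all add: V_isometric f2)
qed

lemma fin_W: "fin (W k l \<xi>)"
  unfolding W_def by (intro V_pow) (simp add: fin_def)

lemma V_pow_commute: "(V1 ^^ k) ((V2 ^^ l) x) = (V2 ^^ l) ((V1 ^^ k) x)"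
proof -
  have 1: "(V1 ^^ k) (V2 x) = V2 ((V1 ^^ k) x)" for k x
    by (induction k arbitrary: x) (auto simp: V_commute)
  show ?thesis by (induction l arbitrary: x) (auto simp: 1)
qed

lemma W_add: "W (i + k) (j + l) \<xi> = (V1 ^^ i) ((V2 ^^ j) (W k l \<xi>))"
  unfolding W_def funpow_add comp_def by (simp only: V_pow_commute)

lemma ip_W_cancel: "ip (W (i + k) (j + l) \<xi>) (W (i + k') (j + l') \<eta>) = ip (W k l \<xi>) (W k' l' \<eta>)"
  unfolding W_add using fin_W V_pow by simp

text \<open>
  For commuting isometries the coefficient \<open>\<langle>V\<^sup>p \<xi>, \<eta>\<rangle>\<close> extends to all \<open>p \<in> \<int>\<^sup>2\<close> by moving negative powers to the
  other side of the inner product.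
\<close>

definition \<Phi> :: "int \<times> int \<Rightarrow> 'h \<Rightarrow> 'h \<Rightarrow> complex" where
  "\<Phi> p \<xi> \<eta> = ip (W (nat (fst p)) (nat (snd p)) \<xi>) (W (nat (- fst p)) (nat (- snd p)) \<eta>)"

lemma \<Phi>_diff: 
  assumes "k \<ge> 0" "l \<ge> 0" "k' \<ge> 0" "l' \<ge> 0"
  shows "\<Phi> (k - k', l - l') \<xi> \<eta> = ip (W (nat k) (nat l) \<xi>) (W (nat k') (nat l') \<eta>)"
proof -
  \<comment> \<open>Cancel the common powers of the two isometries.\<close>
  let ?i = "nat (min k k')" and ?j = "nat (min l l')"
  have "nat k = ?i + nat (k - k')" "nat k' = ?i + nat (- (k - k'))"
    "nat l = ?j + nat (l - l')" "nat l' = ?j + nat (- (l - l'))" using assms by auto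
  then show ?thesis unfolding \<Phi>_def fst_conv snd_conv by (metis ip_W_cancel)
qed

lemma ip_commute: "ip x y = cnj (ip y x)" if "fin x" "fin y"
proof -
  have "form4 u v = cnj (form4 v u)" for u v
    unfolding form4_def using form2_commute by (metis complex_cnj_add)
  moreover have "(\<lambda>n. form4 (snd y n) (snd x n)) sums suminf (\<lambda>n. form4 (snd y n) (snd x n))"
    using that(2) unfolding fin_def by (intro eventually_zero_sums eventually_mono[OF that(2)[unfolded fin_def]]) simp
  ultimately have "(\<lambda>n. form4 (snd x n) (snd y n)) sums cnj (suminf (\<lambda>n. form4 (snd y n) (snd x n)))"
    by (metis (no_types, lifting) ext sums_cnj)
  then have "(\<Sum>n. form4 (snd x n) (snd y n)) = cnj (\<Sum>n. form4 (snd y n) (snd x n))"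
    by (simp only: sums_iff)
  then show ?thesis
    unfolding ip_def by (simp only: complex_cnj_add cinner_commute[of "fst x" "fst y"])
qed

text \<open>
  A finite set of lattice points can be shifted into the positive quadrant, where the kernel is the
  Gram kernel of the vectors \<open>V\<^sup>p \<xi>\<close>.
\<close>

theorem psd_\<Phi>: "psd_kernel (\<lambda>(p, \<xi>) (q, \<eta>). \<Phi> (p - q) \<xi> \<eta>)"
  unfolding psd_kernel_def
proof (intro conjI allI)
  fix x y :: "(int \<times> int) \<times> 'h"
  show "(case x of (p, \<xi>) \<Rightarrow> \<lambda>(q, \<eta>). \<Phi> (p - q) \<xi> \<eta>) y = cnj ((case y of (p, \<xi>) \<Rightarrow> \<lambda>(q, \<eta>). \<Phi> (p - q) \<xi> \<eta>) x)"
    by (simp add: \<Phi>_def split_def ip_commute[OF fin_W fin_W, symmetric])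
next
  fix l :: "(complex \<times> (int \<times> int) \<times> 'h) list"
  have "\<exists>N. \<forall>x\<in>snd ` set l. fst (fst x) + N \<ge> 0 \<and> snd (fst x) + N \<ge> 0"
  proof (intro exI ballI)
    fix x assume x: "x \<in> snd ` set l"
    let ?g = "\<lambda>x. \<bar>fst (fst x)\<bar> + \<bar>snd (fst x)\<bar>"
    have "?g x \<le> (\<Sum>x\<in>snd ` set l. ?g x)" by (rule member_le_sum) (use x in auto)
    then show "fst (fst x) + (\<Sum>x\<in>snd ` set l. ?g x) \<ge> 0 \<and> snd (fst x) + (\<Sum>x\<in>snd ` set l. ?g x) \<ge> 0" by auto
  qed
  then obtain N where "\<forall>x\<in>snd ` set l. fst (fst x) + N \<ge> 0 \<and> snd (fst x) + N \<ge> 0" by (rule exE)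
  note N = this[rule_format]
  define w where "w = (\<lambda>x. W (nat (fst (fst x) + N)) (nat (snd (fst x) + N)) (snd x))"
  have *: "(\<lambda>(p, \<xi>) (q, \<eta>). \<Phi> (p - q) \<xi> \<eta>) x y = ip (w x) (w y)"
    if xy: "x \<in> snd ` set l" "y \<in> snd ` set l" for x y :: "(int \<times> int) \<times> 'h"
  proof -
    have "fst x - fst y = ((fst (fst x) + N) - (fst (fst y) + N), (snd (fst x) + N) - (snd (fst y) + N))"
      by (rule prod_eqI) simp_all
    moreover have "fst (fst x) + N \<ge> 0" "snd (fst x) + N \<ge> 0" using N[OF xy(1)] by auto
    moreover have "fst (fst y) + N \<ge> 0" "snd (fst y) + N \<ge> 0" using N[OF xy(2)] by auto
    ultimately show ?thesis unfolding split_def w_def using \<Phi>_diff by metis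
  qed
  have "kform (\<lambda>(p, \<xi>) (q, \<eta>). \<Phi> (p - q) \<xi> \<eta>) l l = kform (\<lambda>x y. ip (w x) (w y)) l l"
    by (rule kform_cong, rule *)
  then show "0 \<le> Re (kform (\<lambda>(p, \<xi>) (q, \<eta>). \<Phi> (p - q) \<xi> \<eta>) l l)"
    using psd_ip[of w l] fin_W by (simp add: w_def)
qed

theorem \<Phi>_nonneg: "\<Phi> (int k, int l) \<xi> \<eta> = cinner ((T1 ^^ k) ((T2 ^^ l) \<xi>)) \<eta>"
proof -
  have "fst ((V1 ^^ k) x) = (T1 ^^ k) (fst x)" "fst ((V2 ^^ k) x) = (T2 ^^ k) (fst x)" for k x
    by (induction k) (auto simp: V1_def V2_def)
  then show ?thesis by (simp add: \<Phi>_def W_def ip_def)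
qed

end

section \<open>Reproducing kernel Hilbert spaces\<close>

locale psd_space =
  fixes k :: "'x \<Rightarrow> 'x \<Rightarrow> complex"
  assumes psd: "psd_kernel k"
begin

abbreviation s :: "(complex \<times> 'x) list \<Rightarrow> (complex \<times> 'x) list \<Rightarrow> complex" where "s \<equiv> kform k"

definition sc :: "complex \<Rightarrow> (complex \<times> 'x) list \<Rightarrow> (complex \<times> 'x) list" where
  "sc c l = map (\<lambda>(d, x). (c * d, x)) l"

lemma s_sc_left: "s (sc c l) m = c * s l m"
  by (simp add: kform_def sc_def split_def comp_def sum_list_const_mult[symmetric] mult.assoc)

lemma s_commute: "s l m = cnj (s m l)"
proof -
  have k: "k x y = cnj (k y x)" for x y using psd unfolding psd_kernel_def by blast
  have 1: "s [p] m = cnj (s m [p])" for p m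
  proof (induction m)
    case (Cons q m)
    have "s [p] (q # m) = s [p] [q] + s [p] m" "s (q # m) [p] = s [q] [p] + s m [p]"
      by (simp_all add: kform_def split_def)
    moreover have "s [p] [q] = cnj (s [q] [p])"
      using k[of "snd p" "snd q"] by (simp add: kform_def split_def)
    ultimately show ?case using Cons by simp
  qed simp
  show ?thesis
  proof (induction l)
    case (Cons p l)
    then show ?case using 1[of p m] kform_append_left[of k "[p]" l m] kform_append_right[of k m "[p]" l] by simp
  qed simp
qed

lemma s_sc_right: "s l (sc c m) = cnj c * s l m"
  by (metis s_commute s_sc_left complex_cnj_mult)

lemmas s_simps = kform_append_left kform_append_right s_sc_left s_sc_right

definition q :: "(complex \<times> 'x) list \<Rightarrow> real" where "q l = sqrt (Re (s l l))"

lemma s_nonneg [simp]: "0 \<le> Re (s l l)"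
  using psd by (simp add: psd_kernel_def)

lemma q_nonneg [simp]: "0 \<le> q l" by (simp add: q_def)
lemma q_sq: "(q l)\<^sup>2 = Re (s l l)" by (simp add: q_def)
lemma s_self: "s l l = of_real ((q l)\<^sup>2)"
  using s_commute[of l l] by (simp add: q_sq complex_eq_iff)

lemma cauchy_schwarz: "cmod (s l m) \<le> q l * q m"
proof -
  define p where "p = s l m"
  have expand: "0 \<le> (q l)\<^sup>2 - 2 * t * (cmod p)\<^sup>2 + t\<^sup>2 * (cmod p)\<^sup>2 * (q m)\<^sup>2" for t :: real
  proof -
    have "s (l @ sc (- of_real t * p) m) (l @ sc (- of_real t * p) m) =
        s l l - 2 * of_real t * (p * cnj p) + of_real (t\<^sup>2) * (p * cnj p) * s m m"
      using s_commute[of m l] by (simp add: s_simps p_def algebra_simps power2_eq_square)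
    also have "\<dots> = of_real ((q l)\<^sup>2 - 2 * t * (cmod p)\<^sup>2 + t\<^sup>2 * (cmod p)\<^sup>2 * (q m)\<^sup>2)"
      by (simp add: s_self complex_norm_square[symmetric])
    finally show ?thesis by (metis s_nonneg Re_complex_of_real)
  qed
  have "cmod p \<le> q l * q m"
  proof (cases "q m = 0")
    case True
    have "p = 0"
    proof (rule ccontr)
      assume "p \<noteq> 0"
      define P where "P = (cmod p)\<^sup>2"
      have "P > 0" using \<open>p \<noteq> 0\<close> by (simp add: P_def)
      then have "2 * (((q l)\<^sup>2 + 1) / P) * P = 2 * ((q l)\<^sup>2 + 1)" by simp
      moreover have "0 \<le> (q l)\<^sup>2 - 2 * (((q l)\<^sup>2 + 1) / P) * P"
        using expand[of "((q l)\<^sup>2 + 1) / P"] True by (simp add: P_def)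
      ultimately have "0 \<le> (q l)\<^sup>2 - 2 * ((q l)\<^sup>2 + 1)" by (simp only:)
      then have "(q l)\<^sup>2 \<le> - 2" by (simp add: algebra_simps)
      then show False using zero_le_power2[of "q l"] by simp
    qed
    then show ?thesis by simp
  next
    case False
    define M where "M = (q m)\<^sup>2"
    have m: "M > 0" using False by (simp add: M_def)
    have "(1 / M)\<^sup>2 * (cmod p)\<^sup>2 * M = (cmod p)\<^sup>2 / M"
      using m by (simp add: power2_eq_square)
    with expand[of "1 / M"] have "0 \<le> (q l)\<^sup>2 - (cmod p)\<^sup>2 / M"
      by (simp add: M_def)
    then have "(cmod p)\<^sup>2 \<le> (q l)\<^sup>2 * M" using m by (simp add: field_simps)
    then have "(cmod p)\<^sup>2 \<le> (q l * q m)\<^sup>2" by (simp add: M_def power_mult_distrib)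
    then show ?thesis by (rule power2_le_imp_le) simp
  qed
  then show ?thesis by (simp add: p_def)
qed

lemma cauchy_schwarz2: "cmod (s a b + s c d) \<le> q a * q b + q c * q d"
  using norm_triangle_ineq[of "s a b" "s c d"] cauchy_schwarz[of a b] cauchy_schwarz[of c d] by linarith

lemma q_sc: "q (sc c l) = cmod c * q l"
proof -
  have "s (sc c l) (sc c l) = (c * cnj c) * s l l" by (simp add: s_simps)
  also have "\<dots> = of_real ((cmod c * q l)\<^sup>2)" by (simp add: s_self complex_norm_square[symmetric] power_mult_distrib)
  finally have "Re (s (sc c l) (sc c l)) = (cmod c * q l)\<^sup>2" by (metis Re_complex_of_real)
  then show ?thesis by (simp add: q_def)
qed

lemma q_append: "q (l @ m) \<le> q l + q m"
proof (rule power2_le_imp_le)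
  have "Re (s l m) \<le> q l * q m" using cauchy_schwarz[of l m] complex_Re_le_cmod order_trans by blast
  moreover have "Re (s m l) = Re (s l m)" using s_commute[of m l] by simp
  ultimately show "(q (l @ m))\<^sup>2 \<le> (q l + q m)\<^sup>2"
    by (simp add: q_sq power2_sum s_simps)
qed simp

lemma q_cong:
  assumes "\<And>m. s l m = s l' m" shows "q l = q l'"
proof -
  have "s l l = cnj (s l l')" using assms[of l] s_commute[of l' l] by simp
  then show ?thesis using assms[of l'] unfolding q_def by simp
qed

definition df :: "(complex \<times> 'x) list \<Rightarrow> (complex \<times> 'x) list \<Rightarrow> (complex \<times> 'x) list" where
  "df l m = l @ sc (-1) m"

lemma s_df: "s (df l m) n = s l n - s m n" "s n (df l m) = s n l - s n m"
  by (simp_all add: df_def s_simps)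

lemma q_df_triangle: "q (df l n) \<le> q (df l m) + q (df m n)"
proof -
  have "q (df l n) = q (df l m @ df m n)" by (rule q_cong) (simp add: s_simps s_df)
  then show ?thesis using q_append[of "df l m" "df m n"] by simp
qed

lemma q_df_commute: "q (df l m) = q (df m l)"
  using q_sc[of "-1" "df l m"] q_cong[of "sc (-1) (df l m)" "df m l"] by (simp add: s_simps s_df)

lemma q_df_self [simp]: "q (df l l) = 0"
  by (simp add: q_def s_df)

lemma q_le_df: "q l \<le> q m + q (df l m)"
  using q_append[of m "df l m"] q_cong[of "m @ df l m" l] by (simp add: s_simps s_df)

definition cau :: "(nat \<Rightarrow> (complex \<times> 'x) list) \<Rightarrow> bool" where
  "cau v \<longleftrightarrow> (\<forall>e>0. \<exists>N. \<forall>m\<ge>N. \<forall>n\<ge>N. q (df (v m) (v n)) < e)"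

lemma cau_bounded:
  assumes "cau v" obtains B where "B > 0" "\<And>n. q (v n) \<le> B"
proof -
  obtain N where N: "\<And>m n. m \<ge> N \<Longrightarrow> n \<ge> N \<Longrightarrow> q (df (v m) (v n)) < 1"
    using assms unfolding cau_def by (metis zero_less_one)
  define B where "B = q (v N) + 1 + (\<Sum>n<N. q (v n))"
  show thesis
  proof
    have "(\<Sum>n<N. q (v n)) \<ge> 0" "q (v N) \<ge> 0" by (simp_all add: sum_nonneg)
    then show "B > 0" unfolding B_def by linarith
    show "q (v n) \<le> B" for n
    proof (cases "n < N")
      case True
      then have "q (v n) \<le> (\<Sum>n<N. q (v n))" by (intro member_le_sum) auto
      moreover have "q (v N) \<ge> 0" by simp
      ultimately show ?thesis unfolding B_def by linarith
    next
      case False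
      then have "q (v n) \<le> q (v N) + 1" using q_le_df[of "v n" "v N"] N[of n N] by simp
      moreover have "(\<Sum>n<N. q (v n)) \<ge> 0" by (simp add: sum_nonneg)
      ultimately show ?thesis unfolding B_def by linarith
    qed
  qed
qed

lemma cau_const: "cau (\<lambda>_. l)" by (simp add: cau_def)

lemma cau_append:
  assumes "cau v" "cau w" shows "cau (\<lambda>n. v n @ w n)"
  unfolding cau_def
proof (intro allI impI)
  fix e :: real assume "e > 0"
  then obtain N M where N: "\<And>m n. m \<ge> N \<Longrightarrow> n \<ge> N \<Longrightarrow> q (df (v m) (v n)) < e/2"
    and M: "\<And>m n. m \<ge> M \<Longrightarrow> n \<ge> M \<Longrightarrow> q (df (w m) (w n)) < e/2"
    using assms unfolding cau_def by (metis half_gt_zero)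
  have le: "q (df (v m @ w m) (v n @ w n)) \<le> q (df (v m) (v n)) + q (df (w m) (w n))" for m n
    using q_append[of "df (v m) (v n)" "df (w m) (w n)"]
      q_cong[of "df (v m) (v n) @ df (w m) (w n)" "df (v m @ w m) (v n @ w n)"] by (simp add: s_simps s_df)
  show "\<exists>N. \<forall>m\<ge>N. \<forall>n\<ge>N. q (df (v m @ w m) (v n @ w n)) < e"
  proof (intro exI allI impI)
    fix m n assume "max N M \<le> m" "max N M \<le> n"
    then show "q (df (v m @ w m) (v n @ w n)) < e" using le[of m n] N[of m n] M[of m n] by simp
  qed
qed

lemma cau_sc: assumes "cau v" shows "cau (\<lambda>n. sc c (v n))"
  unfolding cau_def
proof (intro allI impI)
  fix e :: real assume "e > 0"
  have c1: "cmod c + 1 > 0" using norm_ge_zero[of c] by linarith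
  then have "e / (cmod c + 1) > 0" using \<open>e > 0\<close> by simp
  then obtain N where N: "\<And>m n. m \<ge> N \<Longrightarrow> n \<ge> N \<Longrightarrow> q (df (v m) (v n)) < e / (cmod c + 1)"
    using assms unfolding cau_def by blast
  have "q (df (sc c (v m)) (sc c (v n))) < e" if "m \<ge> N" "n \<ge> N" for m n
  proof -
    have "q (df (sc c (v m)) (sc c (v n))) = cmod c * q (df (v m) (v n))"
      using q_cong[of "df (sc c (v m)) (sc c (v n))" "sc c (df (v m) (v n))"] by (simp add: s_simps s_df q_sc right_diff_distrib)
    also have "\<dots> \<le> (cmod c + 1) * q (df (v m) (v n))" by (simp add: distrib_right)
    also have "\<dots> < (cmod c + 1) * (e / (cmod c + 1))" 
      by (rule mult_strict_left_mono[OF N[OF that] c1])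
    also have "\<dots> = e" using c1 by simp
    finally show ?thesis .
  qed
  then show "\<exists>N. \<forall>m\<ge>N. \<forall>n\<ge>N. q (df (sc c (v m)) (sc c (v n))) < e" by blast
qed

lemma cau_df: "cau v \<Longrightarrow> cau w \<Longrightarrow> cau (\<lambda>n. df (v n) (w n))"
  unfolding df_def by (intro cau_append cau_sc)

lemma s_convergent:
  assumes v: "cau v" and w: "cau w" shows "convergent (\<lambda>n. s (v n) (w n))"
proof -
  obtain A B where A: "A > 0" "\<And>n. q (v n) \<le> A" and B: "B > 0" "\<And>n. q (w n) \<le> B"
    using cau_bounded v w by metis
  have "Cauchy (\<lambda>n. s (v n) (w n))"
  proof (rule metric_CauchyI)
    fix e :: real assume "e > 0"
    define e' where "e' = e / (A + B)"
    have "e' > 0" "e' * (A + B) = e" using \<open>e > 0\<close> A B by (simp_all add: e'_def)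
    obtain N M where N: "\<And>m n. m \<ge> N \<Longrightarrow> n \<ge> N \<Longrightarrow> q (df (v m) (v n)) < e'"
      and M: "\<And>m n. m \<ge> M \<Longrightarrow> n \<ge> M \<Longrightarrow> q (df (w m) (w n)) < e'"
      using v w \<open>e' > 0\<close> unfolding cau_def by metis
    have "cmod (s (v m) (w m) - s (v n) (w n)) < e" if "m \<ge> max N M" "n \<ge> max N M" for m n
    proof -
      have "s (v m) (w m) - s (v n) (w n) = s (df (v m) (v n)) (w m) + s (v n) (df (w m) (w n))"
        by (simp add: s_df)
      then have "cmod (s (v m) (w m) - s (v n) (w n)) \<le> q (df (v m) (v n)) * q (w m) + q (v n) * q (df (w m) (w n))"
        by (simp only: cauchy_schwarz2)
      also have "\<dots> \<le> q (df (v m) (v n)) * B + A * q (df (w m) (w n))"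
        by (intro add_mono mult_left_mono mult_right_mono A B) auto
      also have "\<dots> < e' * B + A * e'"
        using N[of m n] M[of m n] that A B by (intro add_strict_mono mult_strict_right_mono mult_strict_left_mono) auto
      also have "\<dots> = e" using \<open>e' * (A + B) = e\<close> by (simp add: algebra_simps)
      finally show ?thesis .
    qed
    then show "\<exists>N. \<forall>m\<ge>N. \<forall>n\<ge>N. dist (s (v m) (w m)) (s (v n) (w n)) < e"
      unfolding dist_norm by blast
  qed
  then show ?thesis by (rule Cauchy_convergent)
qed

definition ev :: "(complex \<times> 'x) list \<Rightarrow> 'x \<Rightarrow> complex" where "ev l x = s l [(1, x)]"

lemma s_ev: "(\<And>x. (\<lambda>n. ev (v n) x) \<longlonglongrightarrow> 0) \<Longrightarrow> (\<lambda>n. s (v n) m) \<longlonglongrightarrow> 0"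
proof (induction m)
  case (Cons p m)
  have "s l (p # m) = cnj (fst p) * ev l (snd p) + s l m" for l
    using kform_append_right[of k l "[p]" m] s_sc_right[of l "fst p" "[(1, snd p)]"]
    by (simp add: ev_def sc_def)
  moreover have "(\<lambda>n. cnj (fst p) * ev (v n) (snd p) + s (v n) m) \<longlonglongrightarrow> cnj (fst p) * 0 + 0"
    by (intro tendsto_intros Cons)
  ultimately show ?case by simp
qed simp

text \<open>
  A limit function determines its Cauchy sequence up to null sequences: \<open>\<parallel>v\<^sub>n\<parallel>\<^sup>2 = \<langle>v\<^sub>n, v\<^sub>n - v\<^sub>N\<rangle> + \<langle>v\<^sub>n, v\<^sub>N\<rangle>\<close>, where
  the first term is small uniformly in \<open>n\<close> and the second tends to 0.
\<close>

lemma weakly_null_cau: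
  assumes v: "cau v" and null: "\<And>x. (\<lambda>n. ev (v n) x) \<longlonglongrightarrow> 0"
  shows "(\<lambda>n. q (v n)) \<longlonglongrightarrow> 0"
proof -
  obtain B where B: "B > 0" "\<And>n. q (v n) \<le> B" using cau_bounded v by metis
  have "(\<lambda>n. (q (v n))\<^sup>2) \<longlonglongrightarrow> 0"
  proof (rule LIMSEQ_I)
    fix e :: real assume "e > 0"
    then have "e / (2 * B) > 0" using B by simp
    then obtain N where N: "\<And>m n. m \<ge> N \<Longrightarrow> n \<ge> N \<Longrightarrow> q (df (v m) (v n)) < e / (2 * B)"
      using v unfolding cau_def by meson
    have "(\<lambda>n. s (v n) (v N)) \<longlonglongrightarrow> 0" by (rule s_ev[OF null])
    then obtain M where M: "\<And>n. n \<ge> M \<Longrightarrow> cmod (s (v n) (v N)) < e / 2"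
      using LIMSEQ_D[of _ 0 "e/2"] \<open>e > 0\<close> by (metis diff_zero half_gt_zero)
    have "norm ((q (v n))\<^sup>2 - 0) < e" if "n \<ge> max N M" for n
    proof -
      have "of_real ((q (v n))\<^sup>2) = s (v n) (df (v n) (v N)) + s (v n) (v N)" by (simp add: s_df s_self)
      then have "(q (v n))\<^sup>2 \<le> cmod (s (v n) (df (v n) (v N)) + s (v n) (v N))" 
        by (metis abs_ge_self norm_of_real)
      also have "\<dots> \<le> q (v n) * q (df (v n) (v N)) + cmod (s (v n) (v N))"
        using norm_triangle_ineq[of "s (v n) (df (v n) (v N))"] cauchy_schwarz[of "v n" "df (v n) (v N)"] by (smt (verit))
      also have "\<dots> < B * (e / (2 * B)) + e / 2"
        using M[of n] N[of n N] that B(1) B(2)[of n] by (intro add_le_less_mono mult_mono) auto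
      also have "\<dots> = e" using B by simp
      finally show ?thesis by simp
    qed
    then show "\<exists>no. \<forall>n\<ge>no. norm ((q (v n))\<^sup>2 - 0) < e" by blast
  qed
  then have "(\<lambda>n. sqrt ((q (v n))\<^sup>2)) \<longlonglongrightarrow> sqrt 0" by (intro tendsto_intros)
  then show ?thesis by simp
qed

text \<open>
  The completion of the formal combinations. Its elements are the functions \<open>x \<mapsto> lim \<langle>v\<^sub>n, x\<rangle>\<close> for Cauchy
  sequences \<open>v\<close>; this makes the quotient by null vectors implicit.
\<close>

definition reps :: "(nat \<Rightarrow> (complex \<times> 'x) list) \<Rightarrow> ('x \<Rightarrow> complex) \<Rightarrow> bool" where
  "reps v \<phi> \<longleftrightarrow> cau v \<and> (\<forall>x. (\<lambda>n. ev (v n) x) \<longlonglongrightarrow> \<phi> x)"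

definition rkhs_ip :: "('x \<Rightarrow> complex) \<Rightarrow> ('x \<Rightarrow> complex) \<Rightarrow> complex" where
  "rkhs_ip \<phi> \<psi> = lim (\<lambda>n. s ((SOME v. reps v \<phi>) n) ((SOME v. reps v \<psi>) n))"

lemma reps_ip:
  assumes v: "reps v \<phi>" and w: "reps w \<psi>"
  shows "(\<lambda>n. s (v n) (w n)) \<longlonglongrightarrow> rkhs_ip \<phi> \<psi>"
proof -
  define v' where "v' = (SOME v. reps v \<phi>)"
  define w' where "w' = (SOME v. reps v \<psi>)"
  have v': "reps v' \<phi>" and w': "reps w' \<psi>" 
    unfolding v'_def w'_def by (rule someI[of _ v], rule v, rule someI[of _ w], rule w)
  have null: "(\<lambda>n. q (df (v n) (v' n))) \<longlonglongrightarrow> 0" if "reps v \<phi>" "reps v' \<phi>" for v v' \<phi>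
  proof (rule weakly_null_cau)
    show "cau (\<lambda>n. df (v n) (v' n))" using that by (auto simp: reps_def intro: cau_df)
    show "(\<lambda>n. ev (df (v n) (v' n)) x) \<longlonglongrightarrow> 0" for x
      using tendsto_diff[of "\<lambda>n. ev (v n) x" "\<phi> x" sequentially "\<lambda>n. ev (v' n) x" "\<phi> x"] that
      by (simp add: reps_def ev_def s_df)
  qed
  obtain A B where A: "\<And>n. q (v' n) \<le> A" and B: "\<And>n. q (w n) \<le> B"
    using cau_bounded v' w unfolding reps_def by metis
  have "(\<lambda>n. s (v n) (w n) - s (v' n) (w' n)) \<longlonglongrightarrow> 0"
  proof (rule Lim_null_comparison)
    show "\<forall>\<^sub>F n in sequentially. norm (s (v n) (w n) - s (v' n) (w' n)) \<le> q (df (v n) (v' n)) * B + A * q (df (w n) (w' n))"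
    proof (rule always_eventually, rule allI)
      fix n
      have "s (v n) (w n) - s (v' n) (w' n) = s (df (v n) (v' n)) (w n) + s (v' n) (df (w n) (w' n))"
        by (simp add: s_df)
      then have "norm (s (v n) (w n) - s (v' n) (w' n)) \<le> q (df (v n) (v' n)) * q (w n) + q (v' n) * q (df (w n) (w' n))"
        by (simp only: cauchy_schwarz2)
      also have "\<dots> \<le> q (df (v n) (v' n)) * B + A * q (df (w n) (w' n))"
        by (intro add_mono mult_left_mono mult_right_mono A B) auto
      finally show "norm (s (v n) (w n) - s (v' n) (w' n)) \<le> q (df (v n) (v' n)) * B + A * q (df (w n) (w' n))" .
    qed
    have "(\<lambda>n. q (df (v n) (v' n)) * B + A * q (df (w n) (w' n))) \<longlonglongrightarrow> 0 * B + A * 0"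
      by (intro tendsto_intros null[OF v v'] null[OF w w'])
    then show "(\<lambda>n. q (df (v n) (v' n)) * B + A * q (df (w n) (w' n))) \<longlonglongrightarrow> 0" by simp
  qed
  moreover have "(\<lambda>n. s (v' n) (w' n)) \<longlonglongrightarrow> rkhs_ip \<phi> \<psi>"
    unfolding rkhs_ip_def v'_def[symmetric] w'_def[symmetric]
    using s_convergent[of v' w'] v' w' by (simp add: reps_def convergent_LIMSEQ_iff)
  ultimately show ?thesis using tendsto_add[of "\<lambda>n. s (v n) (w n) - s (v' n) (w' n)" 0 sequentially] by fastforce
qed

definition rkhs :: "('x \<Rightarrow> complex) cspace" where
  "rkhs = \<lparr>carrier = {\<phi>. \<exists>v. reps v \<phi>}, mult = (\<lambda>_ _. undefined), one = undefined, zero = (\<lambda>_. 0),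
     add = (\<lambda>\<phi> \<psi> x. \<phi> x + \<psi> x), smult = (\<lambda>c \<phi> x. c * \<phi> x), cip = rkhs_ip\<rparr>"

lemma rkhs_simps [simp]:
  "\<phi> \<in> carrier rkhs \<longleftrightarrow> (\<exists>v. reps v \<phi>)" "\<phi> \<oplus>\<^bsub>rkhs\<^esub> \<psi> = (\<lambda>x. \<phi> x + \<psi> x)"
  "c \<odot>\<^bsub>rkhs\<^esub> \<phi> = (\<lambda>x. c * \<phi> x)" "\<zero>\<^bsub>rkhs\<^esub> = (\<lambda>_. 0)" "cip rkhs = rkhs_ip"
  by (simp_all add: rkhs_def)

lemma reps_add: "reps v \<phi> \<Longrightarrow> reps w \<psi> \<Longrightarrow> reps (\<lambda>n. v n @ w n) (\<lambda>x. \<phi> x + \<psi> x)"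
  by (auto simp: reps_def ev_def s_simps intro: cau_append tendsto_add)

lemma reps_sc: "reps v \<phi> \<Longrightarrow> reps (\<lambda>n. sc c (v n)) (\<lambda>x. c * \<phi> x)"
  by (auto simp: reps_def ev_def s_simps intro: cau_sc tendsto_mult_left)

lemma reps_df: "reps v \<phi> \<Longrightarrow> reps w \<psi> \<Longrightarrow> reps (\<lambda>n. df (v n) (w n)) (\<lambda>x. \<phi> x - \<psi> x)"
  by (auto simp: reps_def ev_def s_df intro: cau_df tendsto_diff)

lemma reps_ev: "reps (\<lambda>_. l) (ev l)"
  by (simp add: reps_def cau_const)

lemma abelian_group_rkhs: "abelian_group rkhs"
proof (rule abelian_groupI)
  show "\<zero>\<^bsub>rkhs\<^esub> \<in> carrier rkhs" using reps_ev[of "[]"] by (auto simp: ev_def[abs_def])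
  fix \<phi> assume "\<phi> \<in> carrier rkhs"
  then obtain v where "reps v \<phi>" by auto
  from reps_sc[OF this, of "-1"] show "\<exists>y\<in>carrier rkhs. y \<oplus>\<^bsub>rkhs\<^esub> \<phi> = \<zero>\<^bsub>rkhs\<^esub>"
    by (intro bexI[of _ "\<lambda>x. -1 * \<phi> x"]) auto
qed (auto intro: reps_add simp: add_ac)

lemma module_rkhs: "Module.module complex_ring rkhs"
  by (rule moduleI[OF cring_complex_ring abelian_group_rkhs]) (auto intro: reps_sc simp: algebra_simps)

lemma rkhs_minus: 
  assumes "\<phi> \<in> carrier rkhs" "\<psi> \<in> carrier rkhs"
  shows "\<phi> \<ominus>\<^bsub>rkhs\<^esub> \<psi> = (\<lambda>x. \<phi> x - \<psi> x)"
proof -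
  interpret abelian_group rkhs by (rule abelian_group_rkhs)
  obtain v where v: "reps v \<psi>" using assms by auto
  have "\<ominus>\<^bsub>rkhs\<^esub> \<psi> = (\<lambda>x. -1 * \<psi> x)"
    by (rule minus_equality) (use assms(2) reps_sc[OF v, of "-1"] in auto)
  then show ?thesis by (simp add: a_minus_def)
qed

lemma reps_dist:
  assumes v: "reps v \<phi>" and w: "reps w \<psi>"
  shows "(\<lambda>n. q (df (v n) (w n))) \<longlonglongrightarrow> cspace_dist rkhs \<phi> \<psi>"
proof -
  have c: "\<phi> \<in> carrier rkhs" "\<psi> \<in> carrier rkhs" using assms by auto
  have "cspace_dist rkhs \<phi> \<psi> = sqrt (Re (rkhs_ip (\<lambda>x. \<phi> x - \<psi> x) (\<lambda>x. \<phi> x - \<psi> x)))"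
    using c by (simp only: cspace_dist_def cspace_norm_def rkhs_minus[OF c] if_True simp_thms) simp
  then show ?thesis unfolding q_def using reps_ip[OF reps_df[OF v w] reps_df[OF v w]]
    by (simp only:) (intro tendsto_intros)
qed

lemma rkhs_dist_triangle:
  assumes "reps u \<phi>" "reps v \<psi>" "reps w \<theta>"
  shows "cspace_dist rkhs \<phi> \<theta> \<le> cspace_dist rkhs \<phi> \<psi> + cspace_dist rkhs \<psi> \<theta>"
proof (rule LIMSEQ_le)
  show "(\<lambda>n. q (df (u n) (w n))) \<longlonglongrightarrow> cspace_dist rkhs \<phi> \<theta>"
    by (rule reps_dist[OF assms(1,3)])
  show "(\<lambda>n. q (df (u n) (v n)) + q (df (v n) (w n))) \<longlonglongrightarrow> cspace_dist rkhs \<phi> \<psi> + cspace_dist rkhs \<psi> \<theta>"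
    by (rule tendsto_add[OF reps_dist[OF assms(1,2)] reps_dist[OF assms(2,3)]])
  show "\<exists>N. \<forall>n\<ge>N. q (df (u n) (w n)) \<le> q (df (u n) (v n)) + q (df (v n) (w n))"
    using q_df_triangle by (intro exI[of _ 0] allI impI)
qed

lemma rkhs_dist_ev: "cspace_dist rkhs (ev l) (ev m) = q (df l m)"
  using LIMSEQ_unique[OF reps_dist[OF reps_ev reps_ev]] by force

lemma rkhs_ip_ev: "rkhs_ip (ev l) (ev m) = s l m"
  using LIMSEQ_unique[OF reps_ip[OF reps_ev reps_ev]] by force

lemma dist_reps_null:
  assumes v: "reps v \<phi>"
  shows "(\<lambda>n. cspace_dist rkhs \<phi> (ev (v n))) \<longlonglongrightarrow> 0"
proof (rule LIMSEQ_I)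
  fix e :: real assume "e > 0"
  then obtain N where N: "\<And>m n. m \<ge> N \<Longrightarrow> n \<ge> N \<Longrightarrow> q (df (v m) (v n)) < e/2"
    using v unfolding reps_def cau_def by (metis half_gt_zero)
  have "norm (cspace_dist rkhs \<phi> (ev (v n)) - 0) < e" if "n \<ge> N" for n
  proof -
    have "cspace_dist rkhs \<phi> (ev (v n)) \<le> e/2"
      by (rule LIMSEQ_le_const2[OF reps_dist[OF v reps_ev]]) (use N[OF _ that] in \<open>auto intro!: exI[of _ N] less_imp_le\<close>)
    moreover have "0 \<le> cspace_dist rkhs \<phi> (ev (v n))"
      by (rule LIMSEQ_le_const[OF reps_dist[OF v reps_ev]]) auto
    ultimately show ?thesis using \<open>e > 0\<close> by simp
  qed
  then show "\<exists>no. \<forall>n\<ge>no. norm (cspace_dist rkhs \<phi> (ev (v n)) - 0) < e" by blast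
qed

lemma ip_self_tendsto: "reps v \<phi> \<Longrightarrow> (\<lambda>n. (q (v n))\<^sup>2) \<longlonglongrightarrow> Re (rkhs_ip \<phi> \<phi>)"
  unfolding q_sq by (intro tendsto_intros reps_ip)

lemma rkhs_ip_nonneg: "reps v \<phi> \<Longrightarrow> 0 \<le> Re (rkhs_ip \<phi> \<phi>)"
  by (rule LIMSEQ_le_const[OF ip_self_tendsto]) auto

lemma rkhs_ip_commute:
  assumes "reps v \<phi>" "reps w \<psi>" shows "rkhs_ip \<phi> \<psi> = cnj (rkhs_ip \<psi> \<phi>)"
proof (rule LIMSEQ_unique[OF reps_ip[OF assms]])
  show "(\<lambda>n. s (v n) (w n)) \<longlonglongrightarrow> cnj (rkhs_ip \<psi> \<phi>)"
    by (subst s_commute) (intro tendsto_cnj reps_ip assms)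
qed

lemma rkhs_ip_eq_0:
  assumes v: "reps v \<phi>" and 0: "rkhs_ip \<phi> \<phi> = 0" shows "\<phi> = (\<lambda>_. 0)"
proof
  fix x
  have "(\<lambda>n. (q (v n))\<^sup>2) \<longlonglongrightarrow> 0" using ip_self_tendsto[OF v] 0 by simp
  then have "(\<lambda>n. sqrt ((q (v n))\<^sup>2)) \<longlonglongrightarrow> sqrt 0" by (intro tendsto_intros)
  then have "(\<lambda>n. q (v n) * q [(1, x)]) \<longlonglongrightarrow> 0 * q [(1, x)]" by (intro tendsto_intros) simp
  then have "(\<lambda>n. ev (v n) x) \<longlonglongrightarrow> 0"
    by (intro Lim_null_comparison[of "\<lambda>n. ev (v n) x" "\<lambda>n. q (v n) * q [(1, x)]"]) (auto simp: ev_def cauchy_schwarz)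
  then show "\<phi> x = 0" using v LIMSEQ_unique unfolding reps_def by blast
qed

lemma cspace_dist_nonneg: "0 \<le> cspace_dist rkhs x y"
proof (cases "x \<in> carrier rkhs \<and> y \<in> carrier rkhs")
  case True
  then obtain v w where "reps v x" "reps w y" by auto
  then show ?thesis by (intro LIMSEQ_le_const[OF reps_dist]) auto
next
  case False
  then show ?thesis unfolding cspace_dist_def by (simp only: if_False order_refl)
qed

lemma cspace_dist_commute: "cspace_dist rkhs x y = cspace_dist rkhs y x"
proof (cases "x \<in> carrier rkhs \<and> y \<in> carrier rkhs")
  case True
  then obtain v w where vw: "reps v x" "reps w y" by auto
  show ?thesis
    by (rule LIMSEQ_unique[OF reps_dist[OF vw]]) (subst q_df_commute, rule reps_dist[OF vw(2,1)])
next
  case False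
  then have "\<not> (y \<in> carrier rkhs \<and> x \<in> carrier rkhs)" by blast
  with False show ?thesis unfolding cspace_dist_def by (simp only: if_False)
qed

lemma metric_space_rkhs: "Metric_space (carrier rkhs) (cspace_dist rkhs)"
proof
  show "0 \<le> cspace_dist rkhs x y" for x y by (rule cspace_dist_nonneg)
  show "cspace_dist rkhs x y = cspace_dist rkhs y x" for x y by (rule cspace_dist_commute)
  show "cspace_dist rkhs x z \<le> cspace_dist rkhs x y + cspace_dist rkhs y z"
    if "x \<in> carrier rkhs" "y \<in> carrier rkhs" "z \<in> carrier rkhs" for x y z
    using that rkhs_dist_triangle by auto
  show "cspace_dist rkhs x y = 0 \<longleftrightarrow> x = y" if xy: "x \<in> carrier rkhs" "y \<in> carrier rkhs" for x y
  proof -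
    obtain v w where vw: "reps v x" "reps w y" using xy by auto
    show ?thesis
    proof
      assume 0: "cspace_dist rkhs x y = 0"
      show "x = y"
      proof
        fix a
        have "(\<lambda>n. q (df (v n) (w n)) * q [(1, a)]) \<longlonglongrightarrow> 0 * q [(1, a)]"
          using reps_dist[OF vw] 0 by (intro tendsto_intros) simp
        then have lim: "(\<lambda>n. q (df (v n) (w n)) * q [(1, a)]) \<longlonglongrightarrow> 0" by simp
        have "(\<lambda>n. ev (df (v n) (w n)) a) \<longlonglongrightarrow> 0"
          by (rule Lim_null_comparison[OF _ lim]) (simp add: ev_def cauchy_schwarz)
        moreover have "(\<lambda>n. ev (df (v n) (w n)) a) \<longlonglongrightarrow> x a - y a"
          using reps_df[OF vw] by (simp add: reps_def)
        ultimately have "x a - y a = 0" using LIMSEQ_unique by fastforce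
        then show "x a = y a" by simp
      qed
    next
      assume "x = y"
      then have "(\<lambda>n. q (df (v n) (v n))) \<longlonglongrightarrow> cspace_dist rkhs x y" using reps_dist[OF vw(1) vw(1)] by simp
      then show "cspace_dist rkhs x y = 0" using LIMSEQ_unique[of _ "cspace_dist rkhs x y" 0] by simp
    qed
  qed
qed

text \<open>
  A Cauchy sequence of limit functions is shadowed by a Cauchy sequence of formal combinations at distance less than
  \<open>1/(j+1)\<close>, whose own limit function is the limit.
\<close>

lemma complete_rkhs: "Metric_space.mcomplete (carrier rkhs) (cspace_dist rkhs)"
proof -
  interpret M: Metric_space "carrier rkhs" "cspace_dist rkhs" by (rule metric_space_rkhs)
  show ?thesis
    unfolding M.mcomplete_def
  proof (intro allI impI)
    fix \<sigma> assume \<sigma>: "M.MCauchy \<sigma>"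
    then have "range \<sigma> \<subseteq> carrier rkhs" unfolding M.MCauchy_def by blast
    then have \<sigma>_in: "\<sigma> n \<in> carrier rkhs" for n by blast
    have ev_in: "ev l \<in> carrier rkhs" for l using reps_ev by auto
    have "\<exists>l. cspace_dist rkhs (\<sigma> j) (ev l) < inverse (real (Suc j))" for j
    proof -
      obtain v where v: "reps v (\<sigma> j)" using \<sigma>_in[of j] by auto
      have "inverse (real (Suc j)) > 0" by simp
      from LIMSEQ_D[OF dist_reps_null[OF v] this]
      obtain n where "norm (cspace_dist rkhs (\<sigma> j) (ev (v n)) - 0) < inverse (real (Suc j))" by blast
      then show ?thesis by auto
    qed
    then obtain u where u: "\<And>j. cspace_dist rkhs (\<sigma> j) (ev (u j)) < inverse (real (Suc j))" by metis
    have small: "\<exists>N. \<forall>j\<ge>N. inverse (real (Suc j)) < e" if "e > 0" for e :: real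
    proof -
      obtain N where "inverse (real (Suc N)) < e" using reals_Archimedean[OF \<open>e > 0\<close>] by blast
      moreover have "inverse (real (Suc j)) \<le> inverse (real (Suc N))" if "j \<ge> N" for j
        using that by (simp add: field_simps)
      ultimately show ?thesis by (meson le_less_trans)
    qed
    have "cau u"
      unfolding cau_def
    proof (intro allI impI)
      fix e :: real assume "e > 0"
      then have e3: "e/3 > 0" by simp
      from small[OF e3] obtain N where N: "\<And>j. j \<ge> N \<Longrightarrow> inverse (real (Suc j)) < e/3" by blast
      obtain M where M: "\<And>m n. m \<ge> M \<Longrightarrow> n \<ge> M \<Longrightarrow> cspace_dist rkhs (\<sigma> m) (\<sigma> n) < e/3"
        using \<sigma> e3 unfolding M.MCauchy_def by meson
      have "q (df (u m) (u n)) < e" if "m \<ge> max N M" "n \<ge> max N M" for m n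
      proof -
        have "q (df (u m) (u n)) \<le> cspace_dist rkhs (ev (u m)) (\<sigma> m) + cspace_dist rkhs (\<sigma> m) (ev (u n))"
          using M.triangle[OF ev_in[of "u m"] \<sigma>_in[of m] ev_in[of "u n"]] by (simp add: rkhs_dist_ev)
        also have "\<dots> \<le> cspace_dist rkhs (\<sigma> m) (ev (u m)) + (cspace_dist rkhs (\<sigma> m) (\<sigma> n) + cspace_dist rkhs (\<sigma> n) (ev (u n)))"
          using M.triangle[OF \<sigma>_in[of m] \<sigma>_in[of n] ev_in[of "u n"]] M.commute[of "ev (u m)"] by simp
        also have "\<dots> < e" using u[of m] u[of n] N[of m] N[of n] M[of m n] that by auto
        finally show ?thesis .
      qed
      then show "\<exists>N. \<forall>m\<ge>N. \<forall>n\<ge>N. q (df (u m) (u n)) < e" by blast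
    qed
    define \<phi> where "\<phi> = (\<lambda>x. lim (\<lambda>n. ev (u n) x))"
    have \<phi>: "reps u \<phi>"
      unfolding reps_def
    proof (intro conjI allI)
      show "(\<lambda>n. ev (u n) x) \<longlonglongrightarrow> \<phi> x" for x
        using s_convergent[OF \<open>cau u\<close> cau_const] unfolding \<phi>_def ev_def by (simp add: convergent_LIMSEQ_iff)
    qed (rule \<open>cau u\<close>)
    then have \<phi>_in: "\<phi> \<in> carrier rkhs" by auto
    have "limitin M.mtopology \<sigma> \<phi> sequentially"
      unfolding M.limit_metric_sequentially
    proof (intro conjI allI impI)
      show "\<phi> \<in> carrier rkhs" by (rule \<phi>_in)
      fix e :: real assume "e > 0"
      then have e2: "e/2 > 0" by simp
      from small[OF e2] obtain N where N: "\<And>j. j \<ge> N \<Longrightarrow> inverse (real (Suc j)) < e/2" by blast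
      obtain M where M: "\<And>n. n \<ge> M \<Longrightarrow> norm (cspace_dist rkhs \<phi> (ev (u n)) - 0) < e/2"
        using LIMSEQ_D[OF dist_reps_null[OF \<phi>] e2] by blast
      have "cspace_dist rkhs (\<sigma> n) \<phi> < e" if n: "n \<ge> max N M" for n
      proof -
        have "cspace_dist rkhs (\<sigma> n) \<phi> \<le> cspace_dist rkhs (\<sigma> n) (ev (u n)) + cspace_dist rkhs \<phi> (ev (u n))"
          using M.triangle[OF \<sigma>_in[of n] ev_in[of "u n"] \<phi>_in] M.commute[of \<phi>] by simp
        then show ?thesis using u[of n] N[of n] M[of n] n by auto
      qed
      then show "\<exists>N. \<forall>n\<ge>N. \<sigma> n \<in> carrier rkhs \<and> cspace_dist rkhs (\<sigma> n) \<phi> < e" using \<sigma>_in by blast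
    qed
    then show "\<exists>x. limitin M.mtopology \<sigma> x sequentially" by blast
  qed
qed

lemma rkhs_ip_linear:
  assumes "x \<in> carrier rkhs" "y \<in> carrier rkhs"
  shows "cip rkhs x y = cnj (cip rkhs y x)" "cip rkhs (c \<odot>\<^bsub>rkhs\<^esub> x) y = c * cip rkhs x y"
    "z \<in> carrier rkhs \<Longrightarrow> cip rkhs (x \<oplus>\<^bsub>rkhs\<^esub> y) z = cip rkhs x z + cip rkhs y z"
proof -
  obtain v w where vw: "reps v x" "reps w y" using assms by auto
  show "cip rkhs x y = cnj (cip rkhs y x)" using rkhs_ip_commute[OF vw] by simp
  show "cip rkhs (c \<odot>\<^bsub>rkhs\<^esub> x) y = c * cip rkhs x y"
    using tendsto_mult_left[OF reps_ip[OF vw], of c]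
    by (simp, intro LIMSEQ_unique[OF reps_ip[OF reps_sc[OF vw(1)] vw(2)]]) (simp add: s_simps)
  assume "z \<in> carrier rkhs"
  then obtain u where u: "reps u z" by auto
  show "cip rkhs (x \<oplus>\<^bsub>rkhs\<^esub> y) z = cip rkhs x z + cip rkhs y z"
    using tendsto_add[OF reps_ip[OF vw(1) u] reps_ip[OF vw(2) u]]
    by (simp, intro LIMSEQ_unique[OF reps_ip[OF reps_add[OF vw] u]]) (simp add: s_simps)
qed

theorem hilbert_space_rkhs: "hilbert_space_on rkhs"
proof (intro hilbert_space_on.intro hilbert_space_on_axioms.intro)
  show "0 \<le> Re (cip rkhs x x)" if "x \<in> carrier rkhs" for x
    using that rkhs_ip_nonneg by auto
  show "x = \<zero>\<^bsub>rkhs\<^esub>" if "x \<in> carrier rkhs" "cip rkhs x x = 0" for x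
    using that rkhs_ip_eq_0 by auto
qed (fact module_rkhs complete_rkhs rkhs_ip_linear)+

end

section \<open>Dilations from translation-invariant kernels\<close>

lemma isometry_has_adjoint:
  fixes r :: "'h::complex_hilbert \<Rightarrow> 'k"
  assumes H: "hilbert_space_on H" and r: "isometry_into H r"
  shows "\<exists>r'. is_adjoint H r r'"
proof -
  interpret hilbert_space_on H by (rule H)
  have r_in: "r x \<in> carrier H" and r_add: "r (x + y) = r x \<oplus>\<^bsub>H\<^esub> r y"
    and r_sc: "r (c *\<^sub>C x) = c \<odot>\<^bsub>H\<^esub> r x" and r_norm: "cspace_norm H (r x) = norm x" for x y c
    using r by (auto simp: isometry_into_def)
  have "\<exists>z. \<forall>x. cip H (r x) y = cinner x z" if y: "y \<in> carrier H" for y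
  proof (rule riesz)
    show sc: "cip H (r (c *\<^sub>C x)) y = c * cip H (r x) y" for c x
      using r_in y by (simp add: r_sc cip_smult_left)
    show "bounded_linear (\<lambda>x. cip H (r x) y)"
    proof (rule bounded_linear_intro[where K = "cspace_norm H y"])
      show "cip H (r (a + b)) y = cip H (r a) y + cip H (r b) y" for a b
        using r_in y by (simp add: r_add cip_add_left)
      show "cip H (r (t *\<^sub>R x)) y = t *\<^sub>R cip H (r x) y" for t x
        using sc[of "of_real t" x] by (simp add: scaleC_of_real scaleR_conv_of_real)
      show "norm (cip H (r x) y) \<le> norm x * cspace_norm H y" for x
        using cauchy_schwarz[OF r_in y, of x] by (simp add: r_norm)
    qed
  qed
  then obtain r' where r': "\<And>x y. y \<in> carrier H \<Longrightarrow> cip H (r x) y = cinner x (r' y)" by metis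
  have "cinner (r' y) x = cip H y (r x)" if "y \<in> carrier H" for x y
    using r'[OF that, of x] cip_commute[OF that r_in, of x] cinner_commute[of "r' y" x] by simp
  then show ?thesis unfolding is_adjoint_def by blast
qed

text \<open>
  A positive definite function on an additive group with values in the operators on \<open>\<H>\<close>, written as a
  kernel on the product of the group and \<open>\<H>\<close>. Linearity in \<open>\<xi>\<close> is a consequence of \<open>diag\<close>, by positivity.
\<close>

locale translation_kernel = psd_space K
  for K :: "'g::real_vector \<times> 'h::complex_hilbert \<Rightarrow> 'g \<times> 'h \<Rightarrow> complex" +
  assumes translate: "K (p + a, \<xi>) (p' + a, \<eta>) = K (p, \<xi>) (p', \<eta>)"
    and diag: "K (p, \<xi>) (p, \<eta>) = cinner \<xi> \<eta>"
begin

definition shift :: "'g \<Rightarrow> (complex \<times> 'g \<times> 'h) list \<Rightarrow> (complex \<times> 'g \<times> 'h) list" where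
  "shift a l = map (\<lambda>(c, p, \<xi>). (c, p + a, \<xi>)) l"

definition U :: "'g \<Rightarrow> ('g \<times> 'h \<Rightarrow> complex) \<Rightarrow> 'g \<times> 'h \<Rightarrow> complex" where
  "U a \<phi> = (\<lambda>(p, \<xi>). \<phi> (p - a, \<xi>))"

definition embed :: "'h \<Rightarrow> 'g \<times> 'h \<Rightarrow> complex" where
  "embed \<xi> = ev [(1, 0, \<xi>)]"

lemma s_shift: "s (shift a l) (shift a m) = s l m"
  by (simp add: kform_def shift_def split_def comp_def translate)

lemma shift_df: "shift a (df l m) = df (shift a l) (shift a m)"
  by (simp add: shift_def df_def sc_def split_def)

lemma q_shift: "q (shift a l) = q l"
  by (simp add: q_def s_shift)

lemma U_ev: "U a (ev l) = ev (shift a l)"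
proof
  fix x :: "'g \<times> 'h"
  obtain p \<xi> where x: "x = (p, \<xi>)" by (cases x)
  show "U a (ev l) x = ev (shift a l) x"
    using s_shift[of a l "[(1, p - a, \<xi>)]"] by (simp add: U_def ev_def x) (simp add: shift_def)
qed

lemma reps_U: assumes "reps v \<phi>" shows "reps (\<lambda>n. shift a (v n)) (U a \<phi>)"
  unfolding reps_def
proof (intro conjI allI)
  show "cau (\<lambda>n. shift a (v n))"
    using assms by (simp add: reps_def cau_def shift_df[symmetric] q_shift)
  show "(\<lambda>n. ev (shift a (v n)) x) \<longlonglongrightarrow> U a \<phi> x" for x
    using assms unfolding U_ev[symmetric] by (simp add: U_def reps_def split_def)
qed

lemma U_add: "U (a + b) \<phi> = U a (U b \<phi>)"
  by (simp add: U_def fun_eq_iff split_def algebra_simps)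

lemma U_0 [simp]: "U 0 \<phi> = \<phi>"
  by (simp add: U_def fun_eq_iff)

lemma U_in: "\<phi> \<in> carrier rkhs \<Longrightarrow> U a \<phi> \<in> carrier rkhs"
  using reps_U by auto

lemma U_ip:
  assumes "\<phi> \<in> carrier rkhs" "\<psi> \<in> carrier rkhs"
  shows "rkhs_ip (U a \<phi>) (U a \<psi>) = rkhs_ip \<phi> \<psi>"
proof -
  obtain v w where vw: "reps v \<phi>" "reps w \<psi>" using assms by auto
  have "(\<lambda>n. s (v n) (w n)) \<longlonglongrightarrow> rkhs_ip (U a \<phi>) (U a \<psi>)"
    using reps_ip[OF reps_U[OF vw(1), of a] reps_U[OF vw(2), of a]] by (simp add: s_shift)
  then show ?thesis using reps_ip[OF vw] LIMSEQ_unique by blast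
qed

lemma U_dist:
  assumes "\<phi> \<in> carrier rkhs" "\<psi> \<in> carrier rkhs"
  shows "cspace_dist rkhs (U a \<phi>) (U a \<psi>) = cspace_dist rkhs \<phi> \<psi>"
proof -
  obtain v w where vw: "reps v \<phi>" "reps w \<psi>" using assms by auto
  have "(\<lambda>n. q (df (v n) (w n))) \<longlonglongrightarrow> cspace_dist rkhs (U a \<phi>) (U a \<psi>)"
    using reps_dist[OF reps_U[OF vw(1), of a] reps_U[OF vw(2), of a]] by (simp add: shift_df[symmetric] q_shift)
  then show ?thesis using reps_dist[OF vw] LIMSEQ_unique by blast
qed

lemma q_df_translate_sq:
  "(q (df [(1, p, \<xi>)] [(1, p', \<xi>)]))\<^sup>2 = 2 * (norm \<xi>)\<^sup>2 - 2 * Re (K (p - p', \<xi>) (0, \<xi>))"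
proof -
  have K1: "K (p, \<xi>) (p', \<xi>) = K (p - p', \<xi>) (0, \<xi>)"
    using translate[of "p - p'" p' \<xi> 0 \<xi>] by simp
  have "K (p', \<xi>) (p, \<xi>) = cnj (K (p, \<xi>) (p', \<xi>))"
    using psd unfolding psd_kernel_def by blast
  then show ?thesis
    unfolding q_sq s_df by (simp add: kform_def diag cinner_self K1)
qed

text \<open>
  By commutativity \<open>\<parallel>U(t)U(p)\<xi> - U(p)\<xi>\<parallel> = \<parallel>U(t)\<xi> - \<xi>\<parallel>\<close>, so continuity on \<open>\<H>\<close> passes to the translates of \<open>\<H>\<close>, to their
  combinations, and by density to the whole space.
\<close>

lemma strong_continuity:
  assumes e: "\<And>\<xi>. ((\<lambda>t. Re (K (t *\<^sub>R e, \<xi>) (0, \<xi>))) \<longlongrightarrow> (norm \<xi>)\<^sup>2) (at 0)"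
    and \<phi>: "\<phi> \<in> carrier rkhs"
  shows "((\<lambda>t. cspace_dist rkhs (U (t *\<^sub>R e) \<phi>) (U (t0 *\<^sub>R e) \<phi>)) \<longlongrightarrow> 0) (at t0)"
proof -
  interpret M: Metric_space "carrier rkhs" "cspace_dist rkhs" by (rule metric_space_rkhs)
  have 1: "((\<lambda>t. q (df (shift (t *\<^sub>R e) l) (shift (t0 *\<^sub>R e) l))) \<longlongrightarrow> 0) (at t0)" for l
  proof (induction l)
    case Nil
    then show ?case by (simp add: shift_def)
  next
    case (Cons x l)
    obtain c p \<xi> where x: "x = (c, p, \<xi>)" by (cases x)
    let ?g = "\<lambda>t. q (df [(1, p + t *\<^sub>R e, \<xi>)] [(1, p + t0 *\<^sub>R e, \<xi>)])"
    have "((\<lambda>t. Re (K ((t - t0) *\<^sub>R e, \<xi>) (0, \<xi>))) \<longlongrightarrow> (norm \<xi>)\<^sup>2) (at t0)"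
      using e[of \<xi>] by (subst LIM_offset_zero_iff[of t0]) (simp_all add: )
    then have "((\<lambda>t. 2 * (norm \<xi>)\<^sup>2 - 2 * Re (K ((t - t0) *\<^sub>R e, \<xi>) (0, \<xi>))) \<longlongrightarrow> 2 * (norm \<xi>)\<^sup>2 - 2 * (norm \<xi>)\<^sup>2) (at t0)"
      by (intro tendsto_intros)
    then have "((\<lambda>t. (?g t)\<^sup>2) \<longlongrightarrow> 0) (at t0)"
      unfolding q_df_translate_sq by (simp add: scaleR_left_diff_distrib)
    then have "((\<lambda>t. sqrt ((?g t)\<^sup>2)) \<longlongrightarrow> sqrt 0) (at t0)" by (intro tendsto_intros)
    then have "(?g \<longlongrightarrow> 0) (at t0)" by simp
    then have lim: "((\<lambda>t. cmod c * ?g t + q (df (shift (t *\<^sub>R e) l) (shift (t0 *\<^sub>R e) l))) \<longlongrightarrow> cmod c * 0 + 0) (at t0)"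
      by (intro tendsto_intros Cons)
    have le: "q (df (shift (t *\<^sub>R e) (x # l)) (shift (t0 *\<^sub>R e) (x # l)))
        \<le> cmod c * ?g t + q (df (shift (t *\<^sub>R e) l) (shift (t0 *\<^sub>R e) l))" for t
    proof -
      let ?d = "df [(1, p + t *\<^sub>R e, \<xi>)] [(1, p + t0 *\<^sub>R e, \<xi>)]"
      have "s (df (shift (t *\<^sub>R e) (x # l)) (shift (t0 *\<^sub>R e) (x # l))) m =
          s (sc c ?d @ df (shift (t *\<^sub>R e) l) (shift (t0 *\<^sub>R e) l)) m" for m
        using kform_Cons_left[of K c "(p + t *\<^sub>R e, \<xi>)"] kform_Cons_left[of K c "(p + t0 *\<^sub>R e, \<xi>)"]
        by (simp add: shift_def x s_simps s_df right_diff_distrib)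
      then have "q (df (shift (t *\<^sub>R e) (x # l)) (shift (t0 *\<^sub>R e) (x # l))) =
          q (sc c ?d @ df (shift (t *\<^sub>R e) l) (shift (t0 *\<^sub>R e) l))" by (rule q_cong)
      also have "\<dots> \<le> q (sc c ?d) + q (df (shift (t *\<^sub>R e) l) (shift (t0 *\<^sub>R e) l))" by (rule q_append)
      finally show ?thesis by (simp add: q_sc)
    qed
    show ?case
      by (rule real_tendsto_sandwich[OF _ _ tendsto_const lim[simplified]])
        (simp_all only: le q_nonneg eventually_True)
  qed
  obtain v where v: "reps v \<phi>" using \<phi> by auto
  show ?thesis
  proof (rule tendstoI)
    fix \<epsilon> :: real assume "\<epsilon> > 0"
    then have \<epsilon>3: "\<epsilon> / 3 > 0" by simp
    from LIMSEQ_D[OF dist_reps_null[OF v] this] obtain n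
      where n: "norm (cspace_dist rkhs \<phi> (ev (v n)) - 0) < \<epsilon> / 3" by blast
    define l where "l = v n"
    have l_in: "ev l \<in> carrier rkhs" using reps_ev by auto
    have "\<forall>\<^sub>F t in at t0. dist (q (df (shift (t *\<^sub>R e) l) (shift (t0 *\<^sub>R e) l))) 0 < \<epsilon> / 3"
      by (rule tendstoD[OF 1 \<epsilon>3])
    then show "\<forall>\<^sub>F t in at t0. dist (cspace_dist rkhs (U (t *\<^sub>R e) \<phi>) (U (t0 *\<^sub>R e) \<phi>)) 0 < \<epsilon>"
    proof eventually_elim
      fix t assume t: "dist (q (df (shift (t *\<^sub>R e) l) (shift (t0 *\<^sub>R e) l))) 0 < \<epsilon> / 3"
      let ?a = "U (t *\<^sub>R e)" and ?b = "U (t0 *\<^sub>R e)"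
      have "cspace_dist rkhs (?a \<phi>) (?b \<phi>) \<le> cspace_dist rkhs (?a \<phi>) (?a (ev l)) + cspace_dist rkhs (?a (ev l)) (?b \<phi>)"
        by (rule M.triangle) (intro U_in \<phi> l_in)+
      also have "cspace_dist rkhs (?a (ev l)) (?b \<phi>) \<le> cspace_dist rkhs (?a (ev l)) (?b (ev l)) + cspace_dist rkhs (?b (ev l)) (?b \<phi>)"
        by (rule M.triangle) (intro U_in \<phi> l_in)+
      also have "cspace_dist rkhs (?a \<phi>) (?a (ev l)) = cspace_dist rkhs \<phi> (ev l)" by (rule U_dist[OF \<phi> l_in])
      also have "cspace_dist rkhs (?b (ev l)) (?b \<phi>) = cspace_dist rkhs \<phi> (ev l)"
        using U_dist[OF l_in \<phi>] M.commute[of "ev l" \<phi>] by simp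
      also have "cspace_dist rkhs (?a (ev l)) (?b (ev l)) = q (df (shift (t *\<^sub>R e) l) (shift (t0 *\<^sub>R e) l))"
        by (simp add: U_ev rkhs_dist_ev)
      finally show "dist (cspace_dist rkhs (?a \<phi>) (?b \<phi>)) 0 < \<epsilon>"
        using t n cspace_dist_nonneg[of "?a \<phi>" "?b \<phi>"] unfolding l_def by simp
    qed
  qed
qed

theorem unitary_representation_U:
  assumes "\<And>\<xi>. ((\<lambda>t. Re (K (t *\<^sub>R e, \<xi>) (0, \<xi>))) \<longlongrightarrow> (norm \<xi>)\<^sup>2) (at 0)"
  shows "unitary_representation rkhs (\<lambda>t. U (t *\<^sub>R e))"
  unfolding unitary_representation_def
proof (intro conjI allI ballI)
  fix t
  show "bij_betw (U (t *\<^sub>R e)) (carrier rkhs) (carrier rkhs)"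
  proof (rule bij_betwI)
    show "U (t *\<^sub>R e) \<in> carrier rkhs \<rightarrow> carrier rkhs" "U (- (t *\<^sub>R e)) \<in> carrier rkhs \<rightarrow> carrier rkhs"
      using U_in by blast+
    show "U (- (t *\<^sub>R e)) (U (t *\<^sub>R e) x) = x" "U (t *\<^sub>R e) (U (- (t *\<^sub>R e)) x) = x" for x
      by (simp_all add: U_add[symmetric])
  qed
next
  fix t x y assume "x \<in> carrier rkhs" "y \<in> carrier rkhs"
  then show "cip rkhs (U (t *\<^sub>R e) x) (U (t *\<^sub>R e) y) = cip rkhs x y" using U_ip by simp
next
  fix x t assume "x \<in> carrier rkhs"
  then show "((\<lambda>s. cspace_dist rkhs (U (s *\<^sub>R e) x) (U (t *\<^sub>R e) x)) \<longlongrightarrow> 0) (at t)"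
    by (rule strong_continuity[OF assms])
qed (simp_all add: U_add[symmetric] scaleR_left_distrib, simp_all add: U_def split_def)

lemma ev_eqI:
  assumes "q (df l m) = 0" shows "ev l = ev m"
proof
  fix x
  have "cmod (s (df l m) [(1, x)]) \<le> 0" using cauchy_schwarz[of "df l m" "[(1, x)]"] assms by simp
  then show "ev l x = ev m x" by (simp add: ev_def s_df)
qed

text \<open>
  Two formal combinations at distance 0 define the same function. The diagonal of the kernel is the inner product of \<open>\<H>\<close>,
  so \<open>(0, x + y)\<close> and \<open>(0, x) + (0, y)\<close> are at distance 0.
\<close>

theorem isometry_embed: "isometry_into rkhs embed"
  unfolding isometry_into_def
proof (intro conjI allI)
  show "embed x \<in> carrier rkhs" for x using reps_ev by (auto simp: embed_def)
  show "embed (x + y) = embed x \<oplus>\<^bsub>rkhs\<^esub> embed y" for x y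
  proof -
    have "ev [(1, 0, x + y)] = ev ([(1, 0, x)] @ [(1, 0, y)])"
      by (rule ev_eqI) (simp add: q_def s_df s_simps, simp add: kform_def diag cinner_simps)
    then show ?thesis unfolding embed_def by (simp add: ev_def s_simps fun_eq_iff kform_append_left[of K "[_]" "[_]", simplified])
  qed
  show "embed (c *\<^sub>C x) = c \<odot>\<^bsub>rkhs\<^esub> embed x" for c x
  proof -
    have "ev [(1, 0, c *\<^sub>C x)] = ev (sc c [(1, 0, x)])"
      by (rule ev_eqI) (simp add: q_def s_df s_simps, simp add: kform_def diag cinner_simps algebra_simps)
    then show ?thesis unfolding embed_def by (simp add: ev_def s_simps fun_eq_iff)
  qed
  show "cspace_norm rkhs (embed x) = norm x" for x
    by (simp add: cspace_norm_def embed_def rkhs_ip_ev) (simp add: kform_def diag cinner_self)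
qed

lemma ip_U_embed: "cip rkhs (U p (embed \<xi>)) (embed \<eta>) = K (p, \<xi>) (0, \<eta>)"
  by (simp add: embed_def U_ev rkhs_ip_ev) (simp add: shift_def kform_def)

end

section \<open>Limits of kernels\<close>

text \<open>
  A cluster point in a product of discs: along one filter, finer than that of the sequence, all the
  bounded sequences converge simultaneously.
\<close>

lemma common_limit_filter:
  fixes f :: "'i \<Rightarrow> nat \<Rightarrow> complex"
  assumes "\<And>i n. cmod (f i n) \<le> B i"
  obtains F L where "F \<noteq> bot" "F \<le> sequentially" "\<And>i. (f i \<longlongrightarrow> L i) F"
proof -
  define C where "C = (\<Pi>\<^sub>E i\<in>UNIV. cball (0::complex) (B i))"
  define g where "g = (\<lambda>n i. f i n)"
  have "compactin (product_topology (\<lambda>_::'i. euclidean) UNIV) C"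
    unfolding C_def by (subst compactin_PiE) auto
  then have C: "compact C" by (simp add: euclidean_product_topology)
  have "filtermap g sequentially \<noteq> bot" by (simp add: filtermap_bot_iff)
  moreover have "eventually (\<lambda>x. x \<in> C) (filtermap g sequentially)"
    using assms by (simp add: eventually_filtermap g_def C_def PiE_iff)
  ultimately have "\<exists>L\<in>C. inf (nhds L) (filtermap g sequentially) \<noteq> bot"
    by (rule C[unfolded compact_filter, rule_format])
  then obtain L where L: "inf (nhds L) (filtermap g sequentially) \<noteq> bot" by (rule bexE)
  define F where "F = inf sequentially (filtercomap g (nhds L))"
  show thesis
  proof
    show "F \<noteq> bot"
    proof
      assume "F = bot"
      then obtain P Q where P: "eventually P sequentially" and Q: "eventually Q (filtercomap g (nhds L))"
        and PQ: "\<And>n. P n \<Longrightarrow> Q n \<Longrightarrow> False"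
        unfolding F_def trivial_limit_def eventually_inf by (elim exE conjE) (simp, metis)
      from Q obtain R where R: "eventually R (nhds L)" "\<And>n. R (g n) \<Longrightarrow> Q n"
        unfolding eventually_filtercomap by blast
      have "eventually (\<lambda>x. \<not> R x) (filtermap g sequentially)"
        unfolding eventually_filtermap using P by eventually_elim (use PQ R in blast)
      with R(1) have "eventually (\<lambda>_. False) (inf (nhds L) (filtermap g sequentially))"
        unfolding eventually_inf by blast
      then show False using L by (simp add: trivial_limit_def)
    qed
    show "F \<le> sequentially" by (simp add: F_def)
    have "filterlim g (nhds L) F"
      unfolding F_def by (rule filterlim_mono[OF filterlim_filtercomap order_refl]) simp
    then have "((\<lambda>n. g n i) \<longlongrightarrow> L i) F" for i
      by (rule continuous_on_tendsto_compose[OF continuous_on_product_coordinates]) simp_all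
    then show "(f i \<longlongrightarrow> L i) F" for i by (simp add: g_def)
  qed
qed

lemma kform_pullback: "kform (\<lambda>x y. k (g x) (g y)) l m = kform k (map (\<lambda>(c, x). (c, g x)) l) (map (\<lambda>(c, x). (c, g x)) m)"
  by (simp add: kform_def split_def comp_def)

lemma psd_kernel_pullback: "psd_kernel k \<Longrightarrow> psd_kernel (\<lambda>x y. k (g x) (g y))"
  unfolding psd_kernel_def kform_pullback[of k g] by blast

lemma kform_tendsto:
  assumes "\<And>x y. ((\<lambda>n. k n x y) \<longlongrightarrow> k' x y) F"
  shows "((\<lambda>n. kform (k n) l m) \<longlongrightarrow> kform k' l m) F"
proof -
  have 1: "((\<lambda>n. \<Sum>(d, y)\<leftarrow>m. c * cnj d * k n x y) \<longlongrightarrow> (\<Sum>(d, y)\<leftarrow>m. c * cnj d * k' x y)) F" for c x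
    by (induction m) (auto intro!: tendsto_add tendsto_mult tendsto_const assms)
  show ?thesis unfolding kform_def by (induction l) (auto intro!: tendsto_add 1)
qed

lemma psd_kernel_limit:
  assumes "F \<noteq> bot" "\<And>n. psd_kernel (k n)" "\<And>x y. ((\<lambda>n. k n x y) \<longlongrightarrow> k' x y) F"
  shows "psd_kernel k'"
  unfolding psd_kernel_def
proof (intro conjI allI)
  fix x y
  have "((\<lambda>n. cnj (k n y x)) \<longlongrightarrow> cnj (k' y x)) F" by (intro tendsto_cnj assms)
  moreover have "(\<lambda>n. cnj (k n y x)) = (\<lambda>n. k n x y)"
    using assms(2) unfolding psd_kernel_def by metis
  ultimately have "((\<lambda>n. k n x y) \<longlongrightarrow> cnj (k' y x)) F" by (simp only:)
  then show "k' x y = cnj (k' y x)" by (rule tendsto_unique[OF assms(1,3)])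
next
  fix l
  have "((\<lambda>n. Re (kform (k n) l l)) \<longlongrightarrow> Re (kform k' l l)) F"
    by (intro tendsto_Re kform_tendsto assms)
  then show "0 \<le> Re (kform k' l l)"
    by (rule tendsto_lowerbound[OF _ _ assms(1)]) (use assms(2) in \<open>auto simp: psd_kernel_def\<close>)
qed

section \<open>From lattices to the plane\<close>

context commuting_strict_contractions
begin

abbreviation lattice_kernel :: "(int \<times> int) \<times> 'h \<Rightarrow> (int \<times> int) \<times> 'h \<Rightarrow> complex" where
  "lattice_kernel \<equiv> (\<lambda>(p, \<xi>) (q, \<eta>). \<Phi> (p - q) \<xi> \<eta>)"

sublocale Z: psd_space lattice_kernel
  by standard (rule psd_\<Phi>)

lemma \<Phi>_0: "\<Phi> (0, 0) \<xi> \<eta> = cinner \<xi> \<eta>"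
  using \<Phi>_nonneg[of 0 0] by simp

lemma \<Phi>_uminus: "\<Phi> (- p) \<xi> \<eta> = cnj (\<Phi> p \<eta> \<xi>)"
proof -
  have "lattice_kernel (0, \<xi>) (p, \<eta>) = cnj (lattice_kernel (p, \<eta>) (0, \<xi>))"
    using psd_\<Phi> unfolding psd_kernel_def by blast
  then show ?thesis by simp
qed

lemma q_single: "Z.q [(1, p, \<xi>)] = norm \<xi>"
  using \<Phi>_0[of \<xi> \<xi>] by (simp add: Z.q_def kform_def cinner_self zero_prod_def)

lemma \<Phi>_bound: "cmod (\<Phi> p \<xi> \<eta>) \<le> norm \<xi> * norm \<eta>"
  using Z.cauchy_schwarz[of "[(1, p, \<xi>)]" "[(1, 0, \<eta>)]"] unfolding q_single by (simp add: kform_def)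

definition \<omega> :: "'h \<Rightarrow> real" where
  "\<omega> \<xi> = sqrt (2 * (norm \<xi>)\<^sup>2 - 2 * Re (cinner (T1 \<xi>) \<xi>)) + sqrt (2 * (norm \<xi>)\<^sup>2 - 2 * Re (cinner (T2 \<xi>) \<xi>))"

lemma q_df_lattice: "Z.q (Z.df [(1, p, \<xi>)] [(1, p', \<xi>)]) = sqrt (2 * (norm \<xi>)\<^sup>2 - 2 * Re (\<Phi> (p - p') \<xi> \<xi>))"
proof -
  have "Re (\<Phi> (p' - p) \<xi> \<xi>) = Re (\<Phi> (p - p') \<xi> \<xi>)" using \<Phi>_uminus[of "p - p'" \<xi> \<xi>] by simp
  then show ?thesis unfolding Z.q_def Z.s_df by (simp add: kform_def zero_prod_def \<Phi>_0 cinner_self)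
qed

text \<open>
  In the dilation space, neighbouring translates of \<open>\<xi>\<close> are at most as far apart as \<open>\<xi>\<close> is from its images
  under one step in each direction; the Cauchy--Schwarz inequality does the rest.
\<close>

lemma lattice_step:
  assumes "\<bar>fst (p - p')\<bar> \<le> 1" "\<bar>snd (p - p')\<bar> \<le> 1"
  shows "cmod (\<Phi> p \<xi> \<eta> - \<Phi> p' \<xi> \<eta>) \<le> \<omega> \<xi> * norm \<eta>"
proof -
  have nn: "2 * (norm \<xi>)\<^sup>2 - 2 * Re (cinner (X \<xi>) \<xi>) \<ge> 0" if "norm (X \<xi>) \<le> norm \<xi>" for X
  proof -
    have "Re (cinner (X \<xi>) \<xi>) \<le> norm (X \<xi>) * norm \<xi>"
      using cinner_bound[of "X \<xi>" \<xi>] complex_Re_le_cmod order_trans by blast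
    also have "\<dots> \<le> norm \<xi> * norm \<xi>" using that by (simp add: mult_right_mono)
    finally show ?thesis by (simp add: power2_eq_square)
  qed
  obtain a b where p': "p' = (a, b)" by (cases p')
  obtain c d where p: "p = (c, d)" by (cases p)
  have "c - a \<in> {-1, 0, 1}" "d - b \<in> {-1, 0, 1}" using assms by (auto simp: p p')
  moreover have "Re (\<Phi> (1, 0) \<xi> \<xi>) = Re (cinner (T1 \<xi>) \<xi>)" "Re (\<Phi> (0, 1) \<xi> \<xi>) = Re (cinner (T2 \<xi>) \<xi>)"
    using \<Phi>_nonneg[of 1 0 \<xi> \<xi>] \<Phi>_nonneg[of 0 1 \<xi> \<xi>] by simp_all
  moreover from this have "Re (\<Phi> (-1, 0) \<xi> \<xi>) = Re (cinner (T1 \<xi>) \<xi>)" "Re (\<Phi> (0, -1) \<xi> \<xi>) = Re (cinner (T2 \<xi>) \<xi>)"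
    using \<Phi>_uminus[of "(1, 0)" \<xi> \<xi>] \<Phi>_uminus[of "(0, 1)" \<xi> \<xi>] by simp_all
  ultimately have 
    "Z.q (Z.df [(1, p, \<xi>)] [(1, (a, d), \<xi>)]) \<le> sqrt (2 * (norm \<xi>)\<^sup>2 - 2 * Re (cinner (T1 \<xi>) \<xi>))"
    "Z.q (Z.df [(1, (a, d), \<xi>)] [(1, p', \<xi>)]) \<le> sqrt (2 * (norm \<xi>)\<^sup>2 - 2 * Re (cinner (T2 \<xi>) \<xi>))"
    unfolding q_df_lattice p p' using nn[of T1, OF T1.norm_le'] nn[of T2, OF T2.norm_le']
    by (auto simp: \<Phi>_0 cinner_self)
  then have "Z.q (Z.df [(1, p, \<xi>)] [(1, p', \<xi>)]) \<le> \<omega> \<xi>"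
    using Z.q_df_triangle[of "[(1, p, \<xi>)]" "[(1, p', \<xi>)]" "[(1, (a, d), \<xi>)]"] unfolding \<omega>_def by linarith
  then have "Z.q (Z.df [(1, p, \<xi>)] [(1, p', \<xi>)]) * norm \<eta> \<le> \<omega> \<xi> * norm \<eta>" by (simp add: mult_right_mono)
  moreover have "\<Phi> p \<xi> \<eta> - \<Phi> p' \<xi> \<eta> = kform lattice_kernel (Z.df [(1, p, \<xi>)] [(1, p', \<xi>)]) [(1, 0, \<eta>)]"
    unfolding Z.s_df by (simp add: kform_def)
  moreover have "cmod (kform lattice_kernel (Z.df [(1, p, \<xi>)] [(1, p', \<xi>)]) [(1, 0, \<eta>)]) \<le>
      Z.q (Z.df [(1, p, \<xi>)] [(1, p', \<xi>)]) * norm \<eta>"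
    using Z.cauchy_schwarz[of "Z.df [(1, p, \<xi>)] [(1, p', \<xi>)]" "[(1, 0, \<eta>)]"] unfolding q_single .
  ultimately show ?thesis by simp
qed

end

lemma semigroupD:
  assumes "contractive_C0_semigroup S" "t \<ge> 0"
  shows "bounded_linear (S t)" "S t (c *\<^sub>C x) = c *\<^sub>C S t x" "norm (S t x) \<le> norm x"
    "S 0 = id" "s \<ge> 0 \<Longrightarrow> S (s + t) x = S s (S t x)" "continuous_on {0..} (\<lambda>t. S t x)"
proof -
  have S: "bounded_linear (S t)" "onorm (S t) \<le> 1" using assms by (auto simp: contractive_C0_semigroup_def)
  show "norm (S t x) \<le> norm x"
    using onorm[OF S(1), of x] S(2) mult_right_mono[of "onorm (S t)" 1 "norm x"] by simp
  show "s \<ge> 0 \<Longrightarrow> S (s + t) x = S s (S t x)"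
    using assms unfolding contractive_C0_semigroup_def by (metis comp_apply)
qed (use assms in \<open>auto simp: contractive_C0_semigroup_def\<close>)

lemma semigroup_power:
  assumes S: "contractive_C0_semigroup S" and h: "h \<ge> 0"
  shows "((\<lambda>x. a *\<^sub>R S h x) ^^ k) x = a ^ k *\<^sub>R S (real k * h) x"
proof (induction k)
  case 0 then show ?case using semigroupD(4)[OF S order_refl] by simp
next
  case (Suc k)
  interpret bounded_linear "S h" by (rule semigroupD(1)[OF S h])
  have "S (real (Suc k) * h) x = S h (S (real k * h) x)"
    using semigroupD(5)[OF S, of "real k * h" h x] h by (simp add: algebra_simps)
  then show ?case using Suc by (simp add: scaleR)
qed

theorem two_parameter_kernel:
  fixes S1 S2 :: "real \<Rightarrow> 'h \<Rightarrow> 'h::complex_hilbert"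
  assumes S1: "contractive_C0_semigroup S1" and S2: "contractive_C0_semigroup S2"
    and comm: "\<And>s t. s \<ge> 0 \<Longrightarrow> t \<ge> 0 \<Longrightarrow> S1 s \<circ> S2 t = S2 t \<circ> S1 s"
  shows "\<exists>K :: (real \<times> real) \<times> 'h \<Rightarrow> (real \<times> real) \<times> 'h \<Rightarrow> complex. translation_kernel K \<and>
    (\<forall>s\<ge>0. \<forall>t\<ge>0. \<forall>\<xi> \<eta>. K ((s, t), \<xi>) (0, \<eta>) = cinner (S1 s (S2 t \<xi>)) \<eta>)"
proof -
  define \<nu> where "\<nu> = (\<lambda>n. real (Suc n))"
  have \<nu>: "\<nu> n > 0" for n by (simp add: \<nu>_def)
  \<comment> \<open>The damping makes the contractions strict; its exponent is so small that \<open>\<nu> n * s\<close> steps still damp by a factor tending to 1.\<close>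
  define c where "c = (\<lambda>n. exp (- (1 / (\<nu> n)\<^sup>2)))"
  have c: "0 < c n" "c n < 1" for n using \<nu>[of n] by (simp_all add: c_def)
  define X1 where "X1 = (\<lambda>n x. c n *\<^sub>R S1 (1 / \<nu> n) x)"
  define X2 where "X2 = (\<lambda>n x. c n *\<^sub>R S2 (1 / \<nu> n) x)"
  have sc: "strict_contraction (\<lambda>x. c n *\<^sub>R S (1 / \<nu> n) x) (c n)" if S: "contractive_C0_semigroup S"
    for n and S :: "real \<Rightarrow> 'h \<Rightarrow> 'h"
  proof -
    have h: "1 / \<nu> n \<ge> 0" using \<nu>[of n] by simp
    show ?thesis
    proof (rule strict_contraction.intro)
      show "bounded_linear (\<lambda>x. c n *\<^sub>R S (1 / \<nu> n) x)"
        by (rule bounded_linear_compose[OF bounded_linear_scaleR_right semigroupD(1)[OF S h]])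
      show "c n *\<^sub>R S (1 / \<nu> n) (d *\<^sub>C x) = d *\<^sub>C c n *\<^sub>R S (1 / \<nu> n) x" for d x
        by (simp add: semigroupD(2)[OF S h] scaleC_scaleR)
      show "norm (c n *\<^sub>R S (1 / \<nu> n) x) \<le> c n * norm x" for x
        using c[of n] semigroupD(3)[OF S h, of x] by (simp add: mult_left_mono)
    qed (use c[of n] in auto)
  qed
  have strict: "commuting_strict_contractions (X1 n) (X2 n) (c n)" for n
  proof (intro commuting_strict_contractions.intro commuting_strict_contractions_axioms.intro)
    have h: "1 / \<nu> n \<ge> 0" using \<nu>[of n] by simp
    interpret L1: bounded_linear "S1 (1 / \<nu> n)" by (rule semigroupD(1)[OF S1 h])
    interpret L2: bounded_linear "S2 (1 / \<nu> n)" by (rule semigroupD(1)[OF S2 h])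
    show "X1 n (X2 n x) = X2 n (X1 n x)" for x
      using fun_cong[OF comm[OF h h], of x] by (simp add: X1_def X2_def L1.scaleR L2.scaleR)
  qed (unfold X1_def X2_def, (intro sc S1 S2)+)
  define \<Phi> where "\<Phi> = (\<lambda>n. commuting_strict_contractions.\<Phi> (X1 n) (X2 n))"
  define \<omega> where "\<omega> = (\<lambda>n. commuting_strict_contractions.\<omega> (X1 n) (X2 n))"
  have \<Phi>_bound: "cmod (\<Phi> n p \<xi> \<eta>) \<le> norm \<xi> * norm \<eta>" for n p \<xi> \<eta>
    unfolding \<Phi>_def by (rule commuting_strict_contractions.\<Phi>_bound[OF strict])
  have \<Phi>_nonneg: "\<Phi> n (int k, int l) \<xi> \<eta> = cinner ((X1 n ^^ k) ((X2 n ^^ l) \<xi>)) \<eta>" for n k l \<xi> \<eta>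
    unfolding \<Phi>_def by (rule commuting_strict_contractions.\<Phi>_nonneg[OF strict])
  have \<Phi>_0: "\<Phi> n (0, 0) \<xi> \<eta> = cinner \<xi> \<eta>" for n \<xi> \<eta>
    unfolding \<Phi>_def by (rule commuting_strict_contractions.\<Phi>_0[OF strict])
  have psd_\<Phi>: "psd_kernel (\<lambda>(p, \<xi>) (q, \<eta>). \<Phi> n (p - q) \<xi> \<eta>)" for n
    unfolding \<Phi>_def by (rule commuting_strict_contractions.psd_\<Phi>[OF strict])
  have step: "cmod (\<Phi> n p \<xi> \<eta> - \<Phi> n p' \<xi> \<eta>) \<le> \<omega> n \<xi> * norm \<eta>"
    if "\<bar>fst (p - p')\<bar> \<le> 1" "\<bar>snd (p - p')\<bar> \<le> 1" for n p p' \<xi> \<eta>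
    unfolding \<Phi>_def \<omega>_def by (rule commuting_strict_contractions.lattice_step[OF strict that])
  define fl where "fl = (\<lambda>n (p :: real \<times> real). (\<lfloor>\<nu> n * fst p\<rfloor>, \<lfloor>\<nu> n * snd p\<rfloor>))"
  define \<kappa> where "\<kappa> = (\<lambda>n x y. \<Phi> n (fl n (fst x) - fl n (fst y)) (snd x) (snd y))"
  have "cmod (\<kappa> n x y) \<le> norm (snd x) * norm (snd y)" for n x y
    unfolding \<kappa>_def by (rule \<Phi>_bound)
  then obtain F L where F: "F \<noteq> bot" "F \<le> sequentially"
    and L: "\<And>i. ((\<lambda>n. \<kappa> n (fst i) (snd i)) \<longlongrightarrow> L i) F"
    by (rule common_limit_filter[of "\<lambda>i n. \<kappa> n (fst i) (snd i)" "\<lambda>i. norm (snd (fst i)) * norm (snd (snd i))"]) (rule that)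
  define K where "K = (\<lambda>x y. L (x, y))"
  have K: "((\<lambda>n. \<kappa> n x y) \<longlongrightarrow> K x y) F" for x y using L[of "(x, y)"] by (simp add: K_def)
  have K_eqI: "K x y = z" if "(\<lambda>n. \<kappa> n x y) \<longlonglongrightarrow> z" for x y z
    using tendsto_unique[OF F(1) K tendsto_mono[OF F(2) that]] .
  have psd: "psd_kernel K"
  proof (rule psd_kernel_limit[OF F(1) _ K])
    show "psd_kernel (\<kappa> n)" for n
      using psd_kernel_pullback[OF psd_\<Phi>[of n], of "\<lambda>x. (fl n (fst x), snd x)"] by (simp add: \<kappa>_def)
  qed
  have inv_\<nu>: "(\<lambda>n. 1 / \<nu> n) \<longlonglongrightarrow> 0"
    using LIMSEQ_inverse_real_of_nat by (simp add: \<nu>_def inverse_eq_divide)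
  have c_lim: "c \<longlonglongrightarrow> 1"
  proof -
    have "(\<lambda>n. exp (- ((1 / \<nu> n)\<^sup>2))) \<longlonglongrightarrow> exp (- (0\<^sup>2))" by (intro tendsto_intros inv_\<nu>)
    then show ?thesis by (simp add: c_def power_one_over)
  qed
  have S_lim: "(\<lambda>n. S (f n) \<xi>) \<longlonglongrightarrow> S t \<xi>"
    if "contractive_C0_semigroup S" "f \<longlonglongrightarrow> t" "\<And>n. f n \<ge> 0" "t \<ge> 0"
    for S :: "real \<Rightarrow> 'h \<Rightarrow> 'h" and f t \<xi>
    using continuous_on_tendsto_compose[OF semigroupD(6)[OF that(1,4), of \<xi>] that(2)] that(3,4) by simp
  have \<omega>_lim: "(\<lambda>n. \<omega> n \<xi>) \<longlonglongrightarrow> 0" for \<xi>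
  proof -
    have lim: "(\<lambda>n. c n *\<^sub>R S (1 / \<nu> n) \<xi>) \<longlonglongrightarrow> 1 *\<^sub>R S 0 \<xi>" if "contractive_C0_semigroup S"
      for S :: "real \<Rightarrow> 'h \<Rightarrow> 'h"
      using \<nu> by (intro tendsto_scaleR c_lim S_lim[OF that inv_\<nu>]) (auto intro: less_imp_le)
    have "(\<lambda>n. \<omega> n \<xi>) \<longlonglongrightarrow> sqrt (2 * (norm \<xi>)\<^sup>2 - 2 * Re (cinner (1 *\<^sub>R S1 0 \<xi>) \<xi>)) + sqrt (2 * (norm \<xi>)\<^sup>2 - 2 * Re (cinner (1 *\<^sub>R S2 0 \<xi>) \<xi>))"
      unfolding \<omega>_def commuting_strict_contractions.\<omega>_def[OF strict] unfolding X1_def X2_def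
      by (intro tendsto_intros tendsto_Re tendsto_cinner_left lim S1 S2)
    then show ?thesis
      using semigroupD(4)[OF S1 order_refl] semigroupD(4)[OF S2 order_refl] by (simp add: cinner_self)
  qed
  have translate: "K (p + a, \<xi>) (p' + a, \<eta>) = K (p, \<xi>) (p', \<eta>)" for p a p' \<xi> \<eta>
  proof -
    \<comment> \<open>Rounding is additive up to one unit.\<close>
    have fl_step: "\<bar>(\<lfloor>x + z\<rfloor> - \<lfloor>y + z\<rfloor>) - (\<lfloor>x\<rfloor> - \<lfloor>y\<rfloor>)\<bar> \<le> 1" for x y z :: real by linarith
    have "(\<lambda>n. \<kappa> n (p + a, \<xi>) (p' + a, \<eta>) - \<kappa> n (p, \<xi>) (p', \<eta>)) \<longlonglongrightarrow> 0"
    proof (rule Lim_null_comparison)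
      show "\<forall>\<^sub>F n in sequentially. norm (\<kappa> n (p + a, \<xi>) (p' + a, \<eta>) - \<kappa> n (p, \<xi>) (p', \<eta>)) \<le> \<omega> n \<xi> * norm \<eta>"
        unfolding \<kappa>_def fst_conv snd_conv
        by (intro always_eventually allI step) (simp_all add: fl_def distrib_left fl_step)
      show "(\<lambda>n. \<omega> n \<xi> * norm \<eta>) \<longlonglongrightarrow> 0" using tendsto_mult_right[OF \<omega>_lim[of \<xi>], of "norm \<eta>"] by simp
    qed
    then have "((\<lambda>n. \<kappa> n (p + a, \<xi>) (p' + a, \<eta>) - \<kappa> n (p, \<xi>) (p', \<eta>)) \<longlongrightarrow> 0) F"
      by (rule tendsto_mono[OF F(2)])
    moreover have "((\<lambda>n. \<kappa> n (p + a, \<xi>) (p' + a, \<eta>) - \<kappa> n (p, \<xi>) (p', \<eta>)) \<longlongrightarrow>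
        K (p + a, \<xi>) (p' + a, \<eta>) - K (p, \<xi>) (p', \<eta>)) F" by (intro tendsto_diff K)
    ultimately have "K (p + a, \<xi>) (p' + a, \<eta>) - K (p, \<xi>) (p', \<eta>) = 0" using tendsto_unique[OF F(1)] by blast
    then show ?thesis by simp
  qed
  have diag: "K (p, \<xi>) (p, \<eta>) = cinner \<xi> \<eta>" for p \<xi> \<eta>
    by (rule K_eqI) (simp add: \<kappa>_def \<Phi>_0 zero_prod_def)
  have "translation_kernel K"
    by (intro translation_kernel.intro psd_space.intro translation_kernel_axioms.intro psd translate diag)
  moreover have "K ((s, t), \<xi>) (0, \<eta>) = cinner (S1 s (S2 t \<xi>)) \<eta>" if s: "s \<ge> 0" and t: "t \<ge> 0" for s t \<xi> \<eta>
  proof (rule K_eqI)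
    define k where "k = (\<lambda>r n. nat \<lfloor>\<nu> n * r\<rfloor>)"
    have fl: "fl n (s, t) - fl n 0 = (int (k s n), int (k t n))" for n
      using s t \<nu>[of n] by (simp add: fl_def k_def)
    have k_lim: "(\<lambda>n. real (k r n) * (1 / \<nu> n)) \<longlonglongrightarrow> r" if r: "r \<ge> 0" for r
    proof (rule tendsto_sandwich[of "\<lambda>n. r - 1 / \<nu> n" _ _ "\<lambda>_. r"])
      have "real (k r n) \<ge> \<nu> n * r - 1 \<and> real (k r n) \<le> \<nu> n * r" for n
      proof -
        have "\<nu> n * r \<ge> 0" using \<nu>[of n] r by simp
        then show ?thesis unfolding k_def by linarith
      qed
      then have *: "(\<nu> n * r - 1) * (1 / \<nu> n) \<le> real (k r n) * (1 / \<nu> n) \<and> real (k r n) * (1 / \<nu> n) \<le> \<nu> n * r * (1 / \<nu> n)" for n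
        using \<nu>[of n] by (intro conjI mult_right_mono) (auto intro: less_imp_le)
      have "(\<nu> n * r - 1) * (1 / \<nu> n) = r - 1 / \<nu> n" "\<nu> n * r * (1 / \<nu> n) = r" for n
        using \<nu>[of n] by (simp_all add: field_simps)
      then show "\<forall>\<^sub>F n in sequentially. r - 1 / \<nu> n \<le> real (k r n) * (1 / \<nu> n)" "\<forall>\<^sub>F n in sequentially. real (k r n) * (1 / \<nu> n) \<le> r"
        using * by auto
      show "(\<lambda>n. r - 1 / \<nu> n) \<longlonglongrightarrow> r" using tendsto_diff[OF tendsto_const inv_\<nu>, of r] by simp
    qed simp
    have ck_lim: "(\<lambda>n. c n ^ k r n) \<longlonglongrightarrow> 1" if r: "r \<ge> 0" for r
    proof -
      have "(\<lambda>n. exp (- (real (k r n) * (1 / \<nu> n) * (1 / \<nu> n)))) \<longlonglongrightarrow> exp (- (r * 0))"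
        by (intro tendsto_intros k_lim[OF r] inv_\<nu>)
      moreover have "c n ^ k r n = exp (- (real (k r n) * (1 / \<nu> n) * (1 / \<nu> n)))" for n
        unfolding c_def by (simp add: exp_of_nat_mult[symmetric] power2_eq_square)
      ultimately show ?thesis by simp
    qed
    let ?a = "\<lambda>n. real (k s n) * (1 / \<nu> n)" and ?b = "\<lambda>n. real (k t n) * (1 / \<nu> n)"
    have pos: "?a n \<ge> 0" "?b n \<ge> 0" for n using \<nu>[of n] by simp_all
    have "\<kappa> n ((s, t), \<xi>) (0, \<eta>) = cinner ((c n ^ k s n * c n ^ k t n) *\<^sub>R S1 (?a n) (S2 (?b n) \<xi>)) \<eta>" for n
    proof -
      have h: "1 / \<nu> n \<ge> 0" using \<nu>[of n] by simp
      interpret L1: bounded_linear "S1 (?a n)" by (rule semigroupD(1)[OF S1 pos(1)])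
      show ?thesis
        unfolding \<kappa>_def fst_conv snd_conv fl \<Phi>_nonneg unfolding X1_def X2_def semigroup_power[OF S1 h] semigroup_power[OF S2 h]
        by (simp only: L1.scaleR scaleR_scaleR)
    qed
    moreover have "(\<lambda>n. S1 (?a n) (S2 (?b n) \<xi>)) \<longlonglongrightarrow> S1 s (S2 t \<xi>)"
    proof -
      have "(\<lambda>n. S1 (?a n) (S2 (?b n) \<xi> - S2 t \<xi>)) \<longlonglongrightarrow> 0"
      proof (rule Lim_null_comparison)
        show "\<forall>\<^sub>F n in sequentially. norm (S1 (?a n) (S2 (?b n) \<xi> - S2 t \<xi>)) \<le> norm (S2 (?b n) \<xi> - S2 t \<xi>)"
          by (intro always_eventually allI semigroupD(3)[OF S1 pos(1)])
        have "(\<lambda>n. S2 (?b n) \<xi>) \<longlonglongrightarrow> S2 t \<xi>" by (rule S_lim[OF S2 k_lim[OF t] pos(2) t])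
        then show "(\<lambda>n. norm (S2 (?b n) \<xi> - S2 t \<xi>)) \<longlonglongrightarrow> 0"
          using LIM_zero tendsto_norm_zero by blast
      qed
      moreover have "(\<lambda>n. S1 (?a n) (S2 t \<xi>)) \<longlonglongrightarrow> S1 s (S2 t \<xi>)" by (rule S_lim[OF S1 k_lim[OF s] pos(1) s])
      moreover have "S1 (?a n) (S2 (?b n) \<xi>) = S1 (?a n) (S2 (?b n) \<xi> - S2 t \<xi>) + S1 (?a n) (S2 t \<xi>)" for n
        using bounded_linear.linear[OF semigroupD(1)[OF S1 pos(1)[of n]]] by (simp add: linear_diff)
      ultimately show ?thesis using tendsto_add by fastforce
    qed
    ultimately show "(\<lambda>n. \<kappa> n ((s, t), \<xi>) (0, \<eta>)) \<longlonglongrightarrow> cinner (S1 s (S2 t \<xi>)) \<eta>"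
      using tendsto_cinner_left[OF tendsto_scaleR[OF tendsto_mult[OF ck_lim[OF s] ck_lim[OF t]]], of _ "S1 s (S2 t \<xi>)" \<eta>]
      by simp
  qed
  ultimately show ?thesis by blast
qed

section \<open>Commuting dilations of at most two semigroups\<close>

lemma trivial_semigroup: "contractive_C0_semigroup (restrict (\<lambda>_. id :: 'h \<Rightarrow> 'h::complex_hilbert) {0..})"
proof -
  have "onorm (\<lambda>x::'h. x) \<le> 1" by (rule onorm_bound) auto
  then show ?thesis
    by (auto simp: contractive_C0_semigroup_def id_def bounded_linear_ident cong: continuous_on_cong_simp)
qed

lemma word_op_simps [simp]: "word_op T [] = id" "word_op T ((i, t) # w) = T i t \<circ> word_op T w"
  by (simp_all add: word_op_def)

definition total_time :: "nat \<Rightarrow> (nat \<times> real) list \<Rightarrow> real" where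
  "total_time i w = (\<Sum>(j, t)\<leftarrow>w. if j = i then t else 0)"

lemma total_time_simps [simp]:
  "total_time i [] = 0" "total_time i ((j, t) # w) = (if j = i then t else 0) + total_time i w"
  by (simp_all add: total_time_def)

text \<open>
  A missing semigroup is replaced by the trivial one, so that all \<open>d \<le> 2\<close> are covered by the two-parameter kernel.
\<close>

theorem commuting_dilation_exists:
  fixes T :: "'h::complex_hilbert tuple"
  assumes T: "T \<in> commuting_tuples d" and d: "d \<le> 2"
  shows "\<exists>(H :: ((real \<times> real) \<times> 'h \<Rightarrow> complex) cspace) r U.
    free_unitary_dilation d T H r U \<and> commuting_representations d H U"
proof -
  define S where "S = (\<lambda>i. if i \<in> {1..d} then T i else restrict (\<lambda>_. id) {0..})"
  have S: "contractive_C0_semigroup (S i)" for i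
    using T trivial_semigroup[where 'h = 'h] by (simp add: S_def commuting_tuples_def)
  have S_comm: "S i s \<circ> S j t = S j t \<circ> S i s" if "s \<ge> 0" "t \<ge> 0" for i j s t
    using T that by (auto simp: S_def commuting_tuples_def)
  obtain K :: "(real \<times> real) \<times> 'h \<Rightarrow> (real \<times> real) \<times> 'h \<Rightarrow> complex" where
    K: "translation_kernel K" and KS: "\<And>s t \<xi> \<eta>. s \<ge> 0 \<Longrightarrow> t \<ge> 0 \<Longrightarrow> K ((s, t), \<xi>) (0, \<eta>) = cinner (S 1 s (S 2 t \<xi>)) \<eta>"
    using two_parameter_kernel[OF S[of 1] S[of 2] S_comm] by blast
  interpret translation_kernel K by (rule K)
  define e where "e = (\<lambda>i::nat. if i = 1 then (1::real, 0::real) else (0, 1))"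
  have S0: "S i 0 = id" for i using semigroupD(4)[OF S order_refl] .
  have K_axis: "K (t *\<^sub>R e i, \<xi>) (0, \<eta>) = cinner (S (if i = 1 then 1 else 2) t \<xi>) \<eta>" if "t \<ge> 0" for t i \<xi> \<eta>
    using KS[of t 0 \<xi> \<eta>] KS[of 0 t \<xi> \<eta>] that by (simp add: e_def S0)
  have K_neg: "K (- p, \<xi>) (0, \<xi>) = cnj (K (p, \<xi>) (0, \<xi>))" for p \<xi>
  proof -
    have "K (- p, \<xi>) (0, \<xi>) = K (0, \<xi>) (p, \<xi>)" using translate[of "- p" p \<xi> 0 \<xi>] by simp
    also have "\<dots> = cnj (K (p, \<xi>) (0, \<xi>))" using psd unfolding psd_kernel_def by blast
    finally show ?thesis .
  qed
  have rep: "unitary_representation rkhs (\<lambda>t. U (t *\<^sub>R e i))" for i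
  proof (rule unitary_representation_U)
    fix \<xi>
    let ?S = "S (if i = 1 then 1 else 2)"
    have "K (t *\<^sub>R e i, \<xi>) (0, \<xi>) = cnj (cinner (?S \<bar>t\<bar> \<xi>) \<xi>)" if "t < 0" for t
      using K_neg[of "(- t) *\<^sub>R e i" \<xi>] K_axis[of "- t" i \<xi> \<xi>] that by simp
    then have eq: "Re (K (t *\<^sub>R e i, \<xi>) (0, \<xi>)) = Re (cinner (?S \<bar>t\<bar> \<xi>) \<xi>)" for t
      using K_axis[of t i \<xi> \<xi>] by (cases "t < 0") auto
    have "continuous_on UNIV (\<lambda>t. ?S \<bar>t\<bar> \<xi>)"
      by (rule continuous_on_compose2[OF semigroupD(6)[OF S order_refl]]) (auto intro!: continuous_intros)
    then have "((\<lambda>t. ?S \<bar>t\<bar> \<xi>) \<longlongrightarrow> ?S \<bar>0\<bar> \<xi>) (at 0)"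
      unfolding continuous_on_def by (metis UNIV_I)
    then have "((\<lambda>t. Re (cinner (?S \<bar>t\<bar> \<xi>) \<xi>)) \<longlongrightarrow> Re (cinner (?S \<bar>0\<bar> \<xi>) \<xi>)) (at 0)"
      by (intro tendsto_Re tendsto_cinner_left)
    then show "((\<lambda>t. Re (K (t *\<^sub>R e i, \<xi>) (0, \<xi>))) \<longlongrightarrow> (norm \<xi>)\<^sup>2) (at 0)"
      unfolding eq by (simp add: S0 cinner_self)
  qed
  obtain r' where r': "is_adjoint rkhs embed r'"
    using isometry_has_adjoint[OF hilbert_space_rkhs isometry_embed] by blast
  have embed_in: "embed \<xi> \<in> carrier rkhs" for \<xi>
    using isometry_embed by (simp only: isometry_into_def)
  let ?U = "\<lambda>i t. U (t *\<^sub>R e i)"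
  have words: "total_time 1 w \<ge> 0 \<and> total_time 2 w \<ge> 0 \<and>
      word_op T w \<xi> = S 1 (total_time 1 w) (S 2 (total_time 2 w) \<xi>) \<and>
      word_op ?U w \<phi> = U (total_time 1 w, total_time 2 w) \<phi>"
    if "set w \<subseteq> {1..d} \<times> {0..}" for w \<xi> \<phi>
    using that
  proof (induction w)
    case Nil
    then show ?case by (simp add: S0 zero_prod_def[symmetric])
  next
    case (Cons x w)
    obtain i t where x: "x = (i, t)" by (cases x)
    have i: "i = 1 \<or> i = 2" "i \<in> {1..d}" and t: "t \<ge> 0" using Cons.prems d by (auto simp: x)
    have IH: "total_time 1 w \<ge> 0" "total_time 2 w \<ge> 0"
      "word_op T w \<xi> = S 1 (total_time 1 w) (S 2 (total_time 2 w) \<xi>)"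
      "word_op ?U w \<phi> = U (total_time 1 w, total_time 2 w) \<phi>" using Cons by auto
    have TS: "T i = S i" using i by (simp add: S_def)
    show ?case
    proof (cases "i = 1")
      case True
      then show ?thesis
        using IH t semigroupD(5)[OF S[of 1] IH(1) t] TS
        by (simp add: x e_def U_add[symmetric])
    next
      case False
      then have i2: "i = 2" using i by simp
      have "S 2 t (S 1 (total_time 1 w) y) = S 1 (total_time 1 w) (S 2 t y)" for y
        using fun_cong[OF S_comm[OF t IH(1), of 2 1]] by simp
      then show ?thesis
        using IH t semigroupD(5)[OF S[of 2] IH(2) t] TS i2
        by (simp add: x e_def U_add[symmetric])
    qed
  qed
  have "word_op T w = r' \<circ> word_op ?U w \<circ> embed" if w: "set w \<subseteq> {1..d} \<times> {0..}" for w
  proof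
    fix \<xi>
    show "word_op T w \<xi> = (r' \<circ> word_op ?U w \<circ> embed) \<xi>"
    proof (rule cinner_ext)
      fix \<eta>
      let ?p = "(total_time 1 w, total_time 2 w)"
      have "cinner ((r' \<circ> word_op ?U w \<circ> embed) \<xi>) \<eta> = cip rkhs (U ?p (embed \<xi>)) (embed \<eta>)"
        using r' words[OF w, of \<xi> "embed \<xi>"] U_in[OF embed_in, of ?p \<xi>] by (simp add: is_adjoint_def del: rkhs_simps)
      also have "\<dots> = cinner (word_op T w \<xi>) \<eta>"
        unfolding ip_U_embed using words[OF w, of \<xi>] by (simp add: KS)
      finally show "cinner (word_op T w \<xi>) \<eta> = cinner ((r' \<circ> word_op ?U w \<circ> embed) \<xi>) \<eta>" by simp
    qed
  qed
  then have "free_unitary_dilation d T rkhs embed ?U"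
    unfolding free_unitary_dilation_def
    using hilbert_space_rkhs isometry_embed rep r' by blast
  moreover have "commuting_representations d rkhs ?U"
    by (simp add: commuting_representations_def U_add[symmetric] add.commute)
  ultimately show ?thesis by blast
qed

corollary strictly_noncommuting_tuples_le_2:
  assumes "d \<le> 2"
  shows "strictly_noncommuting_tuples d = ({} :: 'h::complex_hilbert tuple set)"
proof -
  have "T \<notin> strictly_noncommuting_tuples d" for T :: "'h tuple"
  proof
    assume T: "T \<in> strictly_noncommuting_tuples d"
    then have "T \<in> commuting_tuples d" by (simp add: strictly_noncommuting_tuples_def)
    then show False using commuting_dilation_exists[OF _ assms] no_commuting_dilation[OF T] by blast
  qed
  then show ?thesis by blast
qed

section \<open>An obstruction to commuting dilations\<close>

context hilbert_space_on
begin

text \<open>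
  Identities between vectors of the dilation space are reduced to identities between complex numbers.
\<close>

lemma cip_ext:
  assumes "x \<in> carrier H" "y \<in> carrier H" "\<And>z. z \<in> carrier H \<Longrightarrow> cip H x z = cip H y z"
  shows "x = y"
proof -
  have "cip H (x \<ominus> y) (x \<ominus> y) = 0" using assms by (simp add: cip_diff_left)
  then show ?thesis using cip_eq_zero[of "x \<ominus> y"] assms diff_eq_zero by simp
qed

lemma cspace_norm_minus: "\<lbrakk>x \<in> carrier H; y \<in> carrier H\<rbrakk> \<Longrightarrow> cspace_norm H (x \<ominus> y) \<le> cspace_norm H x + cspace_norm H y"
  using cspace_norm_triangle[of x "\<ominus> y"] by (simp add: a_minus_def cspace_norm_def cip_minus_left cip_minus_right)

lemma cspace_norm_smult: "x \<in> carrier H \<Longrightarrow> cspace_norm H (c \<odot> x) = cmod c * cspace_norm H x"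
proof -
  assume x: "x \<in> carrier H"
  have "cip H (c \<odot> x) (c \<odot> x) = of_real ((cmod c)\<^sup>2) * cip H x x"
    using x complex_norm_square[of c] by (simp add: cip_smult_left cip_smult_right)
  then have "Re (cip H (c \<odot> x) (c \<odot> x)) = (cmod c)\<^sup>2 * Re (cip H x x)" by simp
  then show ?thesis by (simp add: cspace_norm_def real_sqrt_mult)
qed

definition endo :: "('k \<Rightarrow> 'k) \<Rightarrow> bool" where
  "endo A \<longleftrightarrow> (\<forall>x\<in>carrier H. A x \<in> carrier H) \<and>
     (\<forall>x\<in>carrier H. \<forall>y\<in>carrier H. A (x \<oplus> y) = A x \<oplus> A y) \<and>
     (\<forall>c. \<forall>x\<in>carrier H. A (c \<odot> x) = c \<odot> A x)"

lemma endoD: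
  assumes "endo A" "x \<in> carrier H" "y \<in> carrier H"
  shows "A x \<in> carrier H" "A (x \<oplus> y) = A x \<oplus> A y" "A (c \<odot> x) = c \<odot> A x" "A (x \<ominus> y) = A x \<ominus> A y"
proof -
  show 1: "A x \<in> carrier H" "A (x \<oplus> y) = A x \<oplus> A y" "A (c \<odot> x) = c \<odot> A x"
    using assms by (auto simp: endo_def)
  have "A (x \<oplus> (-1) \<odot> y) = A x \<oplus> (-1) \<odot> A y" using assms by (auto simp: endo_def)
  then show "A (x \<ominus> y) = A x \<ominus> A y"
    using assms by (simp add: a_minus_def minus_as_smult endo_def)
qed

lemma endo_zero: "endo A \<Longrightarrow> A \<zero> = \<zero>"
  using endoD(4)[of A \<zero> \<zero>] diff_eq_zero[of \<zero> \<zero>] diff_eq_zero[of "A \<zero>" "A \<zero>"] endoD(1)[of A \<zero> \<zero>] by simp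

text \<open>
  Parrott's argument with error terms. If the \<open>G i\<close> acted exactly as Parrott's operators, then
  \<open>G 2 (G 3 e1) = G 2 (G 1 e2) = G 1 (G 2 e2) = - G 1 (G 1 e2)\<close>, while
  \<open>G 3 (G 2 e1) = G 3 (G 1 e1) = G 1 (G 3 e1) = G 1 (G 1 e2)\<close>, so that commutativity forces \<open>G 1 (G 1 e2) = 0\<close>.
\<close>

lemma almost_parrott:
  assumes G: "\<And>i. i \<in> {1, 2, 3::nat} \<Longrightarrow> endo (G i)"
    and bounds: "\<And>i x. i \<in> {1, 2, 3} \<Longrightarrow> x \<in> carrier H \<Longrightarrow> cspace_norm H (G i x) \<le> M * cspace_norm H x"
      "\<And>x. x \<in> carrier H \<Longrightarrow> m * cspace_norm H x \<le> cspace_norm H (G 1 x)"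
    and comm: "\<And>i j x. i \<in> {1, 2, 3} \<Longrightarrow> j \<in> {1, 2, 3} \<Longrightarrow> x \<in> carrier H \<Longrightarrow> G i (G j x) = G j (G i x)"
    and in_H: "e1 \<in> carrier H" "e2 \<in> carrier H" "f1 \<in> carrier H" "f2 \<in> carrier H"
    and "cspace_norm H (G 1 e1 \<ominus> f1) \<le> \<theta>" "cspace_norm H (G 1 e2 \<ominus> f2) \<le> \<theta>"
      "cspace_norm H (G 2 e1 \<ominus> f1) \<le> \<theta>" "cspace_norm H (G 2 e2 \<oplus> f2) \<le> \<theta>"
      "cspace_norm H (G 3 e1 \<ominus> f2) \<le> \<theta>"
    and "0 \<le> M" "0 \<le> m"
  shows "2 * m\<^sup>2 * cspace_norm H e2 \<le> 8 * M * \<theta>"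
proof -
  let ?n = "cspace_norm H"
  note GD = endoD[OF G]
  have Gin [simp]: "G i x \<in> carrier H" if "i \<in> {1, 2, 3}" "x \<in> carrier H" for i x using GD(1)[OF that that(2)] .
  have near: "?n (x \<ominus> y) \<le> 2 * \<theta>"
    if "?n (x \<ominus> z) \<le> \<theta>" "?n (y \<ominus> z) \<le> \<theta>" "x \<in> carrier H" "y \<in> carrier H" "z \<in> carrier H" for x y z
  proof -
    have "x \<ominus> y = (x \<ominus> z) \<ominus> (y \<ominus> z)"
      by (rule cip_ext) (use that in \<open>auto simp: cip_diff_left\<close>)
    then show ?thesis using cspace_norm_minus[of "x \<ominus> z" "y \<ominus> z"] that by simp
  qed
  have "G 2 e2 \<oplus> G 1 e2 = (G 2 e2 \<oplus> f2) \<oplus> (G 1 e2 \<ominus> f2)"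
    by (rule cip_ext) (use in_H in \<open>auto simp: cip_diff_left cip_add_left\<close>)
  then have s: "?n (G 2 e2 \<oplus> G 1 e2) \<le> 2 * \<theta>"
    using cspace_norm_triangle[of "G 2 e2 \<oplus> f2" "G 1 e2 \<ominus> f2"] assms by simp
  define a b where "a = G 2 (G 3 e1 \<ominus> G 1 e2) \<oplus> G 1 (G 2 e2 \<oplus> G 1 e2)"
    and "b = G 3 (G 2 e1 \<ominus> G 1 e1) \<oplus> G 1 (G 3 e1 \<ominus> G 1 e2)"
  have n2: "?n (G i x) \<le> M * (2 * \<theta>)" if "i \<in> {1, 2, 3}" "x \<in> carrier H" "?n x \<le> 2 * \<theta>" for i x
    using bounds(1)[OF that(1,2)] mult_left_mono[OF that(3) \<open>0 \<le> M\<close>] by linarith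
  have ab_in: "a \<in> carrier H" "b \<in> carrier H" unfolding a_def b_def using in_H by simp_all
  have "?n a \<le> M * (2 * \<theta>) + M * (2 * \<theta>)"
    unfolding a_def
    by (rule order_trans[OF cspace_norm_triangle add_mono[OF n2 n2]]) (use in_H s near assms in simp_all)
  moreover have "?n b \<le> M * (2 * \<theta>) + M * (2 * \<theta>)"
    unfolding b_def
    by (rule order_trans[OF cspace_norm_triangle add_mono[OF n2 n2]]) (use in_H near assms in simp_all)
  ultimately have ab: "?n (a \<ominus> b) \<le> 8 * M * \<theta>"
    using cspace_norm_minus[OF ab_in] by (simp add: algebra_simps)
  \<comment> \<open>Commutativity cancels all terms except the two copies of \<open>G 1 (G 1 e2)\<close>.\<close>
  have "a \<ominus> b = 2 \<odot> G 1 (G 1 e2)"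
  proof (rule cip_ext)
    fix z assume "z \<in> carrier H"
    then show "cip H (a \<ominus> b) z = cip H (2 \<odot> G 1 (G 1 e2)) z"
      using in_H comm[of 2 3 e1] comm[of 2 1 e2] comm[of 3 1 e1]
      by (simp add: a_def b_def GD(2,4) cip_add_left cip_diff_left cip_smult_left)
  qed (use in_H ab_in in simp_all)
  then have "?n (a \<ominus> b) = 2 * ?n (G 1 (G 1 e2))" using in_H by (simp add: cspace_norm_smult)
  moreover have "m * (m * ?n e2) \<le> ?n (G 1 (G 1 e2))"
    using bounds(2)[of "G 1 e2"] mult_left_mono[OF bounds(2)[of e2] \<open>0 \<le> m\<close>] in_H by simp
  ultimately show ?thesis using ab by (simp add: power2_eq_square algebra_simps)
qed

text \<open>
  The partial sum of \<open>(1 - c U(\<tau>))\<inverse>\<close>, and with it that of the Blaschke factor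
  \<open>(z - c) / (1 - c z)\<close> of \<open>z = U(\<tau>)\<close>.
\<close>

primrec geo :: "real \<Rightarrow> (real \<Rightarrow> 'k \<Rightarrow> 'k) \<Rightarrow> real \<Rightarrow> nat \<Rightarrow> 'k \<Rightarrow> 'k" where
  "geo c U \<tau> 0 x = \<zero>"
| "geo c U \<tau> (Suc k) x = geo c U \<tau> k x \<oplus> of_real (c ^ k) \<odot> U (real k * \<tau>) x"

definition mobius :: "real \<Rightarrow> (real \<Rightarrow> 'k \<Rightarrow> 'k) \<Rightarrow> real \<Rightarrow> nat \<Rightarrow> 'k \<Rightarrow> 'k" where
  "mobius c U \<tau> n x = U \<tau> (geo c U \<tau> n x) \<ominus> of_real c \<odot> geo c U \<tau> n x"

lemma unitary_endo:
  assumes U: "unitary_representation H U" shows "endo (U t)"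
proof -
  have "bij_betw (U t) (carrier H) (carrier H)" using U by (simp add: unitary_representation_def)
  from bij_betwE[OF this] U show ?thesis by (simp add: unitary_representation_def endo_def)
qed

context
  fixes U :: "real \<Rightarrow> 'k \<Rightarrow> 'k" and c \<tau> :: real
  assumes U: "unitary_representation H U"
begin

lemma U_in [simp]: "x \<in> carrier H \<Longrightarrow> U t x \<in> carrier H"
  using unitary_endo[OF U] by (simp add: endo_def)

lemma U_lin:
  "\<lbrakk>x \<in> carrier H; y \<in> carrier H\<rbrakk> \<Longrightarrow> U t (x \<oplus> y) = U t x \<oplus> U t y"
  "x \<in> carrier H \<Longrightarrow> U t (d \<odot> x) = d \<odot> U t x"
  using unitary_endo[OF U] by (auto simp: endo_def)

lemma U_isometric: "x \<in> carrier H \<Longrightarrow> y \<in> carrier H \<Longrightarrow> cip H (U t x) (U t y) = cip H x y"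
  and U_plus: "x \<in> carrier H \<Longrightarrow> U (s + t) x = U s (U t x)"
  and U_zero: "x \<in> carrier H \<Longrightarrow> U 0 x = x"
  using U by (auto simp: unitary_representation_def)

lemma U_zero_vec: "U t \<zero> = \<zero>"
  by (rule endo_zero[OF unitary_endo[OF U]])

lemma geo_in [simp]: "x \<in> carrier H \<Longrightarrow> geo c U \<tau> n x \<in> carrier H"
  by (induction n) auto

lemma mobius_in [simp]: "x \<in> carrier H \<Longrightarrow> mobius c U \<tau> n x \<in> carrier H"
  by (simp add: mobius_def)

lemma geo_telescope:
  assumes x: "x \<in> carrier H"
  shows "geo c U \<tau> n x \<ominus> of_real c \<odot> U \<tau> (geo c U \<tau> n x) = x \<ominus> of_real (c ^ n) \<odot> U (real n * \<tau>) x"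
proof (rule cip_ext)
  fix z assume z: "z \<in> carrier H"
  have "cip H (geo c U \<tau> n x) z - of_real c * cip H (U \<tau> (geo c U \<tau> n x)) z = cip H x z - of_real (c ^ n) * cip H (U (real n * \<tau>) x) z"
  proof (induction n)
    case 0
    then show ?case using x z by (simp add: U_zero_vec U_zero)
  next
    case (Suc n)
    have "U \<tau> (U (real n * \<tau>) x) = U (real (Suc n) * \<tau>) x"
      using U_plus[OF x, of \<tau> "real n * \<tau>"] by (simp add: algebra_simps)
    then show ?case
      using Suc x z by (simp add: U_lin cip_add_left cip_smult_left algebra_simps del: of_nat_Suc)
  qed
  then show "cip H (geo c U \<tau> n x \<ominus> of_real c \<odot> U \<tau> (geo c U \<tau> n x)) z = cip H (x \<ominus> of_real (c ^ n) \<odot> U (real n * \<tau>) x) z"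
    using x z by (simp add: cip_diff_left cip_smult_left)
qed (use x in simp_all)

text \<open>
  For a unitary \<open>U\<close> and real \<open>c\<close> the vectors \<open>U g - c g\<close> and \<open>g - c U g\<close> have the same norm; for the geometric
  sum \<open>g\<close> the second one telescopes. Hence the truncated Blaschke factor is almost isometric.
\<close>

lemma norm_mobius:
  assumes x: "x \<in> carrier H"
  shows "cspace_norm H (mobius c U \<tau> n x) = cspace_norm H (x \<ominus> of_real (c ^ n) \<odot> U (real n * \<tau>) x)"
proof -
  have g: "geo c U \<tau> n x \<in> carrier H" using x by simp
  have "Re (cip H (mobius c U \<tau> n x) (mobius c U \<tau> n x)) =
      Re (cip H (geo c U \<tau> n x \<ominus> of_real c \<odot> U \<tau> (geo c U \<tau> n x)) (geo c U \<tau> n x \<ominus> of_real c \<odot> U \<tau> (geo c U \<tau> n x)))"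
    unfolding mobius_def using g
    by (simp add: cip_diff_left cip_diff_right cip_smult_left cip_smult_right U_isometric algebra_simps)
  then show ?thesis unfolding geo_telescope[OF x] by (simp add: cspace_norm_def)
qed

lemma norm_U: "x \<in> carrier H \<Longrightarrow> cspace_norm H (U t x) = cspace_norm H x"
  by (simp add: cspace_norm_def U_isometric)

lemma mobius_bounds:
  assumes x: "x \<in> carrier H" and c: "0 \<le> c"
  shows "cspace_norm H (mobius c U \<tau> n x) \<le> (1 + c ^ n) * cspace_norm H x"
    "(1 - c ^ n) * cspace_norm H x \<le> cspace_norm H (mobius c U \<tau> n x)"
proof -
  let ?y = "of_real (c ^ n) \<odot> U (real n * \<tau>) x"
  have y: "cspace_norm H ?y = c ^ n * cspace_norm H x"
    using x c by (simp add: cspace_norm_smult norm_U norm_power)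
  have y_in: "?y \<in> carrier H" using x by simp
  show "cspace_norm H (mobius c U \<tau> n x) \<le> (1 + c ^ n) * cspace_norm H x"
    unfolding norm_mobius[OF x] using cspace_norm_minus[OF x y_in] unfolding y by (simp add: algebra_simps)
  have "x = (x \<ominus> ?y) \<oplus> ?y" by (rule cip_ext) (use x y_in in \<open>auto simp: cip_add_left cip_diff_left\<close>)
  then have "cspace_norm H x \<le> cspace_norm H (x \<ominus> ?y) + cspace_norm H ?y"
    using cspace_norm_triangle[of "x \<ominus> ?y" ?y] x y_in by simp
  then show "(1 - c ^ n) * cspace_norm H x \<le> cspace_norm H (mobius c U \<tau> n x)"
    unfolding norm_mobius[OF x] y by (simp add: algebra_simps)
qed

lemma cip_mobius:
  assumes x: "x \<in> carrier H" and z: "z \<in> carrier H"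
  shows "cip H (mobius c U \<tau> n x) z =
    (\<Sum>k<n. of_real (c ^ k) * (cip H (U (real (Suc k) * \<tau>) x) z - of_real c * cip H (U (real k * \<tau>) x) z))"
proof -
  have "cip H (U \<tau> (geo c U \<tau> n x)) z - of_real c * cip H (geo c U \<tau> n x) z =
    (\<Sum>k<n. of_real (c ^ k) * (cip H (U (real (Suc k) * \<tau>) x) z - of_real c * cip H (U (real k * \<tau>) x) z))"
  proof (induction n)
    case 0
    then show ?case using x z by (simp add: U_zero_vec)
  next
    case (Suc n)
    have "U \<tau> (U (real n * \<tau>) x) = U (real (Suc n) * \<tau>) x"
      using U_plus[OF x, of \<tau> "real n * \<tau>"] by (simp add: algebra_simps)
    then show ?case
      using Suc[symmetric] x z by (simp add: U_lin cip_add_left cip_smult_left algebra_simps del: of_nat_Suc)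
  qed
  then show ?thesis using x z by (simp add: mobius_def cip_diff_left cip_smult_left)
qed

lemma endo_mobius: "endo (mobius c U \<tau> n)"
  unfolding endo_def
proof (intro conjI ballI allI)
  fix x y d assume x: "x \<in> carrier H" and y: "y \<in> carrier H"
  show "mobius c U \<tau> n (x \<oplus> y) = mobius c U \<tau> n x \<oplus> mobius c U \<tau> n y"
    by (rule cip_ext) (use x y in \<open>auto simp: cip_mobius cip_add_left U_lin sum.distrib[symmetric] algebra_simps intro!: sum.cong\<close>)
next
  fix x d assume x: "x \<in> carrier H"
  show "mobius c U \<tau> n (d \<odot> x) = d \<odot> mobius c U \<tau> n x"
    by (rule cip_ext) (use x in \<open>auto simp: cip_mobius cip_smult_left U_lin sum_distrib_left algebra_simps intro!: sum.cong\<close>)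
qed simp

lemma endo_commute_mobius:
  assumes A: "endo A" and comm: "\<And>t x. x \<in> carrier H \<Longrightarrow> A (U t x) = U t (A x)" and x: "x \<in> carrier H"
  shows "A (mobius c U \<tau> n x) = mobius c U \<tau> n (A x)"
proof -
  have "A \<zero> = \<zero>" by (rule endo_zero[OF A])
  then have "A (geo c U \<tau> n x) = geo c U \<tau> n (A x)"
    by (induction n) (use x A in \<open>auto simp: endo_def comm\<close>)
  then show ?thesis using x A by (simp add: mobius_def endoD(4)[OF A] comm) (simp add: endo_def)
qed

end

end

text \<open>
  With \<open>\<tau>\<close> the sampling step, the example satisfies \<open>T(\<tau>) = c (1 + \<tau> N)\<close> for \<open>c = e\<^bsup>-\<tau>/2\<^esup>\<close>, which is the
  zero chosen for the Blaschke factor. A small \<open>\<tau>\<close> makes the coefficient of \<open>N\<close> close to 1, a large number of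
  samples makes \<open>c\<^sup>n\<close> small.
\<close>

definition sample_step :: real where "sample_step = 1 / 100"
definition damping :: real where "damping = exp (- 1 / 200)"
definition sample_count :: nat where "sample_count = 2000"

text \<open>
  The matrix coefficient of the truncated Blaschke factor, in terms of the semigroup itself; it is
  unchanged by passing to a dilation.
\<close>

definition mobius_coeff :: "'h::complex_hilbert tuple \<Rightarrow> nat \<Rightarrow> 'h \<Rightarrow> 'h \<Rightarrow> complex" where
  "mobius_coeff T i \<xi> \<eta> = (\<Sum>k<sample_count. of_real (damping ^ k) *
     (cinner (T i (real (Suc k) * sample_step) \<xi>) \<eta> - of_real damping * cinner (T i (real k * sample_step) \<xi>) \<eta>))"

lemma damping_power: "damping ^ sample_count \<le> 1 / 100"
proof -
  have "damping ^ sample_count = exp (- 10)"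
    unfolding damping_def sample_count_def by (subst exp_of_nat_mult[symmetric]) simp
  also have "\<dots> = inverse (exp 1 ^ 10)" by (subst exp_of_nat_mult[symmetric]) (simp add: exp_minus)
  also have "\<dots> \<le> inverse (2 ^ 10)"
    using exp_ge_add_one_self[of 1] by (intro le_imp_inverse_le power_mono) auto
  also have "\<dots> \<le> 1 / 100" by simp
  finally show ?thesis .
qed

text \<open>
  The truncated Blaschke factors almost act as Parrott's operators: \<open>N\<^sub>1\<close> maps \<open>e1, e2\<close> to \<open>f1, f2\<close>, \<open>N\<^sub>2\<close> maps
  them to \<open>f1, - f2\<close>, and \<open>N\<^sub>3\<close> maps \<open>e1\<close> to \<open>f2\<close>.
\<close>

definition parrott_like :: "'h::complex_hilbert tuple \<Rightarrow> 'h \<Rightarrow> 'h \<Rightarrow> 'h \<Rightarrow> 'h \<Rightarrow> bool" where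
  "parrott_like T e1 e2 f1 f2 \<longleftrightarrow>
     Re (mobius_coeff T 1 e1 f1) > 99/100 \<and> Re (mobius_coeff T 1 e2 f2) > 99/100 \<and>
     Re (mobius_coeff T 2 e1 f1) > 99/100 \<and> Re (mobius_coeff T 2 e2 (- f2)) > 99/100 \<and>
     Re (mobius_coeff T 3 e1 f2) > 99/100"

text \<open>
  In a dilation, \<open>\<parallel>G \<xi> - \<eta>\<parallel>\<^sup>2 = \<parallel>G \<xi>\<parallel>\<^sup>2 + 1 - 2 Re \<langle>G \<xi>, \<eta>\<rangle>\<close> for unit vectors, where \<open>\<parallel>G \<xi>\<parallel> \<le> 1.01\<close>. A coefficient
  larger than 0.99 therefore bounds the error by 0.21, and \<open>2 \<cdot> 0.99\<^sup>2 > 8 \<cdot> 1.01 \<cdot> 0.21\<close> contradicts the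
  estimate of Parrott's argument.
\<close>

theorem parrott_like_not_dilatable:
  fixes T :: "'h::complex_hilbert tuple"
  assumes d: "d \<ge> 3" and unit: "norm e1 = 1" "norm e2 = 1" "norm f1 = 1" "norm f2 = 1"
    and P: "parrott_like T e1 e2 f1 f2"
    and dil: "free_unitary_dilation d T H r U"
  shows "\<not> commuting_representations d H U"
proof
  assume comm: "commuting_representations d H U"
  interpret hilbert_space_on H using dil by (simp add: free_unitary_dilation_def)
  have r: "isometry_into H r" and U: "\<And>i. i \<in> {1..d} \<Longrightarrow> unitary_representation H (U i)"
    using dil by (auto simp: free_unitary_dilation_def)
  obtain r' where r': "is_adjoint H r r'"
    and T: "\<And>w. set w \<subseteq> {1..d} \<times> {0..} \<Longrightarrow> word_op T w = r' \<circ> word_op U w \<circ> r"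
    using dil by (auto simp: free_unitary_dilation_def)
  have r_in [simp]: "r \<xi> \<in> carrier H" and r_norm: "cspace_norm H (r \<xi>) = norm \<xi>" for \<xi>
    using r by (auto simp: isometry_into_def)
  let ?c = damping and ?\<tau> = sample_step and ?n = sample_count
  have idx: "i \<in> {1..d}" if "i \<in> {1, 2, 3}" for i using that d by auto
  define G where "G = (\<lambda>i. mobius ?c (U i) ?\<tau> ?n)"
  have TU: "cinner (T i t \<xi>) \<eta> = cip H (U i t (r \<xi>)) (r \<eta>)" if "i \<in> {1, 2, 3}" "t \<ge> 0" for i t \<xi> \<eta>
  proof -
    have "T i t \<xi> = r' (U i t (r \<xi>))"
      using fun_cong[OF T[of "[(i, t)]"], of \<xi>] idx[OF that(1)] that(2) by (simp add: word_op_def)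
    then show ?thesis using r' U_in[OF U[OF idx[OF that(1)]] r_in] by (simp add: is_adjoint_def)
  qed
  have coeff: "cip H (G i (r \<xi>)) (r \<eta>) = mobius_coeff T i \<xi> \<eta>" if "i \<in> {1, 2, 3}" for i \<xi> \<eta>
  proof -
    have "0 \<le> real (Suc k) * sample_step" "0 \<le> real k * sample_step" for k by (simp_all add: sample_step_def)
    then show ?thesis unfolding G_def cip_mobius[OF U[OF idx[OF that]] r_in r_in] mobius_coeff_def
      by (simp only: TU[OF that])
  qed
  have c0: "0 \<le> ?c" by (simp add: damping_def)
  have upper: "cspace_norm H (G i x) \<le> 101/100 * cspace_norm H x" if "i \<in> {1, 2, 3}" "x \<in> carrier H" for i x
  proof -
    have "(1 + ?c ^ ?n) * cspace_norm H x \<le> 101/100 * cspace_norm H x"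
      using damping_power that by (intro mult_right_mono) auto
    then show ?thesis using mobius_bounds(1)[OF U[OF idx[OF that(1)]] that(2) c0, where n = ?n and \<tau> = ?\<tau>] unfolding G_def by linarith
  qed
  have lower: "99/100 * cspace_norm H x \<le> cspace_norm H (G 1 x)" if "x \<in> carrier H" for x
  proof -
    have "99/100 * cspace_norm H x \<le> (1 - ?c ^ ?n) * cspace_norm H x"
      using damping_power that by (intro mult_right_mono) auto
    then show ?thesis using mobius_bounds(2)[OF U[OF idx[of 1]] that c0, where n = ?n and \<tau> = ?\<tau>] unfolding G_def by simp
  qed
  have close: "cspace_norm H (G i (r \<xi>) \<ominus>\<^bsub>H\<^esub> r \<eta>) \<le> 21/100"
    if i: "i \<in> {1, 2, 3}" and n: "norm \<xi> = 1" "norm \<eta> = 1" and big: "Re (mobius_coeff T i \<xi> \<eta>) > 99/100" for i \<xi> \<eta>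
  proof (rule power2_le_imp_le)
    have Gx: "G i (r \<xi>) \<in> carrier H" unfolding G_def by (rule mobius_in[OF U[OF idx[OF i]] r_in])
    have "cip H (r \<eta>) (G i (r \<xi>)) = cnj (cip H (G i (r \<xi>)) (r \<eta>))" by (rule cip_commute) (use Gx in auto)
    then have "(cspace_norm H (G i (r \<xi>) \<ominus>\<^bsub>H\<^esub> r \<eta>))\<^sup>2 =
        (cspace_norm H (G i (r \<xi>)))\<^sup>2 + (cspace_norm H (r \<eta>))\<^sup>2 - 2 * Re (mobius_coeff T i \<xi> \<eta>)"
      using Gx by (simp add: cspace_norm_sq cip_diff_left cip_diff_right coeff[OF i])
    moreover have "(cspace_norm H (G i (r \<xi>)))\<^sup>2 \<le> (101/100)\<^sup>2"
      using upper[OF i r_in, of \<xi>] Gx by (intro power_mono) (simp_all add: r_norm n)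
    ultimately show "(cspace_norm H (G i (r \<xi>) \<ominus>\<^bsub>H\<^esub> r \<eta>))\<^sup>2 \<le> (21/100)\<^sup>2"
      using big by (simp add: r_norm n power2_eq_square)
  qed simp
  have endo: "endo (G i)" if "i \<in> {1, 2, 3}" for i
    unfolding G_def by (rule endo_mobius[OF U[OF idx[OF that]]])
  have "U i s (G j x) = G j (U i s x)" if "i \<in> {1, 2, 3}" "j \<in> {1, 2, 3}" "x \<in> carrier H" for i j s x
    unfolding G_def
    by (rule endo_commute_mobius[OF U[OF idx[OF that(2)]] unitary_endo[OF U[OF idx[OF that(1)]]] _ that(3)])
      (use comm idx that in \<open>auto simp: commuting_representations_def\<close>)
  then have comm_G: "G i (G j x) = G j (G i x)" if "i \<in> {1, 2, 3}" "j \<in> {1, 2, 3}" "x \<in> carrier H" for i j x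
    using endo_commute_mobius[OF U[OF idx[OF that(1)]] endo[OF that(2)] _ that(3), where n = ?n and \<tau> = ?\<tau> and c = ?c] that
    unfolding G_def by simp
  have "r (- f2) = \<ominus>\<^bsub>H\<^esub> r f2"
    using r minus_as_smult[OF r_in, of f2] scaleC_of_real[of "-1" f2] by (simp add: isometry_into_def) (metis)
  then have f2: "x \<oplus>\<^bsub>H\<^esub> r f2 = x \<ominus>\<^bsub>H\<^esub> r (- f2)" if "x \<in> carrier H" for x
    using that by (simp add: a_minus_def)
  have "2 * (99/100)\<^sup>2 * cspace_norm H (r e2) \<le> 8 * (101/100) * (21/100)"
  proof (rule almost_parrott[of G "101/100" "99/100" "r e1" "r e2" "r f1" "r f2"])
    show "cspace_norm H (G 2 (r e2) \<oplus>\<^bsub>H\<^esub> r f2) \<le> 21/100"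
      using close[of 2 e2 "- f2"] P unit f2[OF endoD(1)[OF endo r_in r_in]] by (simp add: parrott_like_def)
  qed (use endo upper lower comm_G close unit P in \<open>simp_all add: parrott_like_def\<close>)
  then show False by (simp add: r_norm unit power2_eq_square)
qed

section \<open>Isometries with prescribed deficiency\<close>

lemma vector_space_scaleC: "vector_space ((*\<^sub>C) :: complex \<Rightarrow> 'h \<Rightarrow> 'h::complex_hilbert)"
  by standard (auto simp: scaleC_add_right scaleC_add_left scaleC_scaleC)

text \<open>
  Otherwise subtracting from a vector its projection onto the span of \<open>A\<close> leaves 0, and a finite set spans.
\<close>

lemma exists_orthogonal_unit_vector:
  fixes A :: "'h::complex_hilbert set"
  assumes inf: "infinite_dimensional TYPE('h)" and A: "finite A"
  shows "\<exists>x. norm x = 1 \<and> (\<forall>a\<in>A. cinner x a = 0)"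
proof (rule ccontr)
  assume no: "\<not> ?thesis"
  interpret V: vector_space "(*\<^sub>C) :: complex \<Rightarrow> 'h \<Rightarrow> 'h" by (rule vector_space_scaleC)
  have perp_span: "cinner z y = 0" if "\<forall>a\<in>B. cinner z a = 0" "y \<in> V.span B" for z y B
    using that(2) by (induction rule: V.span_induct_alt) (use that(1) in \<open>auto simp: cinner_simps\<close>)
  have proj: "\<exists>y\<in>V.span A. \<forall>a\<in>A. cinner (x - y) a = 0" for x
    using A
  proof (induction A arbitrary: x)
    case empty
    then show ?case using V.span_zero by auto
  next
    case (insert b A)
    obtain y where y: "y \<in> V.span A" "\<forall>a\<in>A. cinner (x - y) a = 0" using insert.IH by blast
    obtain w where w: "w \<in> V.span A" "\<forall>a\<in>A. cinner (b - w) a = 0" using insert.IH by blast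
    define t where "t = cinner (x - y) (b - w) / cinner (b - w) (b - w)"
    define z where "z = x - (y + t *\<^sub>C (b - w))"
    have z_A: "\<forall>a\<in>A. cinner z a = 0" using y(2) w(2) by (simp add: z_def cinner_simps)
    have "cinner z (b - w) = 0"
    proof (cases "b - w = 0")
      case False
      then have "cinner (b - w) (b - w) \<noteq> 0" by (simp add: cinner_self)
      then have "t * cinner (b - w) (b - w) = cinner (x - y) (b - w)" by (simp add: t_def)
      then show ?thesis
        unfolding z_def cinner_diff_left[of _ "y + _"] cinner_add_left cinner_scaleC_left
        by (simp only: cinner_diff_left[of x y]) simp
    qed simp
    then have "cinner z b = 0" using perp_span[OF z_A w(1)] by (simp add: cinner_diff_right)
    moreover have "y + t *\<^sub>C (b - w) \<in> V.span (insert b A)"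
    proof -
      have "A \<subseteq> insert b A" by blast
      then have "y \<in> V.span (insert b A)" "w \<in> V.span (insert b A)" using y(1) w(1) V.span_mono by blast+
      moreover have "b \<in> V.span (insert b A)" by (rule V.span_base) simp
      ultimately show ?thesis by (intro V.span_add V.span_scale V.span_diff)
    qed
    ultimately show ?case using z_A unfolding z_def by blast
  qed
  have "x \<in> V.span A" for x
  proof -
    obtain y where y: "y \<in> V.span A" "\<forall>a\<in>A. cinner (x - y) a = 0" using proj by blast
    have "x = y"
    proof (rule ccontr)
      assume "x \<noteq> y"
      then have "norm ((1 / norm (x - y)) *\<^sub>R (x - y)) = 1 \<and> (\<forall>a\<in>A. cinner ((1 / norm (x - y)) *\<^sub>R (x - y)) a = 0)"
        using y(2) by (simp add: cinner_scaleR_left)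
      then show False using no by blast
    qed
    then show ?thesis using y by simp
  qed
  then have span: "V.span A = UNIV" by blast
  obtain B where B: "B \<subseteq> A" "V.independent B" "A \<subseteq> V.span B"
    using V.maximal_independent_subset by blast
  have "V.span B = UNIV"
    using V.span_mono[OF B(3)] span by (auto simp: V.span_span)
  then have "finite_dimensional_vector_space ((*\<^sub>C) :: complex \<Rightarrow> 'h \<Rightarrow> 'h) B"
    using B finite_subset[OF B(1) A]
    by (intro finite_dimensional_vector_space.intro finite_dimensional_vector_space_axioms.intro vector_space_scaleC) auto
  then show False using inf by (auto simp: infinite_dimensional_def)
qed

definition orthonormal :: "('i \<Rightarrow> 'h::complex_hilbert) \<Rightarrow> bool" where
  "orthonormal e \<longleftrightarrow> (\<forall>m n. cinner (e m) (e n) = (if m = n then 1 else 0))"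

lemma exists_orthonormal_sequence:
  fixes A :: "'h::complex_hilbert set"
  assumes inf: "infinite_dimensional TYPE('h)" and A: "finite A"
  shows "\<exists>e :: nat \<Rightarrow> 'h. orthonormal e \<and> (\<forall>n. \<forall>a\<in>A. cinner a (e n) = 0)"
proof -
  define next_vec where "next_vec = (\<lambda>B. SOME x :: 'h. norm x = 1 \<and> (\<forall>a\<in>B. cinner x a = 0))"
  have next_vec: "norm (next_vec B) = 1 \<and> (\<forall>a\<in>B. cinner (next_vec B) a = 0)" if "finite B" for B
    unfolding next_vec_def by (rule someI_ex[OF exists_orthogonal_unit_vector[OF inf that]])
  define C where "C = rec_nat A (\<lambda>_ B. insert (next_vec B) B)"
  define e where "e = (\<lambda>n. next_vec (C n))"
  have C: "C 0 = A" "C (Suc n) = insert (e n) (C n)" for n by (simp_all add: C_def e_def)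
  have fin: "finite (C n)" for n by (induction n) (auto simp: C A)
  have C_mono: "C m \<subseteq> C n" if "m \<le> n" for m n using that by (rule lift_Suc_mono_le[rotated]) (auto simp: C)
  have less: "cinner (e n) (e m) = 0" if "m < n" for m n
  proof -
    have "e m \<in> C n" using C_mono[of "Suc m" n] that by (auto simp: C)
    then show ?thesis using next_vec[OF fin[of n]] by (simp add: e_def)
  qed
  have "cinner (e m) (e n) = (if m = n then 1 else 0)" for m n
    using less[of m n] less[of n m] cinner_commute[of "e m" "e n"] next_vec[OF fin[of m]]
    by (cases m n rule: linorder_cases) (auto simp: cinner_self e_def)
  moreover have "cinner a (e n) = 0" if "a \<in> A" for a n
  proof -
    have "a \<in> C n" using C_mono[of 0 n] that by (auto simp: C)
    then have "cinner (e n) a = 0" using next_vec[OF fin[of n]] by (simp add: e_def)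
    then show ?thesis using cinner_commute[of a "e n"] by simp
  qed
  ultimately show ?thesis unfolding orthonormal_def by blast
qed

lemma orthonormal_sum_norm:
  assumes "orthonormal g" "finite A"
  shows "(norm (\<Sum>k\<in>A. c k *\<^sub>C g k))\<^sup>2 = (\<Sum>k\<in>A. (cmod (c k))\<^sup>2)"
proof -
  let ?S = "\<Sum>k\<in>A. c k *\<^sub>C g k"
  have "cinner (g k) ?S = cnj (c k)" if "k \<in> A" for k
  proof -
    have "cinner (g k) ?S = (\<Sum>j\<in>A. if k = j then cnj (c j) else 0)"
      unfolding cinner_sum_right cinner_scaleC_right
      by (rule sum.cong) (use assms(1) in \<open>auto simp: orthonormal_def\<close>)
    then show ?thesis using that assms(2) by simp
  qed
  then have "complex_of_real ((norm ?S)\<^sup>2) = (\<Sum>k\<in>A. c k * cnj (c k))"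
    unfolding cinner_self[symmetric] by (subst cinner_sum_left) (simp add: cinner_scaleC_left)
  also have "\<dots> = complex_of_real (\<Sum>k\<in>A. (cmod (c k))\<^sup>2)"
    by (simp only: of_real_sum complex_norm_square)
  finally show ?thesis by (simp only: of_real_eq_iff)
qed

lemma bessel:
  assumes e: "orthonormal e"
  shows "summable (\<lambda>k. (cmod (cinner x (e k)))\<^sup>2)"
proof (rule bounded_imp_summable)
  show "0 \<le> (cmod (cinner x (e k)))\<^sup>2" for k by simp
  show "(\<Sum>k\<le>n. (cmod (cinner x (e k)))\<^sup>2) \<le> (norm x)\<^sup>2" for n :: nat
  proof -
    let ?y = "\<Sum>k\<le>n. cinner x (e k) *\<^sub>C e k"
    have xy: "cinner x ?y = complex_of_real (\<Sum>k\<le>n. (cmod (cinner x (e k)))\<^sup>2)"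
      by (simp only: cinner_sum_right cinner_scaleC_right of_real_sum complex_norm_square mult.commute)
    have yy: "cinner ?y ?y = complex_of_real (\<Sum>k\<le>n. (cmod (cinner x (e k)))\<^sup>2)"
      using orthonormal_sum_norm[OF e, of "{..n}" "\<lambda>k. cinner x (e k)"] by (simp add: cinner_self)
    have "cinner (x - ?y) (x - ?y) = cinner x x - cinner x ?y - cnj (cinner x ?y) + cinner ?y ?y"
      by (simp only: cinner_diff_left cinner_diff_right cinner_commute[of ?y x]) simp
    also have "\<dots> = complex_of_real ((norm x)\<^sup>2 - (\<Sum>k\<le>n. (cmod (cinner x (e k)))\<^sup>2))"
      unfolding xy yy by (simp add: cinner_self)
    finally have "(norm (x - ?y))\<^sup>2 = (norm x)\<^sup>2 - (\<Sum>k\<le>n. (cmod (cinner x (e k)))\<^sup>2)"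
      unfolding cinner_self of_real_eq_iff .
    then show ?thesis using zero_le_power2[of "norm (x - ?y)"] by linarith
  qed
qed

lemma orthonormal_summable:
  fixes g :: "nat \<Rightarrow> 'h::complex_hilbert"
  assumes g: "orthonormal g" and c: "summable (\<lambda>k. (cmod (c k))\<^sup>2)"
  shows "summable (\<lambda>k. c k *\<^sub>C g k)"
proof -
  have "Cauchy (\<lambda>n. \<Sum>k<n. c k *\<^sub>C g k)"
  proof (rule metric_CauchyI)
    fix \<epsilon> :: real assume "\<epsilon> > 0"
    then have "\<epsilon>\<^sup>2 > 0" by simp
    with c obtain N where N: "\<And>m n. m \<ge> N \<Longrightarrow> norm (\<Sum>k=m..<n. (cmod (c k))\<^sup>2) < \<epsilon>\<^sup>2"
      unfolding summable_Cauchy by meson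
    have *: "dist (\<Sum>k<m. c k *\<^sub>C g k) (\<Sum>k<n. c k *\<^sub>C g k) < \<epsilon>" if "N \<le> m" "m \<le> n" for m n
    proof -
      have "(\<Sum>k<n. c k *\<^sub>C g k) - (\<Sum>k<m. c k *\<^sub>C g k) = (\<Sum>k=m..<n. c k *\<^sub>C g k)"
        using sum_diff_nat_ivl[of 0 m n "\<lambda>k. c k *\<^sub>C g k"] that by (simp add: atLeast0LessThan)
      then have "(dist (\<Sum>k<m. c k *\<^sub>C g k) (\<Sum>k<n. c k *\<^sub>C g k))\<^sup>2 = (\<Sum>k=m..<n. (cmod (c k))\<^sup>2)"
        by (simp add: dist_norm norm_minus_commute[of "\<Sum>k<m. c k *\<^sub>C g k"] orthonormal_sum_norm[OF g])
      also have "\<dots> < \<epsilon>\<^sup>2" using N[OF that(1), of n] by simp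
      finally show ?thesis using \<open>\<epsilon> > 0\<close> by (simp add: power_less_imp_less_base)
    qed
    then show "\<exists>M. \<forall>m\<ge>M. \<forall>n\<ge>M. dist (\<Sum>k<m. c k *\<^sub>C g k) (\<Sum>k<n. c k *\<^sub>C g k) < \<epsilon>"
      by (metis dist_commute nle_le)
  qed
  then show ?thesis by (simp add: summable_iff_convergent Cauchy_convergent)
qed

text \<open>
  The isometry shifts an orthonormal sequence orthogonal to \<open>A\<close> by \<open>m\<close> places and is the identity on the
  orthogonal complement of this sequence.
\<close>

lemma isometry_with_deficiency:
  fixes A :: "'h::complex_hilbert set"
  assumes inf: "infinite_dimensional TYPE('h)" and A: "finite A"
  shows "\<exists>(v :: 'h \<Rightarrow> 'h) v' (e :: nat \<Rightarrow> 'h). orthonormal e \<and>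
    (\<forall>x y. cinner (v x) (v y) = cinner x y) \<and> (\<forall>x y. cinner (v x) y = cinner x (v' y)) \<and>
    (\<forall>a\<in>A. v a = a) \<and> (\<forall>j<m. v' (e j) = 0)"
proof -
  obtain e :: "nat \<Rightarrow> 'h" where e: "orthonormal e" and eA: "\<And>n a. a \<in> A \<Longrightarrow> cinner a (e n) = 0"
    using exists_orthonormal_sequence[OF inf A] by blast
  \<comment> \<open>\<open>F h\<close> maps \<open>e k\<close> to \<open>h k\<close> and the orthogonal complement to 0.\<close>
  define g where "g = (\<lambda>k. e (k + m))"
  have g: "orthonormal g" using e by (simp add: orthonormal_def g_def)
  define F where "F = (\<lambda>h x. \<Sum>k. cinner x (e k) *\<^sub>C (h k :: 'h))"
  have F_left: "(\<lambda>k. cinner x (e k) * cinner (h k) y) sums cinner (F h x) y" if "orthonormal h" for h x y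
    using bounded_linear.sums[OF bounded_linear_cinner_left summable_sums[OF orthonormal_summable[OF that bessel[OF e]]], of x y]
    by (simp add: F_def cinner_scaleC_left)
  have F_right: "cinner (F h x) (h k) = cinner x (e k)" if "orthonormal h" for h x k
  proof -
    have "(\<lambda>j. cinner x (e j) * cinner (h j) (h k)) = (\<lambda>j. if j = k then cinner x (e j) else 0)"
      using that by (simp add: orthonormal_def fun_eq_iff)
    then have "(\<lambda>j. cinner x (e j) * cinner (h j) (h k)) sums cinner x (e k)"
      using sums_single[of k "\<lambda>j. cinner x (e j)"] by (simp only:)
    then show ?thesis using F_left[OF that] sums_unique2 by blast
  qed
  have F_F: "(\<lambda>k. cinner x (e k) * cnj (cinner y (e k))) sums cinner (F h x) (F h y)" if "orthonormal h" for h x y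
  proof -
    have "cinner (h k) (F h y) = cnj (cinner y (e k))" for k
      using F_right[OF that, of y k] cinner_commute[of "h k" "F h y"] by simp
    then show ?thesis using F_left[OF that, of x "F h y"] by simp
  qed
  define p where "p = (\<lambda>x. x - F e x)"
  have p_e: "cinner (p x) (e k) = 0" for x k
    using F_right[OF e] by (simp add: p_def cinner_diff_left)
  have F_p: "cinner (F h x) (p y) = 0 \<and> cinner (p y) (F h x) = 0" if "orthonormal h" "h = e \<or> h = g" for h x y
  proof -
    have "cinner (h k) (p y) = 0" for k
      using that(2) p_e cinner_commute[of "h k" "p y"] by (auto simp: g_def)
    then have "(\<lambda>k. 0) sums cinner (F h x) (p y)" using F_left[OF that(1), of x "p y"] by simp
    then have "cinner (F h x) (p y) = 0" using sums_unique2[OF _ sums_zero] by blast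
    then show ?thesis using cinner_commute[of "p y" "F h x"] by simp
  qed
  define v where "v = (\<lambda>x. p x + F g x)"
  have iso: "cinner (v x) (v y) = cinner x y" for x y
  proof -
    have "cinner (v x) (v y) = cinner (p x) (p y) + cinner (F g x) (F g y)"
      using F_p[OF g] by (simp add: v_def cinner_simps)
    also have "cinner (F g x) (F g y) = cinner (F e x) (F e y)"
      by (rule sums_unique2[OF F_F[OF g] F_F[OF e]])
    also have "cinner (p x) (p y) + cinner (F e x) (F e y) = cinner (p x + F e x) (p y + F e y)"
      using F_p[OF e] by (simp only: cinner_add_left cinner_add_right) simp
    finally show ?thesis by (simp add: p_def)
  qed
  have v_norm: "norm (v x) = norm x" for x
  proof -
    have "(norm (v x))\<^sup>2 = (norm x)\<^sup>2" using iso[of x x] unfolding cinner_self of_real_eq_iff .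
    then show ?thesis by simp
  qed
  have lin_zero: "z = 0" if "cinner z z = 0" for z :: 'h using that by (simp add: cinner_self)
  \<comment> \<open>A map that preserves inner products is linear.\<close>
  have v_add: "v (x + y) = v x + v y" for x y
  proof -
    have "cinner (v (x + y) - v x - v y) (v (x + y) - v x - v y) = 0"
      by (simp only: cinner_diff_left cinner_diff_right iso cinner_add_left cinner_add_right) simp
    from lin_zero[OF this] show ?thesis by (simp add: algebra_simps)
  qed
  have v_sc: "v (c *\<^sub>C x) = c *\<^sub>C v x" for c x
  proof -
    have "cinner (v (c *\<^sub>C x) - c *\<^sub>C v x) (v (c *\<^sub>C x) - c *\<^sub>C v x) = 0"
      by (simp only: cinner_diff_left cinner_diff_right iso cinner_scaleC_left cinner_scaleC_right) simp
    from lin_zero[OF this] show ?thesis by simp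
  qed
  have v_bl: "bounded_linear v"
    by (rule bounded_linear_intro[where K = 1]) (auto simp: v_add v_norm v_sc[of "of_real _", unfolded scaleC_of_real])
  have "\<exists>z. \<forall>x. cinner (v x) y = cinner x z" for y
    by (rule riesz) (auto intro: bounded_linear_compose[OF bounded_linear_cinner_left v_bl] simp: v_sc cinner_scaleC_left)
  then obtain v' where v': "\<And>x y. cinner (v x) y = cinner x (v' y)" by metis
  have "v a = a" if "a \<in> A" for a
    using eA[OF that] by (simp add: v_def p_def F_def)
  moreover have "v' (e j) = 0" if j: "j < m" for j
  proof -
    have "cinner (F g x) (e j) = 0" for x
    proof -
      have "cinner (g k) (e j) = 0" for k using e j by (simp add: orthonormal_def g_def)
      then have "(\<lambda>k. 0) sums cinner (F g x) (e j)" using F_left[OF g, of x "e j"] by simp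
      then show ?thesis using sums_unique2[OF _ sums_zero] by blast
    qed
    then have "cinner (v x) (e j) = 0" for x by (simp add: v_def cinner_add_left p_e)
    then have "cinner (v' (e j)) (v' (e j)) = 0" using v' by metis
    then show ?thesis by (rule lin_zero)
  qed
  ultimately show ?thesis using e iso v' by blast
qed

section \<open>Adding Parrott's example as a direct summand\<close>

lemma sinh_bound: "t * exp (t / 2) \<le> exp t - 1" if "t \<ge> 0" for t :: real
proof -
  let ?f = "\<lambda>x::real. exp x - exp (- x) - 2 * x"
  have "?f 0 \<le> ?f (t / 2)"
  proof (rule DERIV_nonneg_imp_nondecreasing[where f = ?f])
    fix x :: real
    have "(?f has_real_derivative exp x + exp (- x) - 2) (at x)"
      by (auto intro!: derivative_eq_intros)
    moreover have "exp x + exp (- x) - 2 \<ge> 0"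
    proof -
      have "exp x + exp (- x) - 2 = (exp (x / 2) - exp (- (x / 2)))\<^sup>2"
        by (simp add: power2_diff exp_double[symmetric] exp_minus_inverse flip: exp_add)
      then show ?thesis by simp
    qed
    ultimately show "\<exists>y. (?f has_real_derivative y) (at x) \<and> y \<ge> 0" by blast
  qed (use that in simp)
  then have "t \<le> exp (t / 2) - exp (- (t / 2))" by simp
  then have "t * exp (t / 2) \<le> (exp (t / 2) - exp (- (t / 2))) * exp (t / 2)" by (simp add: mult_right_mono)
  also have "\<dots> = exp t - 1" by (simp add: left_diff_distrib flip: exp_add)
  finally show ?thesis .
qed

text \<open>
  The difference of the two sides is a quadratic form in \<open>(a, b)\<close> with determinant \<open>l\<^sup>2 - l t\<^sup>2 - t\<^sup>2\<close>, where \<open>l = e\<^sup>t - 1\<close>;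
  it is nonnegative since \<open>t e\<^bsup>t/2\<^esup> \<le> l\<close>, i.e. \<open>t/2 \<le> sinh (t/2)\<close>. This is contractivity of \<open>e\<^bsup>-t/2\<^esup>(1 + t N)\<close> for the
  extreme nilpotent \<open>N\<close>.
\<close>

lemma nilpotent_contraction_bound:
  fixes a b t :: real
  assumes t: "t \<ge> 0"
  shows "a\<^sup>2 + b\<^sup>2 + 2 * t * (a * b) + t\<^sup>2 * a\<^sup>2 \<le> exp t * (a\<^sup>2 + b\<^sup>2)"
proof (cases "t = 0")
  case False
  define l where "l = exp t - 1"
  have "l > 0" using t False by (simp add: l_def)
  have "(t * exp (t / 2))\<^sup>2 \<le> l\<^sup>2" unfolding l_def using sinh_bound[OF t] t by (intro power_mono) auto
  moreover have "(t * exp (t / 2))\<^sup>2 = t\<^sup>2 * (l + 1)" by (simp add: power_mult_distrib l_def flip: exp_double)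
  ultimately have l: "0 \<le> l\<^sup>2 - l * t\<^sup>2 - t\<^sup>2" by (simp add: algebra_simps)
  have "l * ((l - t\<^sup>2) * a\<^sup>2 - 2 * t * (a * b) + l * b\<^sup>2) = (l * b - t * a)\<^sup>2 + (l\<^sup>2 - l * t\<^sup>2 - t\<^sup>2) * a\<^sup>2"
    by (simp add: power2_eq_square algebra_simps)
  also have "\<dots> \<ge> 0" using l by simp
  finally have "0 \<le> (l - t\<^sup>2) * a\<^sup>2 - 2 * t * (a * b) + l * b\<^sup>2"
    using \<open>l > 0\<close> by (simp add: zero_le_mult_iff)
  then show ?thesis by (simp add: l_def algebra_simps)
qed simp

text \<open>
  The orthogonal complement of the range of \<open>v\<close> contains \<open>e 0, \<dots>, e 3\<close>, on which Parrott's operators \<open>N i\<close> act.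
\<close>

locale deficient_isometry =
  fixes v v' :: "'h \<Rightarrow> 'h::complex_hilbert" and e :: "nat \<Rightarrow> 'h"
  assumes e: "orthonormal e" and v_iso: "cinner (v x) (v y) = cinner x y"
    and v_adj: "cinner (v x) y = cinner x (v' y)" and v'_e [simp]: "j < 4 \<Longrightarrow> v' (e j) = 0"
begin

lemma v'_v [simp]: "v' (v x) = x"
proof (rule cinner_ext)
  fix y
  have "cinner (v' (v x)) y = cnj (cinner y (v' (v x)))" by (rule cinner_commute)
  also have "\<dots> = cnj (cinner y x)" by (simp add: v_adj[symmetric] v_iso)
  finally show "cinner (v' (v x)) y = cinner x y" by (simp add: cinner_commute[symmetric])
qed

lemma v_adj': "cinner x (v y) = cinner (v' x) y"
  using v_adj[of y x] cinner_commute[of x "v y"] cinner_commute[of "v' x" y] by simp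

lemma v_add: "v (x + y) = v x + v y"
  by (rule cinner_ext) (simp add: v_adj cinner_add_left)
lemma v_sc: "v (c *\<^sub>C x) = c *\<^sub>C v x"
  by (rule cinner_ext) (simp add: v_adj cinner_scaleC_left)
lemma v'_add: "v' (x + y) = v' x + v' y"
  by (rule cinner_ext) (simp add: v_adj'[symmetric] cinner_add_left)
lemma v'_sc: "v' (c *\<^sub>C x) = c *\<^sub>C v' x"
  by (rule cinner_ext) (simp add: v_adj'[symmetric] cinner_scaleC_left)
lemma v'_diff: "v' (x - y) = v' x - v' y"
  by (rule cinner_ext) (simp add: v_adj'[symmetric] cinner_diff_left)
lemma v_0 [simp]: "v 0 = 0" and v'_0 [simp]: "v' 0 = 0"
  using v_sc[of 0 0] v'_sc[of 0 0] by simp_all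
lemma norm_v: "norm (v x) = norm x"
proof -
  have "(norm (v x))\<^sup>2 = (norm x)\<^sup>2" using v_iso[of x x] unfolding cinner_self of_real_eq_iff .
  then show ?thesis by simp
qed

lemma bounded_linear_v: "bounded_linear v"
  by (rule bounded_linear_intro[where K = 1]) (auto simp: v_add norm_v v_sc[of "of_real _", unfolded scaleC_of_real])

lemma e_ip: "cinner (e i) (e j) = (if i = j then 1 else 0)"
  using e by (simp add: orthonormal_def)

lemma v_e: "j < 4 \<Longrightarrow> cinner (v x) (e j) = 0" "j < 4 \<Longrightarrow> cinner (e j) (v x) = 0"
  by (simp_all add: v_adj v_adj')

definition p :: "'h \<Rightarrow> 'h" where "p x = x - v (v' x)"

fun N :: "nat \<Rightarrow> 'h \<Rightarrow> 'h" where
  "N i x = (if i = 1 then cinner x (e 0) *\<^sub>C e 2 + cinner x (e 1) *\<^sub>C e 3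
     else if i = 2 then cinner x (e 0) *\<^sub>C e 2 - cinner x (e 1) *\<^sub>C e 3
     else if i = 3 then cinner x (e 0) *\<^sub>C e 3 else 0)"

lemma p_add: "p (x + y) = p x + p y" and p_sc: "p (c *\<^sub>C x) = c *\<^sub>C p x"
  by (simp_all add: p_def v_add v'_add v_sc v'_sc scaleC_diff_right)

lemma N_add: "N i (x + y) = N i x + N i y"
  by (simp add: cinner_add_left scaleC_add_left scaleC_diff_right)

lemma N_sc: "N i (c *\<^sub>C x) = c *\<^sub>C N i x"
  by (simp add: cinner_scaleC_left scaleC_scaleC[symmetric] scaleC_add_right scaleC_diff_right)

lemma p_v [simp]: "p (v x) = 0" and v'_p [simp]: "v' (p x) = 0"
  by (simp_all add: p_def v'_diff)

lemma p_p [simp]: "p (p x) = p x"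
  using v'_p[of x] by (simp add: p_def[of "p x"])

lemma p_e [simp]: "j < 4 \<Longrightarrow> p (e j) = e j"
  by (simp add: p_def)

lemma v'_N [simp]: "v' (N i x) = 0"
  by (simp add: v'_add v'_diff v'_sc)

lemma p_N [simp]: "p (N i x) = N i x"
  using v'_N[of i x] by (simp add: p_def del: N.simps)

lemma p_ip_e: "j < 4 \<Longrightarrow> cinner (p x) (e j) = cinner x (e j)"
  by (simp add: p_def cinner_diff_left v_e)

lemma N_p [simp]: "N i (p x) = N i x"
  by (simp add: p_ip_e)

lemma N_v [simp]: "N i (v x) = 0"
  by (simp add: v_e)

lemma N_N [simp]: "N i (N j x) = 0"
  by (simp add: cinner_simps e_ip)

text \<open>
  Only the components of \<open>z\<close> along \<open>e 0\<close> and \<open>e 1\<close> enter \<open>N i z\<close>, and \<open>N i z\<close> is orthogonal to them. With \<open>a\<close> and \<open>b\<close>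
  the norms of these components and of the rest, the estimate reduces to real numbers.
\<close>

lemma norm_add_N: 
  assumes t: "t \<ge> 0"
  shows "(norm (z + t *\<^sub>R N i z))\<^sup>2 \<le> exp t * (norm z)\<^sup>2"
proof -
  define y where "y = cinner z (e 0) *\<^sub>C e 0 + cinner z (e 1) *\<^sub>C e 1"
  define a where "a = norm y"
  define b where "b = norm (z - y)"
  define z0 z1 where "z0 = cinner z (e 0)" and "z1 = cinner z (e 1)"
  have "cinner y y = z0 * cnj z0 + z1 * cnj z1"
    unfolding y_def z0_def z1_def by (simp add: cinner_simps e_ip mult.commute)
  also have "\<dots> = complex_of_real ((cmod z0)\<^sup>2 + (cmod z1)\<^sup>2)"
    by (simp only: of_real_add complex_norm_square)
  finally have a: "a\<^sup>2 = (cmod z0)\<^sup>2 + (cmod z1)\<^sup>2"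
    unfolding a_def cinner_self of_real_eq_iff .
  have yz: "cinner y (z - y) = 0"
    using cinner_commute[of "e 0" z] cinner_commute[of "e 1" z]
    by (simp add: y_def cinner_simps e_ip)
  then have "cinner z z = cinner y y + cinner (z - y) (z - y)"
    using cinner_commute[of "z - y" y] by (simp add: cinner_simps)
  then have z: "(norm z)\<^sup>2 = a\<^sup>2 + b\<^sup>2"
    unfolding a_def b_def cinner_self of_real_add[symmetric] of_real_eq_iff .
  define r where "r = (if i = 1 \<or> i = 2 then (cmod z0)\<^sup>2 + (cmod z1)\<^sup>2 else if i = 3 then (cmod z0)\<^sup>2 else 0)"
  have "cinner (N i z) (N i z) = (if i = 1 \<or> i = 2 then z0 * cnj z0 + z1 * cnj z1 else if i = 3 then z0 * cnj z0 else 0)"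
    unfolding z0_def z1_def by (simp add: cinner_simps e_ip mult.commute)
  also have "\<dots> = complex_of_real r"
    unfolding r_def by (simp only: of_real_add complex_norm_square of_real_0 split: if_split) simp
  finally have "(norm (N i z))\<^sup>2 = r" unfolding cinner_self of_real_eq_iff .
  then have Na2: "(norm (N i z))\<^sup>2 \<le> a\<^sup>2" unfolding a r_def by simp
  then have Na: "norm (N i z) \<le> a" by (rule power2_le_imp_le) (simp add: a_def)
  have "cinner y (N i z) = 0" by (simp add: y_def cinner_simps e_ip)
  then have "cinner z (N i z) = cinner (z - y) (N i z)" by (simp add: cinner_diff_left del: N.simps)
  then have "cmod (cinner z (N i z)) \<le> b * norm (N i z)" using cinner_bound by (simp add: b_def del: N.simps)
  also have "\<dots> \<le> b * a" using Na by (simp add: b_def mult_left_mono del: N.simps)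
  finally have cross: "Re (cinner z (N i z)) \<le> a * b"
    using complex_Re_le_cmod[of "cinner z (N i z)"] by (simp add: mult.commute del: N.simps)
  have "(norm (z + t *\<^sub>R N i z))\<^sup>2 = (norm z)\<^sup>2 + 2 * t * Re (cinner z (N i z)) + t\<^sup>2 * (norm (N i z))\<^sup>2"
    unfolding power2_norm_eq_inner Re_cinner by (simp add: inner_simps inner_commute power2_eq_square algebra_simps del: N.simps)
  also have "\<dots> \<le> (a\<^sup>2 + b\<^sup>2) + 2 * t * (a * b) + t\<^sup>2 * a\<^sup>2"
    unfolding z using t cross Na2
    by (intro add_mono mult_left_mono) auto
  also have "\<dots> \<le> exp t * (norm z)\<^sup>2" unfolding z using nilpotent_contraction_bound[OF t, of a b] by simp
  finally show ?thesis .
qed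

declare N.simps [simp del]

definition P :: "nat \<Rightarrow> real \<Rightarrow> 'h \<Rightarrow> 'h" where
  "P i t x = exp (- t / 2) *\<^sub>R (p x + t *\<^sub>R N i x)"

lemma scR: "of_real t *\<^sub>C x = t *\<^sub>R (x::'h)" by (rule scaleC_of_real)

lemma linear_scR:
  "v (t *\<^sub>R x) = t *\<^sub>R v x" "v' (t *\<^sub>R x) = t *\<^sub>R v' x" "p (t *\<^sub>R x) = t *\<^sub>R p x" "N i (t *\<^sub>R x) = t *\<^sub>R N i x"
  using v_sc[of "of_real t" x] v'_sc[of "of_real t" x] p_sc[of "of_real t" x] N_sc[of i "of_real t" x] by (simp_all only: scR)

lemma P_add: "P i t (x + y) = P i t x + P i t y"
  by (simp add: P_def p_add N_add scaleR_add_right algebra_simps)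

lemma P_sc: "P i t (c *\<^sub>C x) = c *\<^sub>C P i t x"
  by (simp add: P_def p_sc N_sc scaleC_scaleR scaleC_add_right)

lemma P_v [simp]: "P i t (v x) = 0" and v'_P [simp]: "v' (P i t x) = 0"
  by (simp_all add: P_def linear_scR v'_add)

lemma P_0: "P i 0 x = p x" by (simp add: P_def)

lemma P_P: "P i s (P j t x) = exp (- (s + t) / 2) *\<^sub>R (p x + t *\<^sub>R N j x + s *\<^sub>R N i x)"
proof -
  have "exp (- (s + t) / 2) = exp (- s / 2) * exp (- t / 2)"
    unfolding exp_add[symmetric] by (simp add: field_simps)
  then show ?thesis by (simp add: P_def linear_scR p_add N_add algebra_simps)
qed

lemma norm_P: assumes "t \<ge> 0" shows "(norm (P i t x))\<^sup>2 \<le> (norm (p x))\<^sup>2"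
proof -
  have "(norm (P i t x))\<^sup>2 = (exp (- t / 2))\<^sup>2 * (norm (p x + t *\<^sub>R N i (p x)))\<^sup>2"
    by (simp add: P_def power_mult_distrib)
  also have "\<dots> \<le> (exp (- t / 2))\<^sup>2 * (exp t * (norm (p x))\<^sup>2)"
    by (intro mult_left_mono norm_add_N assms) simp
  also have "(exp (- t / 2))\<^sup>2 * (exp t * (norm (p x))\<^sup>2) = (norm (p x))\<^sup>2"
    by (simp add: exp_double[symmetric] mult.assoc[symmetric] flip: exp_add)
  finally show ?thesis .
qed

lemma v_P_orth: "cinner (v x) (P i t y) = 0"
  by (simp add: v_adj)

lemma norm_orth: "cinner x y = 0 \<Longrightarrow> (norm (x + y))\<^sup>2 = (norm x)\<^sup>2 + (norm (y::'h))\<^sup>2"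
  using Re_cinner[of x y] by (simp add: power2_norm_eq_inner inner_simps inner_commute)

text \<open>
  The direct sum of \<open>v T v'\<close> on the range of \<open>v\<close> and of the example on its complement, i.e. of a copy of \<open>T\<close> and
  Parrott's semigroups.
\<close>

definition add_block :: "nat \<Rightarrow> 'h tuple \<Rightarrow> 'h tuple" where
  "add_block d T = (\<lambda>i\<in>{1..d}. \<lambda>t\<in>{0..}. \<lambda>x. v (T i t (v' x)) + P i t x)"

lemma add_block_eq: "i \<in> {1..d} \<Longrightarrow> t \<ge> 0 \<Longrightarrow> add_block d T i t x = v (T i t (v' x)) + P i t x"
  by (simp add: add_block_def)

lemma add_block_semigroup:
  assumes T: "contractive_C0_semigroup (T i)" and i: "i \<in> {1..d}"
  shows "contractive_C0_semigroup (add_block d T i)"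
proof -
  let ?S = "add_block d T i"
  have TD: "bounded_linear (T i t)" "onorm (T i t) \<le> 1" "T i t (c *\<^sub>C x) = c *\<^sub>C T i t x" if "t \<ge> 0" for t c x
    using T that by (auto simp: contractive_C0_semigroup_def)
  have T0: "T i 0 = id" and T_add: "\<And>s t x. s \<ge> 0 \<Longrightarrow> t \<ge> 0 \<Longrightarrow> T i (s + t) x = T i s (T i t x)"
    and T_cont: "\<And>x. continuous_on {0..} (\<lambda>t. T i t x)"
    using T by (auto simp: contractive_C0_semigroup_def comp_def)
  have T_norm: "norm (T i t x) \<le> norm x" if "t \<ge> 0" for t x
    using onorm[OF TD(1)[OF that], of x] TD(2)[OF that] mult_right_mono[of "onorm (T i t)" 1 "norm x"] by simp
  have S: "?S t x = v (T i t (v' x)) + P i t x" if "t \<ge> 0" for t x by (rule add_block_eq[OF i that])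
  have S_norm: "norm (?S t x) \<le> norm x" if t: "t \<ge> 0" for t x
  proof (rule power2_le_imp_le)
    have "(norm (?S t x))\<^sup>2 = (norm (T i t (v' x)))\<^sup>2 + (norm (P i t x))\<^sup>2"
      unfolding S[OF t] norm_orth[OF v_P_orth] norm_v by simp
    also have "\<dots> \<le> (norm (v' x))\<^sup>2 + (norm (p x))\<^sup>2"
      by (intro add_mono norm_P[OF t] power_mono T_norm[OF t]) simp
    also have "\<dots> = (norm (v (v' x) + p x))\<^sup>2"
      by (subst norm_orth) (simp_all add: v_adj norm_v)
    also have "v (v' x) + p x = x" by (simp add: p_def)
    finally show "(norm (?S t x))\<^sup>2 \<le> (norm x)\<^sup>2" .
  qed simp
  have S_sc: "?S t (c *\<^sub>C x) = c *\<^sub>C ?S t x" if "t \<ge> 0" for t c x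
    using that by (simp add: S v_sc v'_sc P_sc TD(3) scaleC_add_right)
  have S_bl: "bounded_linear (?S t)" if t: "t \<ge> 0" for t
  proof (rule bounded_linear_intro[where K = 1])
    interpret bounded_linear "T i t" by (rule TD(1)[OF t])
    show "?S t (x + y) = ?S t x + ?S t y" for x y
      using t by (simp add: S v'_add v_add P_add add)
    show "?S t (r *\<^sub>R x) = r *\<^sub>R ?S t x" for r x
      using S_sc[OF t, of "of_real r" x] by (simp only: scaleC_of_real)
  qed (use S_norm t in auto)
  have "onorm (?S t) \<le> 1" if "t \<ge> 0" for t
    using S_norm[OF that] by (intro onorm_bound) auto
  moreover have "?S 0 = id" by (rule ext) (simp add: S T0 P_0 p_def)
  moreover have "?S (s + t) = ?S s \<circ> ?S t" if s: "s \<ge> 0" and t: "t \<ge> 0" for s t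
  proof
    fix x
    have "?S s (?S t x) = v (T i s (T i t (v' x))) + P i s (P i t x)"
      unfolding S[OF s] unfolding S[OF t] by (simp add: v'_add P_add)
    also have "P i s (P i t x) = P i (s + t) x"
      unfolding P_P by (simp add: P_def algebra_simps)
    also have "v (T i s (T i t (v' x))) + P i (s + t) x = ?S (s + t) x"
      using s t by (simp add: S T_add)
    finally show "?S (s + t) x = (?S s \<circ> ?S t) x" by simp
  qed
  moreover have "continuous_on {0..} (\<lambda>t. ?S t x)" for x
  proof -
    have "continuous_on {0..} (\<lambda>t. v (T i t (v' x)) + P i t x)"
      unfolding P_def
      by (intro continuous_intros bounded_linear.continuous_on[OF bounded_linear_v] T_cont) auto
    then show ?thesis by (rule continuous_on_eq) (simp add: S)
  qed
  moreover have "?S \<in> extensional {0..}" using i by (simp add: add_block_def)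
  ultimately show ?thesis using S_sc S_bl by (simp add: contractive_C0_semigroup_def)
qed

lemma add_block_commuting:
  assumes T: "T \<in> commuting_tuples d"
  shows "add_block d T \<in> commuting_tuples d"
  unfolding commuting_tuples_def
proof (intro CollectI conjI ballI allI impI)
  show "add_block d T \<in> extensional {1..d}" by (simp add: add_block_def)
  show "contractive_C0_semigroup (add_block d T i)" if "i \<in> {1..d}" for i
    using T that by (intro add_block_semigroup) (auto simp: commuting_tuples_def)
  fix i j and s t :: real assume i: "i \<in> {1..d}" and j: "j \<in> {1..d}" and s: "0 \<le> s" and t: "0 \<le> t"
  have "T i s \<circ> T j t = T j t \<circ> T i s" using T i j s t by (simp add: commuting_tuples_def)
  from fun_cong[OF this] have comm: "T i s (T j t y) = T j t (T i s y)" for y by simp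
  show "add_block d T i s \<circ> add_block d T j t = add_block d T j t \<circ> add_block d T i s"
    by (rule ext) (use i j s t in \<open>simp add: add_block_eq v'_add P_add comm P_P algebra_simps\<close>)
qed

lemma word_add_block:
  assumes "set w \<subseteq> {1..d} \<times> {0..}"
  shows "word_op (add_block d T) w (v x) = v (word_op T w x)"
  using assms
proof (induction w)
  case (Cons a w)
  then obtain i t where "a = (i, t)" "i \<in> {1..d}" "t \<ge> 0" by auto
  with Cons show ?case by (simp add: word_op_def add_block_eq)
qed (simp add: word_op_def)

text \<open>
  The samples of \<open>e\<^bsup>-t/2\<^esup>\<langle>(1 + t N) \<xi>, \<eta>\<rangle>\<close> are \<open>c\<^sup>k k \<tau>\<close>. The coefficient is a geometric sum with value
  \<open>c \<tau> (1 - c\<^bsup>2n\<^esup>) / (1 - c\<^sup>2)\<close>, at least \<open>c (1 - c\<^bsup>2n\<^esup>)\<close> because \<open>1 - c\<^sup>2 = 1 - e\<^bsup>-\<tau>\<^esup> \<le> \<tau>\<close>.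
\<close>

lemma mobius_coeff_add_block:
  assumes T: "T \<in> commuting_tuples d" and i: "i \<in> {1..d}"
    and \<xi>: "v' \<xi> = 0" and eta: "cinner \<xi> \<eta> = 0" "cinner (N i \<xi>) \<eta> = 1"
  shows "Re (mobius_coeff (add_block d T) i \<xi> \<eta>) > 99/100"
proof -
  have T0: "T i t 0 = 0" if "t \<ge> 0" for t
  proof -
    have "bounded_linear (T i t)" using T i that by (simp add: commuting_tuples_def contractive_C0_semigroup_def)
    then show ?thesis by (intro linear_0 bounded_linear.linear)
  qed
  have S: "cinner (add_block d T i (real k * sample_step) \<xi>) \<eta> = complex_of_real (damping ^ k * (real k * sample_step))" for k
  proof -
    have t: "real k * sample_step \<ge> 0" by (simp add: sample_step_def)
    have "exp (- (real k * sample_step) / 2) = damping ^ k"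
      by (simp add: damping_def sample_step_def exp_of_nat_mult[symmetric])
    moreover have "p \<xi> = \<xi>" using \<xi> by (simp add: p_def)
    ultimately show ?thesis
      unfolding add_block_eq[OF i t] using \<xi> T0[OF t]
      by (simp add: P_def cinner_simps eta)
  qed
  have "mobius_coeff (add_block d T) i \<xi> \<eta> = complex_of_real (\<Sum>k<sample_count. damping ^ k * (damping ^ Suc k * (real (Suc k) * sample_step) - damping * (damping ^ k * (real k * sample_step))))"
    unfolding mobius_coeff_def S by simp
  also have "(\<Sum>k<sample_count. damping ^ k * (damping ^ Suc k * (real (Suc k) * sample_step) - damping * (damping ^ k * (real k * sample_step))))
      = (\<Sum>k<sample_count. damping * sample_step * (damping\<^sup>2) ^ k)"
    by (intro sum.cong refl) (simp add: algebra_simps power2_eq_square power_mult_distrib)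
  also have "\<dots> = damping * sample_step * (\<Sum>k<sample_count. (damping\<^sup>2) ^ k)"
    by (simp add: sum_distrib_left)
  finally have coeff: "Re (mobius_coeff (add_block d T) i \<xi> \<eta>) = damping * sample_step * (\<Sum>k<sample_count. (damping\<^sup>2) ^ k)"
    by simp
  have d2: "damping\<^sup>2 = exp (- 1 / 100)" by (simp add: damping_def flip: exp_double)
  have lt: "1 - damping\<^sup>2 > 0" unfolding d2 by simp
  have step: "1 - damping\<^sup>2 \<le> sample_step"
    unfolding d2 sample_step_def using exp_ge_add_one_self[of "- 1 / 100"] by simp
  have geo: "(1 - damping\<^sup>2) * (\<Sum>k<sample_count. (damping\<^sup>2) ^ k) = 1 - (damping\<^sup>2) ^ sample_count"
    by (rule one_diff_power_eq[symmetric])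
  have "(damping\<^sup>2) ^ sample_count = (damping ^ sample_count)\<^sup>2" by (simp add: power_mult[symmetric] mult.commute)
  also have "\<dots> \<le> (1 / 100)\<^sup>2" by (intro power_mono damping_power) (simp add: damping_def)
  finally have "9999/10000 \<le> (1 - damping\<^sup>2) * (\<Sum>k<sample_count. (damping\<^sup>2) ^ k)"
    unfolding geo by (simp add: power2_eq_square)
  also have "\<dots> \<le> sample_step * (\<Sum>k<sample_count. (damping\<^sup>2) ^ k)"
    by (intro mult_right_mono step sum_nonneg) simp
  finally have s: "9999/10000 \<le> sample_step * (\<Sum>k<sample_count. (damping\<^sup>2) ^ k)" .
  have "199/200 \<le> damping" unfolding damping_def using exp_ge_add_one_self[of "- 1 / 200"] by simp
  then have "199/200 * (9999/10000) \<le> damping * (sample_step * (\<Sum>k<sample_count. (damping\<^sup>2) ^ k))"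
    using s by (intro mult_mono) (auto simp: damping_def)
  then show ?thesis unfolding coeff by (simp add: mult.assoc)
qed

theorem parrott_like_add_block:
  assumes "T \<in> commuting_tuples d" "d \<ge> 3"
  shows "parrott_like (add_block d T) (e 0) (e 1) (e 2) (e 3)"
  unfolding parrott_like_def
  by (intro conjI mobius_coeff_add_block assms)
    (use assms(2) in \<open>simp_all add: e_ip cinner_simps N.simps\<close>)

end

theorem parrott_like_dense:
  fixes T :: "'h::complex_hilbert tuple"
  assumes inf: "infinite_dimensional TYPE('h)" and T: "T \<in> commuting_tuples d" and d: "d \<ge> 3" and A: "finite A"
  shows "\<exists>S e1 e2 f1 f2. S \<in> commuting_tuples d \<and> norm e1 = 1 \<and> norm e2 = 1 \<and> norm f1 = 1 \<and> norm f2 = 1 \<and>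
    parrott_like S e1 e2 f1 f2 \<and>
    (\<forall>t \<xi> \<eta>. t ` {1..d} \<subseteq> {0..} \<longrightarrow> \<xi> \<in> A \<longrightarrow> \<eta> \<in> A \<longrightarrow> cinner (tuple_op d S t \<xi>) \<eta> = cinner (tuple_op d T t \<xi>) \<eta>)"
proof -
  obtain v v' :: "'h \<Rightarrow> 'h" and e where e: "orthonormal e" and v: "\<And>x y. cinner (v x) (v y) = cinner x y"
    "\<And>x y. cinner (v x) y = cinner x (v' y)" "\<And>a. a \<in> A \<Longrightarrow> v a = a" "\<And>j. j < (4::nat) \<Longrightarrow> v' (e j) = 0"
    using isometry_with_deficiency[OF inf A, of 4] by blast
  interpret deficient_isometry v v' e by standard (use e v in auto)
  have unit: "norm (e j) = 1" for j
  proof -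
    have "complex_of_real ((norm (e j))\<^sup>2) = complex_of_real 1" using e_ip[of j j] unfolding cinner_self by simp
    then have "(norm (e j))\<^sup>2 = 1" unfolding of_real_eq_iff .
    then show ?thesis by (simp add: abs_square_eq_1)
  qed
  have "cinner (tuple_op d (add_block d T) t \<xi>) \<eta> = cinner (tuple_op d T t \<xi>) \<eta>"
    if t: "t ` {1..d} \<subseteq> {0..}" and "\<xi> \<in> A" "\<eta> \<in> A" for t \<xi> \<eta>
  proof -
    have w: "set (map (\<lambda>i. (i, t i)) [1..<Suc d]) \<subseteq> {1..d} \<times> {0..}" using t by (auto simp: image_subset_iff)
    have "tuple_op d (add_block d T) t \<xi> = v (tuple_op d T t \<xi>)"
      using word_add_block[OF w, of T \<xi>] v(3)[OF \<open>\<xi> \<in> A\<close>] by (simp add: tuple_op_def)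
    moreover have "v' \<eta> = \<eta>" using v'_v[of \<eta>] v(3)[OF \<open>\<eta> \<in> A\<close>] by simp
    ultimately show ?thesis by (simp add: v(2))
  qed
  then show ?thesis
    using add_block_commuting[OF T] parrott_like_add_block[OF T d] unit by blast
qed

section \<open>Genericity\<close>

lemma commuting_tuples_nonempty: "(commuting_tuples d :: 'h::complex_hilbert tuple set) \<noteq> {}"
proof -
  have "(\<lambda>i\<in>{1..d}. restrict (\<lambda>_. id) {0..}) \<in> (commuting_tuples d :: 'h tuple set)"
    using trivial_semigroup[where 'h = 'h] by (simp add: commuting_tuples_def)
  then show ?thesis by blast
qed

definition axis_time :: "nat \<Rightarrow> nat \<Rightarrow> real \<Rightarrow> nat \<Rightarrow> real" where
  "axis_time d i t = (\<lambda>j\<in>{1..d}. if j = i then t else 0)"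

lemma axis_time_in: "t \<ge> 0 \<Longrightarrow> axis_time d i t \<in> topspace (times_space d)"
  unfolding times_space_def axis_time_def by (simp add: PiE_iff)

lemma tuple_op_axis_time:
  assumes T: "T \<in> commuting_tuples d" and i: "i \<in> {1..d}"
  shows "tuple_op d T (axis_time d i t) = T i t"
proof -
  have T0: "T j 0 = id" if "j \<in> {1..d}" for j
    using T that by (simp add: commuting_tuples_def contractive_C0_semigroup_def)
  have "word_op T (map (\<lambda>j. (j, axis_time d i t j)) l) = (if i \<in> set l then T i t else id)"
    if "distinct l" "set l \<subseteq> {1..d}" for l
    using that by (induction l) (auto simp: word_op_def axis_time_def T0)
  moreover have l: "set [1..<Suc d] = {1..d}" by auto
  moreover have "distinct [1..<Suc d]" by (rule distinct_upt)
  ultimately show ?thesis using i unfolding tuple_op_def by (metis order_refl)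
qed

lemma mobius_coeff_continuous:
  assumes S: "S \<in> commuting_tuples d" and R: "R \<in> commuting_tuples d" and i: "i \<in> {1..d}"
    and close: "\<And>k. k \<le> sample_count \<Longrightarrow> cmod (cinner (R i (real k * sample_step) \<xi> - S i (real k * sample_step) \<xi>) \<eta>) < \<epsilon>"
  shows "Re (mobius_coeff S i \<xi> \<eta>) \<le> Re (mobius_coeff R i \<xi> \<eta>) + 2 * real sample_count * \<epsilon>"
proof -
  have c: "0 \<le> damping" "damping \<le> 1" by (simp_all add: damping_def)
  define a where "a = (\<lambda>k. cinner (R i (real k * sample_step) \<xi> - S i (real k * sample_step) \<xi>) \<eta>)"
  have "mobius_coeff R i \<xi> \<eta> - mobius_coeff S i \<xi> \<eta> =
      (\<Sum>k<sample_count. of_real (damping ^ k) * (a (Suc k) - of_real damping * a k))"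
    unfolding mobius_coeff_def sum_subtractf[symmetric] a_def cinner_diff_left
    by (intro sum.cong refl) (simp add: algebra_simps)
  also have "cmod \<dots> \<le> (\<Sum>k<sample_count. 2 * \<epsilon>)"
  proof (rule sum_norm_le)
    fix k assume "k \<in> {..<sample_count}"
    then have k: "cmod (a (Suc k)) < \<epsilon>" "cmod (a k) < \<epsilon>" using close[of "Suc k"] close[of k] by (simp_all add: a_def)
    have "damping * cmod (a k) \<le> 1 * cmod (a k)" using c by (intro mult_right_mono) auto
    then have "cmod (a (Suc k) - of_real damping * a k) \<le> 2 * \<epsilon>"
      using norm_triangle_ineq4[of "a (Suc k)" "of_real damping * a k"] k c by (simp add: norm_mult)
    moreover have "damping ^ k \<le> 1" using c by (simp add: power_le_one)
    ultimately have "damping ^ k * cmod (a (Suc k) - of_real damping * a k) \<le> 1 * (2 * \<epsilon>)"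
      using c by (intro mult_mono) auto
    then show "cmod (of_real (damping ^ k) * (a (Suc k) - of_real damping * a k)) \<le> 2 * \<epsilon>"
      using c by (simp add: norm_mult norm_power)
  qed
  finally have "cmod (mobius_coeff R i \<xi> \<eta> - mobius_coeff S i \<xi> \<eta>) \<le> 2 * real sample_count * \<epsilon>" by simp
  then show ?thesis
    using abs_Re_le_cmod[of "mobius_coeff R i \<xi> \<eta> - mobius_coeff S i \<xi> \<eta>"] by simp
qed

text \<open>
  The condition consists of finitely many strict inequalities, each of which involves the semigroup at finitely
  many times only.
\<close>

lemma parrott_like_open:
  assumes S: "S \<in> commuting_tuples d" and d: "d \<ge> 3" and P: "parrott_like S e1 e2 f1 f2"
  shows "\<exists>K F \<epsilon>. compactin (times_space d) K \<and> finite F \<and> \<epsilon> > 0 \<and>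
    (\<forall>R\<in>kwot_nbhd d S K F \<epsilon>. parrott_like R e1 e2 f1 f2)"
proof -
  define I where "I = {(1::nat, e1, f1), (1, e2, f2), (2, e1, f1), (2, e2, - f2), (3, e1, f2)}"
  have pl: "parrott_like R e1 e2 f1 f2 \<longleftrightarrow> (\<forall>(i, \<xi>, \<eta>)\<in>I. Re (mobius_coeff R i \<xi> \<eta>) > 99/100)" for R
    by (auto simp: parrott_like_def I_def)
  define \<delta> where "\<delta> = Min ((\<lambda>(i, \<xi>, \<eta>). Re (mobius_coeff S i \<xi> \<eta>) - 99/100) ` I)"
  have "finite I" "I \<noteq> {}" by (auto simp: I_def)
  then have "\<delta> > 0" using P unfolding \<delta>_def pl by (subst Min_gr_iff) auto
  have gap: "Re (mobius_coeff S i \<xi> \<eta>) \<ge> 99/100 + \<delta>" if "(i, \<xi>, \<eta>) \<in> I" for i \<xi> \<eta>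
  proof -
    have "\<delta> \<le> (\<lambda>(i, \<xi>, \<eta>). Re (mobius_coeff S i \<xi> \<eta>) - 99/100) (i, \<xi>, \<eta>)"
      unfolding \<delta>_def by (rule Min_le) (use \<open>finite I\<close> that in blast)+
    then show ?thesis by simp
  qed
  have n: "real sample_count > 0" by (simp add: sample_count_def)
  define \<epsilon> where "\<epsilon> = \<delta> / (4 * real sample_count)"
  have "\<epsilon> > 0" using \<open>\<delta> > 0\<close> n by (simp add: \<epsilon>_def)
  have \<epsilon>: "2 * real sample_count * \<epsilon> < \<delta>" using \<open>\<delta> > 0\<close> n by (simp add: \<epsilon>_def)
  define K where "K = (\<lambda>(i, k). axis_time d i (real k * sample_step)) ` ({1, 2, 3} \<times> {..sample_count})"
  define F where "F = snd ` I"
  have pos: "real k * sample_step \<ge> 0" for k by (simp add: sample_step_def)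
  have "compactin (times_space d) K"
    by (rule finite_imp_compactin) (use axis_time_in[OF pos] in \<open>auto simp: K_def\<close>)
  moreover have "finite F" unfolding F_def using \<open>finite I\<close> by simp
  moreover have "parrott_like R e1 e2 f1 f2" if R: "R \<in> kwot_nbhd d S K F \<epsilon>" for R
    unfolding pl
  proof clarify
    fix i \<xi> \<eta> assume I: "(i, \<xi>, \<eta>) \<in> I"
    have R_ct: "R \<in> commuting_tuples d" using R by (simp add: kwot_nbhd_def)
    have i3: "i \<in> {1, 2, 3}" using I by (auto simp: I_def)
    then have i: "i \<in> {1..d}" using d by auto
    have "cmod (cinner (R i (real k * sample_step) \<xi> - S i (real k * sample_step) \<xi>) \<eta>) < \<epsilon>"
      if "k \<le> sample_count" for k
    proof -
      have "axis_time d i (real k * sample_step) \<in> K" using i3 that unfolding K_def by force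
      moreover have "(\<xi>, \<eta>) \<in> F" using I by (force simp: F_def)
      ultimately have "cmod (cinner (tuple_op d R (axis_time d i (real k * sample_step)) \<xi> -
          tuple_op d S (axis_time d i (real k * sample_step)) \<xi>) \<eta>) < \<epsilon>"
        using R by (auto simp: kwot_nbhd_def)
      then show ?thesis by (simp only: tuple_op_axis_time[OF S i] tuple_op_axis_time[OF R_ct i])
    qed
    from mobius_coeff_continuous[OF S R_ct i this]
    show "99/100 < Re (mobius_coeff R i \<xi> \<eta>)" using gap[OF I] \<epsilon> by linarith
  qed
  ultimately show ?thesis using \<open>\<epsilon> > 0\<close> by blast
qed

definition parrott_like_tuples :: "nat \<Rightarrow> 'h::complex_hilbert tuple set" where
  "parrott_like_tuples d = {T \<in> commuting_tuples d. \<exists>e1 e2 f1 f2.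
     norm e1 = 1 \<and> norm e2 = 1 \<and> norm f1 = 1 \<and> norm f2 = 1 \<and> parrott_like T e1 e2 f1 f2}"

lemma parrott_like_tuples_noncommuting:
  "d \<ge> 3 \<Longrightarrow> parrott_like_tuples d \<subseteq> strictly_noncommuting_tuples d"
proof
  fix T :: "'h::complex_hilbert tuple"
  assume d: "d \<ge> 3" and "T \<in> parrott_like_tuples d"
  then obtain e1 e2 f1 f2 where T: "T \<in> commuting_tuples d" and P: "norm e1 = 1" "norm e2 = 1" "norm f1 = 1" "norm f2 = 1"
    "parrott_like T e1 e2 f1 f2" by (auto simp: parrott_like_tuples_def)
  show "T \<in> strictly_noncommuting_tuples d"
    unfolding strictly_noncommuting_tuples_def
    by (intro CollectI conjI T allI impI parrott_like_not_dilatable[OF d P])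
qed

lemma openin_parrott_like_tuples:
  assumes "d \<ge> 3"
  shows "openin (kwot d) (parrott_like_tuples d :: 'h::complex_hilbert tuple set)"
  unfolding openin_kwot
proof (intro conjI ballI)
  show "parrott_like_tuples d \<subseteq> (commuting_tuples d :: 'h tuple set)"
    by (auto simp: parrott_like_tuples_def)
  fix S :: "'h tuple" assume "S \<in> parrott_like_tuples d"
  then obtain e1 e2 f1 f2 where S: "S \<in> commuting_tuples d" and unit: "norm e1 = 1" "norm e2 = 1" "norm f1 = 1" "norm f2 = 1"
    and P: "parrott_like S e1 e2 f1 f2" by (auto simp: parrott_like_tuples_def)
  obtain K F \<epsilon> where KF: "compactin (times_space d) K" "finite F" "\<epsilon> > 0"
    and R: "\<forall>R\<in>kwot_nbhd d S K F \<epsilon>. parrott_like R e1 e2 f1 f2"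
    using parrott_like_open[OF S assms P] by blast
  have "kwot_nbhd d S K F \<epsilon> \<subseteq> parrott_like_tuples d"
  proof
    fix R assume "R \<in> kwot_nbhd d S K F \<epsilon>"
    then have "R \<in> commuting_tuples d" "parrott_like R e1 e2 f1 f2" using R by (auto simp: kwot_nbhd_def)
    then show "R \<in> parrott_like_tuples d" using unit unfolding parrott_like_tuples_def by blast
  qed
  then show "\<exists>K F \<epsilon>. compactin (times_space d) K \<and> finite F \<and> \<epsilon> > 0 \<and> kwot_nbhd d S K F \<epsilon> \<subseteq> parrott_like_tuples d"
    using KF by blast
qed

lemma parrott_like_tuples_dense:
  fixes U :: "'h::complex_hilbert tuple set"
  assumes d: "d \<ge> 3" and inf: "infinite_dimensional TYPE('h)" and U: "openin (kwot d) U" "U \<noteq> {}"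
  shows "U \<inter> parrott_like_tuples d \<noteq> {}"
proof -
  obtain T where "T \<in> U" using U(2) by blast
  then obtain K F \<epsilon> where K: "compactin (times_space d) K" and F: "finite F" and "\<epsilon> > 0"
    and nb: "kwot_nbhd d T K F \<epsilon> \<subseteq> U" and T: "T \<in> commuting_tuples d"
    using U(1) unfolding openin_kwot by blast
  define A where "A = fst ` F \<union> snd ` F"
  have "finite A" using F by (simp add: A_def)
  obtain S e1 e2 f1 f2 where S: "S \<in> commuting_tuples d"
    and P: "norm e1 = 1" "norm e2 = 1" "norm f1 = 1" "norm f2 = 1" "parrott_like S e1 e2 f1 f2"
    and eq: "\<And>t \<xi> \<eta>. t ` {1..d} \<subseteq> {0..} \<Longrightarrow> \<xi> \<in> A \<Longrightarrow> \<eta> \<in> A \<Longrightarrow>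
      cinner (tuple_op d S t \<xi>) \<eta> = cinner (tuple_op d T t \<xi>) \<eta>"
    using parrott_like_dense[OF inf T d \<open>finite A\<close>] by blast
  have "S \<in> kwot_nbhd d T K F \<epsilon>"
    unfolding kwot_nbhd_def
  proof (intro CollectI conjI ballI S, clarify)
    fix t \<xi> \<eta> assume t: "t \<in> K" and p: "(\<xi>, \<eta>) \<in> F"
    have "t \<in> topspace (times_space d)" using compactin_subset_topspace[OF K] t by blast
    then have "t ` {1..d} \<subseteq> {0..}" by (auto simp: times_space_def PiE_iff)
    moreover have "\<xi> \<in> A" "\<eta> \<in> A" using p unfolding A_def by force+
    ultimately show "cmod (cinner (tuple_op d S t \<xi> - tuple_op d T t \<xi>) \<eta>) < \<epsilon>"
      using eq \<open>\<epsilon> > 0\<close> by (simp add: cinner_diff_left)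
  qed
  moreover have "S \<in> parrott_like_tuples d" using S P unfolding parrott_like_tuples_def by blast
  ultimately show ?thesis using nb by blast
qed

lemma residual_in_if_open_dense:
  assumes O: "openin X O'" "O' \<subseteq> A" and A: "A \<subseteq> topspace X"
    and dense: "\<And>U. openin X U \<Longrightarrow> U \<noteq> {} \<Longrightarrow> U \<inter> O' \<noteq> {}"
  shows "residual_in X A"
proof -
  have "closedin X (topspace X - O')" using O(1) by blast
  then have "X closure_of (topspace X - A) \<subseteq> topspace X - O'"
    by (rule closure_of_minimal[rotated]) (use O(2) in blast)
  then have "X interior_of (X closure_of (topspace X - A)) \<inter> O' = {}"
    using interior_of_subset[of X "X closure_of (topspace X - A)"] by blast
  then have "X interior_of (X closure_of (topspace X - A)) = {}"
    using dense[OF openin_interior_of] by blast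
  then have "nowhere_dense_in X (topspace X - A)" by (simp add: nowhere_dense_in_def)
  then have "meagre_in X (topspace X - A)"
    unfolding meagre_in_def by (intro exI[of _ "{topspace X - A}"]) simp
  then show ?thesis using A by (simp add: residual_in_def)
qed

theorem strictly_noncommuting_tuples_residual:
  assumes d: "d \<ge> 3" and inf: "infinite_dimensional TYPE('h::complex_hilbert)"
  shows "residual_in (kwot d) (strictly_noncommuting_tuples d :: 'h tuple set)"
proof (rule residual_in_if_open_dense)
  show "strictly_noncommuting_tuples d \<subseteq> topspace (kwot d :: 'h tuple topology)"
    by (auto simp: strictly_noncommuting_tuples_def)
  show "openin (kwot d) (parrott_like_tuples d :: 'h tuple set)"
    by (rule openin_parrott_like_tuples[OF d])
  show "parrott_like_tuples d \<subseteq> (strictly_noncommuting_tuples d :: 'h tuple set)"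
    by (rule parrott_like_tuples_noncommuting[OF d])
qed (rule parrott_like_tuples_dense[OF d inf])

theorem strictly_noncommuting_tuples_nonempty:
  assumes d: "d \<ge> 3" and inf: "infinite_dimensional TYPE('h::complex_hilbert)"
  shows "strictly_noncommuting_tuples d \<noteq> ({} :: 'h tuple set)"
proof -
  have "openin (kwot d) (commuting_tuples d :: 'h tuple set)"
    by (metis openin_topspace topspace_kwot)
  then show ?thesis
    using parrott_like_tuples_dense[OF d inf _ commuting_tuples_nonempty] parrott_like_tuples_noncommuting[OF d] by blast
qed

theorem proposition6p5:
  fixes d :: nat
  shows
    "(d \<le> 2 \<longrightarrow> (strictly_noncommuting_tuples d :: 'h::complex_hilbert tuple set) = {}) \<and>
     (d \<ge> 3 \<and> infinite_dimensional TYPE('h) \<longrightarrow>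
       (strictly_noncommuting_tuples d :: 'h tuple set) \<noteq> {} \<and>
       (separable_space (euclidean :: 'h topology) \<longrightarrow>
         residual_in (kwot d) (strictly_noncommuting_tuples d :: 'h tuple set)))"
  using strictly_noncommuting_tuples_le_2[of d, where 'h = 'h]
    strictly_noncommuting_tuples_nonempty[of d, where 'h = 'h]
    strictly_noncommuting_tuples_residual[of d, where 'h = 'h] by blast

end
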